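(* Let $m,n\ge 2$ be integers and let $k\in\{1,\ldots,mn-1\}$. A linear map $\phi: M_{mn}\to M_{mn}$ satisfies $$W_k(\phi(A\otimes B)) = W_k(A\otimes B)\quad\text{for all } A\in M_m \text{ and } B\in M_n$$ if and only if there is a unitary $U\in M_{mn}$ such that one of the following holds: (i) for all $A\in M_m$, $B\in M_n$, $$\phi(A\otimes B)=U(\varphi(A\otimes B))U^*;$$ (ii) $mn=2k$ and for all $A\in M_m$, $B\in M_n$, $$\phi(A\otimes B)=(\operatorname{tr}(A\otimes B)/k)\,I_{mn}-U(\varphi(A\otimes B))U^*;$$ where $\varphi: M_{mn}\to M_{mn}$ is a linear map such that either (1) $\varphi$ is the identity map $A\otimes B\mapsto A\otimes B$ or the transposition map $A\otimes B\mapsto (A\otimes B)^t$, or (2) $\min\{m,n\}\le 2$ and $\varphi$ has the form $A\otimes B\mapsto A\otimes B^t$ or $A\otimes B\mapsto A^t\otimes B$ (each form holding for all $A\in M_m$, $B\in M_n$).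
   Context: $M_n$ denotes the set of $n\times n$ complex matrices, and linear means complex linear. $A\otimes B\in M_{mn}$ is the Kronecker (tensor) product of $A\in M_m$ and $B\in M_n$. $A^t$ is the transpose and $A^*$ the conjugate transpose. For $A\in M_N$ and $k\in\{1,\ldots,N\}$, the $k$-numerical range is $$W_k(A)=\{\operatorname{tr}(X^*AX)/k : X \text{ is a complex } N\times k \text{ matrix with } X^*X=I_k\}\subseteq\mathbb{C}.$$ *)

theory Defs
  imports
    "Jordan_Normal_Form.Schur_Decomposition"
    "Jordan_Normal_Form.VS_Connect"
begin

definition mat_trace :: "complex mat \<Rightarrow> complex" where
  "mat_trace A = (\<Sum>i<dim_row A. A $$ (i, i))"

definition unitary_mat :: "nat \<Rightarrow> complex mat \<Rightarrow> bool" where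
  "unitary_mat N U \<longleftrightarrow>
     U \<in> carrier_mat N N \<and> mat_adjoint U * U = 1\<^sub>m N \<and> U * mat_adjoint U = 1\<^sub>m N"

text \<open>Kronecker product: the block matrix whose block at position (i, j) is
  A $$ (i, j) times B. Indices are zero-based.\<close>

definition kron :: "complex mat \<Rightarrow> complex mat \<Rightarrow> complex mat" where
  "kron A B = mat (dim_row A * dim_row B) (dim_col A * dim_col B)
     (\<lambda>(i, j). A $$ (i div dim_row B, j div dim_col B) * B $$ (i mod dim_row B, j mod dim_col B))"

text \<open>Intended for square A and k between 1 and the size of A.\<close>

definition k_numerical_range :: "nat \<Rightarrow> complex mat \<Rightarrow> complex set" where
  "k_numerical_range k A =
     {mat_trace (mat_adjoint X * A * X) / of_nat k | X.
        X \<in> carrier_mat (dim_row A) k \<and> mat_adjoint X * X = 1\<^sub>m k}"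

text \<open>Complex linear maps from the N by N matrices to themselves. Values outside
  carrier_mat N N are irrelevant.\<close>

abbreviation mat_linear_map :: "nat \<Rightarrow> (complex mat \<Rightarrow> complex mat) \<Rightarrow> bool" where
  "mat_linear_map N f \<equiv>
     linear_map class_ring (module_mat TYPE(complex) N N) (module_mat TYPE(complex) N N) f"

end

theory Submission
  imports Defs "Jordan_Normal_Form.Spectral_Radius"
begin

text \<open>
  Throughout, \<open>N = m n\<close>, and \<open>k\<close> times a point of the \<open>k\<close>-numerical range of \<open>H\<close> is the sum of the
  values \<open>x*Hx\<close> over an orthonormal family of length \<open>k\<close>. Since \<open>N\<close> and \<open>k\<close> vary and dimensions have to be
  compared, vectors and matrices are handled as functions on the natural numbers of which only the values at
  indices below the dimension matter.

  The listed maps are preservers because the range is invariant under unitary similarity and under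
  transposition; because completing a family of length \<open>k\<close> to a basis turns a value for \<open>k\<close> into the trace minus
  a value for \<open>N - k\<close>, so that \<open>X \<mapsto> (tr X / k) I - X\<close> is a preserver if \<open>N = 2k\<close>; and because a
  \<open>2 \<times> 2\<close> matrix \<open>B\<close> is unitarily similar to its transpose, although by a unitary that depends on
  \<open>B\<close>, so that \<open>A \<otimes> B\<close> is unitarily similar to \<open>A \<otimes> B\<^sup>t\<close> (lemma \<open>transpose_similar_2\<close>).

  Conversely, let \<open>\<phi>\<close> be a preserver, let \<open>P = xx* \<otimes> yy*\<close> with unit vectors \<open>x\<close> and \<open>y\<close>, and let
  \<open>H = \<phi>(P)\<close>. All sums of the quadratic form of \<open>H\<close> over families of length \<open>k\<close> lie between 0 and 1, and both
  bounds are attained. In particular \<open>H\<close> is Hermitian. Non-Hermitian tensor products give more: the real part of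
  \<open>(xx* + \<i>x'x'*) \<otimes> (yy* \<plusminus> \<i>y'y'*)\<close> is \<open>P \<mp> P'\<close>, so for orthogonal product vectors some family gives the value
  1 at \<open>\<phi>(P)\<close> and 0 at \<open>\<phi>(P')\<close>, and, if \<open>k \<ge> 2\<close>, some family gives the value 1 at both (lemma \<open>attained_pair\<close>).
  By Ky Fan's principle a family that attains the maximum of \<open>H\<close> contains every eigenvector above the threshold
  between the \<open>k\<close>-th and the next eigenvalue, and is orthogonal to every eigenvector below it. Hence for the
  images \<open>H\<^sub>s\<close> of an orthonormal basis of product vectors the eigenvectors off the threshold are orthogonal to each
  other. There are \<open>N\<close> matrices \<open>H\<^sub>s\<close>, so each of them has exactly one such eigenvector and is a scalar plus a
  matrix of rank one. Testing leaves \<open>H\<^sub>s = vv*\<close> or, if \<open>N = 2k\<close>, \<open>H\<^sub>s = I/k - vv*\<close>, with the same sign for the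
  whole basis because the \<open>H\<^sub>s\<close> add up to \<open>I\<close> (theorem \<open>resolution_rank1\<close>). Product vectors with orthogonal left
  (or right) factors lie in a common product basis, so the sign is the same for all product vectors. Composing
  with \<open>X \<mapsto> (tr X / k) I - X\<close> if necessary, one may assume that \<open>\<phi>\<close> sends product bases to orthonormal bases
  (theorem \<open>basis_preserving_or_reflected\<close>), and after a unitary similarity that it fixes the diagonal matrix
  units.

  Then \<open>A \<mapsto> \<phi>(A \<otimes> E\<^sub>j\<^sub>j)\<close> lives in one block, sends rank one projections to rank one projections, and is
  therefore \<open>A\<close> or \<open>A\<^sup>t\<close> up to a diagonal unitary (theorem \<open>rank1_map_form\<close>); likewise on the other side.
  The factorization \<open>\<phi>(xx* \<otimes> yy*) = \<phi>(xx* \<otimes> I) \<phi>(I \<otimes> yy*)\<close>, in which the factors commute, forces the same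
  choice in all blocks and makes the diagonal unitaries fit together (theorem \<open>product_map_form\<close>). What remains is
  to exclude the partial transpositions for \<open>m, n \<ge> 3\<close>: for the weighted shift \<open>C = 2E\<^sub>0\<^sub>1 + E\<^sub>1\<^sub>2\<close> the sums of
  the \<open>k\<close> largest eigenvalues of the Hermitian parts of \<open>C \<otimes> C\<close> and \<open>C \<otimes> C\<^sup>t\<close> differ for every \<open>k\<close>
  (theorem \<open>partial_transpose_distinguished\<close>).
\<close>

section \<open>Orthonormal families\<close>

definition ip :: "nat \<Rightarrow> (nat \<Rightarrow> complex) \<Rightarrow> (nat \<Rightarrow> complex) \<Rightarrow> complex" where
  "ip N x y = (\<Sum>i<N. cnj (x i) * y i)"

definition orthonormal :: "nat \<Rightarrow> nat \<Rightarrow> (nat \<Rightarrow> nat \<Rightarrow> complex) \<Rightarrow> bool" where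
  "orthonormal N k u \<longleftrightarrow> (\<forall>a<k. \<forall>b<k. ip N (u a) (u b) = of_bool (a = b))"

lemma orthonormalD: "orthonormal N k u \<Longrightarrow> a < k \<Longrightarrow> b < k \<Longrightarrow> ip N (u a) (u b) = of_bool (a = b)"
  by (auto simp: orthonormal_def)

lemma orthonormal_mono: "orthonormal N k u \<Longrightarrow> l \<le> k \<Longrightarrow> orthonormal N l u"
  by (auto simp: orthonormal_def)

lemma orthonormal_reindex:
  assumes "orthonormal N k u" "inj_on \<pi> {..<l}" "\<And>a. a < l \<Longrightarrow> \<pi> a < k"
  shows "orthonormal N l (\<lambda>a. u (\<pi> a))"
  unfolding orthonormal_def
proof (intro allI impI)
  fix a b assume ab: "a < l" "b < l"
  then have "\<pi> a = \<pi> b \<longleftrightarrow> a = b" using assms(2) by (auto simp: inj_on_def)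
  then show "ip N (u (\<pi> a)) (u (\<pi> b)) = of_bool (a = b)"
    using orthonormalD[OF assms(1) assms(3)[OF ab(1)] assms(3)[OF ab(2)]] by simp
qed

lemma cnj_ip: "cnj (ip N x y) = ip N y x"
  by (simp add: ip_def mult.commute)

lemma ip_sum_right: "ip N x (\<lambda>i. \<Sum>a\<in>S. c a * y a i) = (\<Sum>a\<in>S. c a * ip N x (y a))"
proof -
  have "ip N x (\<lambda>i. \<Sum>a\<in>S. c a * y a i) = (\<Sum>i<N. \<Sum>a\<in>S. c a * (cnj (x i) * y a i))"
    by (simp add: ip_def sum_distrib_left mult.left_commute)
  also have "\<dots> = (\<Sum>a\<in>S. \<Sum>i<N. c a * (cnj (x i) * y a i))" by (rule sum.swap)
  finally show ?thesis by (simp add: ip_def sum_distrib_left)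
qed

lemma ip_sum_left: "ip N (\<lambda>i. \<Sum>a\<in>S. c a * y a i) x = (\<Sum>a\<in>S. cnj (c a) * ip N (y a) x)"
  using arg_cong[OF ip_sum_right[of N x c y S], of cnj] by (simp add: cnj_ip)

lemma ip_scale_right: "ip N x (\<lambda>i. c * y i) = c * ip N x y"
  by (simp add: ip_def sum_distrib_left mult.left_commute)

lemma ip_scale_left: "ip N (\<lambda>i. c * x i) y = cnj c * ip N x y"
  by (simp add: ip_def sum_distrib_left mult.assoc)

lemma ip_self: "ip N x x = of_real (\<Sum>i<N. (cmod (x i))\<^sup>2)"
  unfolding ip_def of_real_sum
  by (intro sum.cong refl) (metis complex_norm_square mult.commute of_real_power)

lemma ip_self_Re: "ip N x x = of_real (Re (ip N x x))"
  by (simp add: ip_self)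

lemma ip_self_nonneg: "0 \<le> Re (ip N x x)"
  by (simp add: ip_self sum_nonneg)

lemma ip_self_eq_0: "ip N x x = 0 \<longleftrightarrow> (\<forall>i<N. x i = 0)"
proof -
  have "ip N x x = 0 \<longleftrightarrow> (\<Sum>i<N. (cmod (x i))\<^sup>2) = 0"
    unfolding ip_self by (simp only: of_real_eq_0_iff)
  also have "\<dots> \<longleftrightarrow> (\<forall>i<N. x i = 0)" by (subst sum_nonneg_eq_0_iff) auto
  finally show ?thesis .
qed

lemma ip_cong: "(\<And>i. i < N \<Longrightarrow> x i = x' i) \<Longrightarrow> (\<And>i. i < N \<Longrightarrow> y i = y' i) \<Longrightarrow> ip N x y = ip N x' y'"
  by (simp add: ip_def)

lemma normalize:
  assumes "i < N" "x i \<noteq> 0"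
  shows "\<exists>c::complex. c \<noteq> 0 \<and> ip N (\<lambda>i. c * x i) (\<lambda>i. c * x i) = 1"
proof -
  let ?r = "Re (ip N x x)"
  have "ip N x x \<noteq> 0" using assms by (auto simp: ip_self_eq_0)
  then have r: "?r > 0" using ip_self_nonneg[of N x] ip_self_Re[of N x]
    by (metis less_eq_real_def of_real_0)
  have e: "ip N x x = of_real ?r" by (rule ip_self_Re)
  show ?thesis
  proof (intro exI[of _ "complex_of_real (1 / sqrt ?r)"] conjI)
    show "complex_of_real (1 / sqrt ?r) \<noteq> 0" using r by simp
    have "(1 / sqrt ?r) * (1 / sqrt ?r) * ?r = 1" using r by (simp add: field_simps)
    then have "complex_of_real ((1 / sqrt ?r) * ((1 / sqrt ?r) * ?r)) = 1"
      by (metis mult.assoc of_real_1)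
    then show "ip N (\<lambda>i. complex_of_real (1 / sqrt ?r) * x i) (\<lambda>i. complex_of_real (1 / sqrt ?r) * x i) = 1"
      unfolding ip_scale_left ip_scale_right complex_cnj_complex_of_real
      by (subst e) (simp only: of_real_mult)
  qed
qed

text \<open>A square isometry is unitary: the rows of the matrix with columns \<open>u s\<close> are orthonormal too.\<close>

lemma orthonormal_complete:
  assumes "orthonormal N N u" "i < N" "j < N"
  shows "(\<Sum>s<N. u s i * cnj (u s j)) = of_bool (i = j)"
proof -
  define U where "U = mat N N (\<lambda>(i, s). u s i)"
  define Ua where "Ua = mat N N (\<lambda>(s, i). cnj (u s i))"
  have "Ua * U = 1\<^sub>m N"
  proof (rule eq_matI)
    fix a b assume ab: "a < dim_row (1\<^sub>m N)" "b < dim_col (1\<^sub>m N)"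
    then have "(Ua * U) $$ (a, b) = ip N (u a) (u b)"
      by (simp add: U_def Ua_def ip_def scalar_prod_def lessThan_atLeast0)
    then show "(Ua * U) $$ (a, b) = 1\<^sub>m N $$ (a, b)"
      using ab orthonormalD[OF assms(1)] by simp
  qed (auto simp: U_def Ua_def)
  then have "U * Ua = 1\<^sub>m N"
    by (intro mat_mult_left_right_inverse[of Ua N U]) (auto simp: U_def Ua_def)
  then have "(U * Ua) $$ (i, j) = 1\<^sub>m N $$ (i, j)" by simp
  then show ?thesis using assms(2,3)
    by (simp add: U_def Ua_def scalar_prod_def lessThan_atLeast0)
qed

lemma orthonormal_expand:
  assumes "orthonormal N N u" "i < N"
  shows "x i = (\<Sum>s<N. ip N (u s) x * u s i)"
proof -
  have "(\<Sum>s<N. ip N (u s) x * u s i) = (\<Sum>s<N. \<Sum>j<N. x j * (u s i * cnj (u s j)))"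
    by (simp add: ip_def sum_distrib_left sum_distrib_right mult_ac)
  also have "\<dots> = (\<Sum>j<N. x j * (\<Sum>s<N. u s i * cnj (u s j)))"
    by (subst sum.swap) (simp add: sum_distrib_left)
  also have "\<dots> = (\<Sum>j<N. x j * of_bool (i = j))"
    by (intro sum.cong refl) (simp add: orthonormal_complete[OF assms])
  also have "\<dots> = x i" using assms(2) by (simp add: of_bool_def if_distrib sum.delta cong: if_cong)
  finally show ?thesis by simp
qed

lemma parseval_ip:
  assumes "orthonormal N N u"
  shows "ip N x y = (\<Sum>s<N. ip N x (u s) * ip N (u s) y)"
proof -
  have "ip N x y = ip N x (\<lambda>i. \<Sum>s<N. ip N (u s) y * u s i)"
    using orthonormal_expand[OF assms] by (intro ip_cong) auto
  then show ?thesis unfolding ip_sum_right by (simp add: mult.commute)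
qed

lemma parseval:
  assumes "orthonormal N N u"
  shows "ip N x x = of_real (\<Sum>s<N. (cmod (ip N (u s) x))\<^sup>2)"
  unfolding parseval_ip[OF assms, of x x] of_real_sum
  by (intro sum.cong refl) (metis cnj_ip complex_norm_square mult.commute of_real_power)

text \<open>A homogeneous system with fewer equations than unknowns has a nonzero solution, so an orthonormal family
  that is too short to be a basis leaves room for one more unit vector.\<close>

lemma orthonormal_extend_step:
  assumes "orthonormal N k u" "k < N"
  shows "\<exists>x. ip N x x = 1 \<and> (\<forall>a<k. ip N (u a) x = 0)"
proof -
  define M where "M = mat\<^sub>r N N (\<lambda>a. if a = k then 0\<^sub>v N else vec N (\<lambda>i. cnj (u a i)))"
  have M: "M \<in> carrier_mat N N" by (simp add: M_def)
  have "det M = 0" unfolding M_def using assms(2) by (intro det_row_0) auto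
  then obtain v where v: "v \<in> carrier_vec N" "v \<noteq> 0\<^sub>v N" "M *\<^sub>v v = 0\<^sub>v N"
    using det_0_iff_vec_prod_zero[OF M] by auto
  obtain i where i: "i < N" "v $ i \<noteq> 0" using v(1,2) by (auto simp: vec_eq_iff)
  have orth: "ip N (u a) (\<lambda>i. v $ i) = 0" if "a < k" for a
  proof -
    have "(M *\<^sub>v v) $ a = 0" using v(3) that assms(2) by simp
    then show ?thesis using that assms(2) v(1)
      by (simp add: M_def ip_def scalar_prod_def lessThan_atLeast0)
  qed
  obtain c where "c \<noteq> 0" "ip N (\<lambda>i. c * v $ i) (\<lambda>i. c * v $ i) = 1"
    using normalize[of i N "\<lambda>i. v $ i"] i by auto
  then show ?thesis using orth by (intro exI[of _ "\<lambda>i. c * v $ i"]) (simp add: ip_scale_right)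
qed

lemma orthonormal_Suc:
  assumes "orthonormal N k u" "ip N x x = 1" "\<forall>a<k. ip N (u a) x = 0"
  shows "orthonormal N (Suc k) (u(k := x))"
  unfolding orthonormal_def
proof (intro allI impI)
  fix a b assume "a < Suc k" "b < Suc k"
  moreover have "ip N x (u a) = 0" if "a < k" for a
    using assms(3) that cnj_ip[of N "u a" x] by simp
  ultimately show "ip N ((u(k := x)) a) ((u(k := x)) b) = of_bool (a = b)"
    using assms(2,3) orthonormalD[OF assms(1)] by (auto simp: less_Suc_eq)
qed

lemma orthonormal_extend:
  assumes "orthonormal N k u" "k \<le> N"
  shows "\<exists>v. orthonormal N N v \<and> (\<forall>a<k. v a = u a)"
  using assms(2,1)
proof (induction k arbitrary: u rule: inc_induct)
  case base
  then show ?case by auto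
next
  case (step k)
  obtain x where x: "ip N x x = 1" "\<forall>a<k. ip N (u a) x = 0"
    using orthonormal_extend_step[OF step.prems step.hyps(2)] by auto
  obtain v where "orthonormal N N v" "\<forall>a<Suc k. v a = (u(k := x)) a"
    using step.IH[OF orthonormal_Suc[OF step.prems x]] by auto
  then show ?case by (intro exI[of _ v]) auto
qed

lemma orthonormal_single: "ip N x x = 1 \<Longrightarrow> orthonormal N 1 (\<lambda>_. x)"
  by (auto simp: orthonormal_def)

text \<open>Bessel's inequality with its defect: Parseval's identity for an extension of the family to a basis.\<close>

lemma bessel_gap:
  assumes "orthonormal N k u" "k \<le> N"
  obtains v where "orthonormal N N v" "\<forall>a<k. v a = u a"
    "\<forall>x. Re (ip N x x) = (\<Sum>c<k. (cmod (ip N (u c) x))\<^sup>2) + (\<Sum>c=k..<N. (cmod (ip N (v c) x))\<^sup>2)"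
proof -
  obtain v where v: "orthonormal N N v" "\<forall>a<k. v a = u a"
    using orthonormal_extend[OF assms] by auto
  have *: "Re (ip N x x) = (\<Sum>c<k. (cmod (ip N (u c) x))\<^sup>2) + (\<Sum>c=k..<N. (cmod (ip N (v c) x))\<^sup>2)" for x
  proof -
    have "Re (ip N x x) = (\<Sum>c<N. (cmod (ip N (v c) x))\<^sup>2)"
      using parseval[OF v(1)] by simp
    also have "{..<N} = {..<k} \<union> {k..<N}" using assms(2) by auto
    also have "(\<Sum>c\<in>{..<k} \<union> {k..<N}. (cmod (ip N (v c) x))\<^sup>2)
      = (\<Sum>c<k. (cmod (ip N (v c) x))\<^sup>2) + (\<Sum>c=k..<N. (cmod (ip N (v c) x))\<^sup>2)"
      by (intro sum.union_disjoint) auto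
    finally show ?thesis using v(2) by simp
  qed
  show ?thesis by (rule that[OF v allI[OF *]])
qed

lemma orthonormal_length:
  assumes "orthonormal N k u"
  shows "k \<le> N"
proof (rule ccontr)
  assume "\<not> k \<le> N"
  then have k: "N < k" by simp
  have o: "orthonormal N N u" using orthonormal_mono[OF assms, of N] k by simp
  have "ip N (u N) (u N) = (\<Sum>s<N. ip N (u N) (u s) * ip N (u s) (u N))"
    by (rule parseval_ip[OF o])
  also have "\<dots> = 0" using orthonormalD[OF assms] k by (intro sum.neutral) auto
  finally show False using orthonormalD[OF assms k k] by simp
qed

lemma bessel:
  assumes "orthonormal N k u"
  shows "(\<Sum>c<k. (cmod (ip N (u c) x))\<^sup>2) \<le> Re (ip N x x)"
proof -
  obtain v where "orthonormal N N v" "\<forall>a<k. v a = u a"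
    and *: "\<forall>x. Re (ip N x x) = (\<Sum>c<k. (cmod (ip N (u c) x))\<^sup>2) + (\<Sum>c=k..<N. (cmod (ip N (v c) x))\<^sup>2)"
    by (rule bessel_gap[OF assms orthonormal_length[OF assms]])
  moreover have "0 \<le> (\<Sum>c=k..<N. (cmod (ip N (v c) x))\<^sup>2)" by (simp add: sum_nonneg)
  ultimately show ?thesis using *[rule_format, of x] by simp
qed

text \<open>Equality in Bessel's inequality puts \<open>x\<close> in the span of the family, so \<open>x\<close> is orthogonal to every vector
  that is orthogonal to the family.\<close>

lemma bessel_eq_orthogonal:
  assumes "orthonormal N k u"
    and "(\<Sum>c<k. (cmod (ip N (u c) x))\<^sup>2) = Re (ip N x x)"
    and "(\<Sum>c<k. (cmod (ip N (u c) y))\<^sup>2) = 0"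
  shows "ip N x y = 0"
proof -
  obtain v where v: "orthonormal N N v" "\<forall>a<k. v a = u a"
    "\<forall>x. Re (ip N x x) = (\<Sum>c<k. (cmod (ip N (u c) x))\<^sup>2) + (\<Sum>c=k..<N. (cmod (ip N (v c) x))\<^sup>2)"
    by (rule bessel_gap[OF assms(1) orthonormal_length[OF assms(1)]])
  have x0: "(\<Sum>c=k..<N. (cmod (ip N (v c) x))\<^sup>2) = 0" using v(3)[rule_format, of x] assms(2) by simp
  have x: "\<forall>c\<in>{k..<N}. ip N (v c) x = 0"
    using sum_nonneg_eq_0_iff[THEN iffD1, OF _ _ x0] by simp
  have y: "\<forall>c<k. ip N (v c) y = 0"
    using sum_nonneg_eq_0_iff[THEN iffD1, OF _ _ assms(3)] v(2) by simp
  have "ip N x y = (\<Sum>s<N. ip N x (v s) * ip N (v s) y)" by (rule parseval_ip[OF v(1)])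
  also have "\<dots> = 0"
  proof (intro sum.neutral ballI)
    fix s assume "s \<in> {..<N}"
    then show "ip N x (v s) * ip N (v s) y = 0"
      using x y cnj_ip[of N "v s" x] by (cases "s < k") auto
  qed
  finally show ?thesis .
qed

section \<open>Quadratic forms and the spectral theorem\<close>

definition quad :: "nat \<Rightarrow> (nat \<Rightarrow> nat \<Rightarrow> complex) \<Rightarrow> (nat \<Rightarrow> complex) \<Rightarrow> complex" where
  "quad N H x = (\<Sum>i<N. \<Sum>j<N. cnj (x i) * H i j * x j)"

definition hermitian :: "nat \<Rightarrow> (nat \<Rightarrow> nat \<Rightarrow> complex) \<Rightarrow> bool" where
  "hermitian N H \<longleftrightarrow> (\<forall>i<N. \<forall>j<N. H j i = cnj (H i j))"

lemma hermitianD: "hermitian N H \<Longrightarrow> i < N \<Longrightarrow> j < N \<Longrightarrow> H j i = cnj (H i j)"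
  unfolding hermitian_def by blast

definition mat_app :: "nat \<Rightarrow> (nat \<Rightarrow> nat \<Rightarrow> complex) \<Rightarrow> (nat \<Rightarrow> complex) \<Rightarrow> nat \<Rightarrow> complex" where
  "mat_app N H x i = (\<Sum>j<N. H i j * x j)"

lemma quad_mat_app: "quad N H x = ip N x (mat_app N H x)"
  by (simp add: quad_def ip_def mat_app_def sum_distrib_left mult.assoc)

lemma ip_mat_app_hermitian:
  assumes "hermitian N H"
  shows "ip N x (mat_app N H y) = ip N (mat_app N H x) y"
proof -
  have "ip N x (mat_app N H y) = (\<Sum>i<N. \<Sum>j<N. cnj (x i) * H i j * y j)"
    by (simp add: ip_def mat_app_def sum_distrib_left mult.assoc)
  also have "\<dots> = (\<Sum>j<N. \<Sum>i<N. cnj (x i) * H i j * y j)" by (rule sum.swap)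
  also have "\<dots> = ip N (mat_app N H x) y"
    unfolding ip_def mat_app_def cnj_sum sum_distrib_right
  proof (intro sum.cong refl)
    fix i j assume "i \<in> {..<N}" "j \<in> {..<N}"
    then have "H j i = cnj (H i j)" by (intro hermitianD[OF assms]) auto
    then show "cnj (x j) * H j i * y i = cnj (H i j * x j) * y i" by simp
  qed
  finally show ?thesis .
qed

lemma quad_sum: "quad N (\<lambda>i j. \<Sum>s\<in>S. c s * G s i j) x = (\<Sum>s\<in>S. c s * quad N (G s) x)"
proof -
  have "quad N (\<lambda>i j. \<Sum>s\<in>S. c s * G s i j) x
    = (\<Sum>i<N. \<Sum>j<N. \<Sum>s\<in>S. c s * (cnj (x i) * G s i j * x j))"
    by (simp add: quad_def sum_distrib_left sum_distrib_right mult.assoc mult.left_commute[of "c _"])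
  also have "\<dots> = (\<Sum>s\<in>S. \<Sum>i<N. \<Sum>j<N. c s * (cnj (x i) * G s i j * x j))"
    by (subst sum.swap[of _ S], intro sum.cong refl sum.swap)
  finally show ?thesis by (simp add: quad_def sum_distrib_left)
qed

lemma quad_cong: "(\<And>i j. i < N \<Longrightarrow> j < N \<Longrightarrow> H i j = H' i j) \<Longrightarrow> quad N H x = quad N H' x"
  by (simp add: quad_def)

lemma quad_rank1: "quad N (\<lambda>i j. z i * cnj (z j)) x = of_real ((cmod (ip N z x))\<^sup>2)"
proof -
  have "quad N (\<lambda>i j. z i * cnj (z j)) x = ip N x z * ip N z x"
    by (simp add: quad_def ip_def sum_product mult.assoc)
  then show ?thesis by (metis cnj_ip complex_norm_square mult.commute of_real_power)
qed

text \<open>The orthogonal complement of a family of eigenvectors is invariant, and an eigenvector of the compression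
  to this complement is an eigenvector of the whole matrix.\<close>

lemma hermitian_eigenvector_step:
  assumes H: "hermitian N H" and u: "orthonormal N k u" and k: "k < N"
    and ev: "\<And>a i. a < k \<Longrightarrow> i < N \<Longrightarrow> mat_app N H (u a) i = h a * u a i"
  shows "\<exists>x \<mu>. ip N x x = 1 \<and> (\<forall>a<k. ip N (u a) x = 0) \<and> (\<forall>i<N. mat_app N H x i = \<mu> * x i)"
proof -
  obtain w where w: "orthonormal N N w" "\<And>a. a < k \<Longrightarrow> w a = u a"
    using orthonormal_extend[OF u] k by auto
  define r where "r = N - k"
  define M where "M = mat r r (\<lambda>(a, b). ip N (w (k + a)) (mat_app N H (w (k + b))))"
  have M: "M \<in> carrier_mat r r" and r: "r > 0" using k by (auto simp: M_def r_def)
  obtain \<mu> where "\<mu> \<in> spectrum M" using spectrum_non_empty[OF M r] by auto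
  then obtain v where v: "v \<in> carrier_vec r" "v \<noteq> 0\<^sub>v r" "M *\<^sub>v v = \<mu> \<cdot>\<^sub>v v"
    using M by (auto simp: spectrum_def eigenvalue_def eigenvector_def)
  define y where "y = (\<lambda>i. \<Sum>b<r. v $ b * w (k + b) i)"
  have wy: "ip N (w s) y = (if s < k then 0 else v $ (s - k))" if "s < N" for s
  proof -
    have "ip N (w s) y = (\<Sum>b<r. v $ b * of_bool (s = k + b))"
      unfolding y_def ip_sum_right
      using that by (intro sum.cong refl) (simp add: orthonormalD[OF w(1)] r_def)
    also have "\<dots> = (if s < k then 0 else v $ (s - k))"
    proof (cases "s < k")
      case False
      have "(\<Sum>b<r. v $ b * of_bool (s = k + b)) = (\<Sum>b<r. if b = s - k then v $ b else 0)"
        using False by (intro sum.cong refl) auto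
      then show ?thesis using False that by (simp add: r_def)
    qed auto
    finally show ?thesis .
  qed
  have wHy: "ip N (w s) (mat_app N H y) = \<mu> * ip N (w s) y" if s: "s < N" for s
  proof (cases "s < k")
    case True
    have "ip N (w s) (mat_app N H y) = ip N (mat_app N H (w s)) y" by (rule ip_mat_app_hermitian[OF H])
    also have "\<dots> = ip N (\<lambda>i. h s * w s i) y" using ev[OF True] w(2)[OF True] by (intro ip_cong) auto
    finally show ?thesis using wy[OF s] True by (simp add: ip_scale_left)
  next
    case False
    then have sr: "s - k < r" "k + (s - k) = s" using s by (auto simp: r_def)
    have "mat_app N H y = (\<lambda>i. \<Sum>b<r. v $ b * mat_app N H (w (k + b)) i)"
      unfolding mat_app_def y_def sum_distrib_left
      by (subst sum.swap) (simp add: mult.left_commute sum_distrib_left mult.assoc)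
    then have "ip N (w s) (mat_app N H y) = (\<Sum>b<r. v $ b * ip N (w s) (mat_app N H (w (k + b))))"
      by (simp add: ip_sum_right)
    also have "\<dots> = (M *\<^sub>v v) $ (s - k)"
      using sr v(1) by (simp add: M_def scalar_prod_def lessThan_atLeast0 mult.commute)
    also have "\<dots> = \<mu> * v $ (s - k)" using v(1,3) sr by simp
    finally show ?thesis using wy[OF s] False by simp
  qed
  have ev_y: "mat_app N H y i = \<mu> * y i" if "i < N" for i
  proof -
    have "mat_app N H y i = (\<Sum>s<N. ip N (w s) (mat_app N H y) * w s i)"
      by (rule orthonormal_expand[OF w(1) that])
    also have "\<dots> = \<mu> * (\<Sum>s<N. ip N (w s) y * w s i)"
      by (simp add: wHy sum_distrib_left mult.assoc)
    finally show ?thesis using orthonormal_expand[OF w(1) that, of y] by simp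
  qed
  obtain b where b: "b < r" "v $ b \<noteq> 0" using v(1,2) by (auto simp: vec_eq_iff)
  have "ip N (w (k + b)) y \<noteq> 0" using wy[of "k + b"] b by (simp add: r_def)
  then obtain i where i: "i < N" "y i \<noteq> 0" unfolding ip_def
    by (metis (no_types, lifting) lessThan_iff mult_zero_right sum.neutral)
  obtain c where c: "c \<noteq> 0" "ip N (\<lambda>i. c * y i) (\<lambda>i. c * y i) = 1" using normalize[of i N y, OF i] by auto
  show ?thesis
  proof (intro exI conjI allI impI)
    show "ip N (\<lambda>i. c * y i) (\<lambda>i. c * y i) = 1" by fact
    show "ip N (u a) (\<lambda>i. c * y i) = 0" if "a < k" for a
      using wy[of a] w(2)[OF that] that k by (simp add: ip_scale_right)
    show "mat_app N H (\<lambda>i. c * y i) i = \<mu> * (c * y i)" if "i < N" for i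
      using ev_y[OF that] by (simp add: mat_app_def mult.left_commute sum_distrib_left[symmetric])
  qed
qed

lemma hermitian_eigenvectors:
  assumes "hermitian N H" "k \<le> N"
  shows "\<exists>u h. orthonormal N k u \<and> (\<forall>a<k. \<forall>i<N. mat_app N H (u a) i = h a * u a i)"
  using assms(2)
proof (induction k)
  case 0
  then show ?case by (auto simp: orthonormal_def)
next
  case (Suc k)
  then obtain u h where u: "orthonormal N k u" "\<forall>a<k. \<forall>i<N. mat_app N H (u a) i = h a * u a i" by auto
  obtain x \<mu> where x: "ip N x x = 1" "\<forall>a<k. ip N (u a) x = 0" "\<forall>i<N. mat_app N H x i = \<mu> * x i"
    using hermitian_eigenvector_step[OF assms(1) u(1) _ u(2)[rule_format]] Suc.prems by auto
  have "\<forall>a<Suc k. \<forall>i<N. mat_app N H ((u(k := x)) a) i = (h(k := \<mu>)) a * (u(k := x)) a i"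
    using u(2) x(3) by (simp add: less_Suc_eq)
  then show ?case using orthonormal_Suc[OF u(1) x(1,2)] by blast
qed

lemma exists_antimono_permutation:
  fixes h :: "nat \<Rightarrow> real"
  shows "\<exists>\<pi>. bij_betw \<pi> {..<N} {..<N} \<and> (\<forall>i j. i \<le> j \<longrightarrow> j < N \<longrightarrow> h (\<pi> j) \<le> h (\<pi> i))"
proof -
  define l where "l = sort_key (\<lambda>i. - h i) [0..<N]"
  have l: "length l = N" "distinct l" "set l = {..<N}" by (auto simp: l_def)
  have sorted: "sorted (map (\<lambda>i. - h i) l)" unfolding l_def by (rule sorted_sort_key)
  show ?thesis
  proof (intro exI[of _ "\<lambda>i. l ! i"] conjI allI impI)
    show "bij_betw ((!) l) {..<N} {..<N}" by (rule bij_betw_nth) (simp_all add: l)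
    show "h (l ! j) \<le> h (l ! i)" if "i \<le> j" "j < N" for i j
      using sorted_nth_mono[OF sorted, of i j] that l(1) by simp
  qed
qed

theorem hermitian_spectral:
  assumes "hermitian N H"
  shows "\<exists>v (h :: nat \<Rightarrow> real). orthonormal N N v \<and> (\<forall>i j. i \<le> j \<longrightarrow> j < N \<longrightarrow> h j \<le> h i) \<and>
    (\<forall>i<N. \<forall>j<N. H i j = (\<Sum>s<N. of_real (h s) * (v s i * cnj (v s j))))"
proof -
  obtain u g where u: "orthonormal N N u" "\<forall>a<N. \<forall>i<N. mat_app N H (u a) i = g a * u a i"
    using hermitian_eigenvectors[OF assms, of N] by auto
  have g_real: "g a = of_real (Re (g a))" if "a < N" for a
  proof -
    have 1: "ip N (u a) (mat_app N H (u a)) = g a"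
      using u(2) that orthonormalD[OF u(1) that that]
      by (subst ip_cong[of N _ "u a" _ "\<lambda>i. g a * u a i"]) (auto simp: ip_scale_right)
    have "ip N (u a) (mat_app N H (u a)) = cnj (g a)"
      unfolding ip_mat_app_hermitian[OF assms]
      using u(2) that orthonormalD[OF u(1) that that]
      by (subst ip_cong[of N _ "\<lambda>i. g a * u a i" _ "u a"]) (auto simp: ip_scale_left)
    then have "cnj (g a) = g a" using 1 by simp
    then show ?thesis by (metis Reals_cnj_iff of_real_Re)
  qed
  obtain \<pi> where \<pi>: "bij_betw \<pi> {..<N} {..<N}" "\<And>i j. i \<le> j \<Longrightarrow> j < N \<Longrightarrow> Re (g (\<pi> j)) \<le> Re (g (\<pi> i))"
    using exists_antimono_permutation[of N "\<lambda>a. Re (g a)"] by auto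
  define v where "v = (\<lambda>a. u (\<pi> a))"
  define h where "h = (\<lambda>a. Re (g (\<pi> a)))"
  have lt: "\<pi> a < N" if "a < N" for a using \<pi>(1) that by (auto simp: bij_betw_def)
  have v: "orthonormal N N v" unfolding v_def
    using \<pi>(1) lt by (intro orthonormal_reindex[OF u(1)]) (auto simp: bij_betw_def)
  have ev: "mat_app N H (v a) i = of_real (h a) * v a i" if "a < N" "i < N" for a i
    using u(2) that lt[of a] g_real[of "\<pi> a"] unfolding v_def h_def by metis
  have "H i j = (\<Sum>s<N. of_real (h s) * (v s i * cnj (v s j)))" if ij: "i < N" "j < N" for i j
  proof -
    have "(\<Sum>s<N. of_real (h s) * (v s i * cnj (v s j))) = (\<Sum>s<N. \<Sum>l<N. H i l * (v s l * cnj (v s j)))"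
    proof (intro sum.cong refl)
      fix s assume "s \<in> {..<N}"
      then have "(of_real (h s) * v s i) * cnj (v s j) = (\<Sum>l<N. H i l * v s l) * cnj (v s j)"
        using ev[of s i] ij by (simp add: mat_app_def)
      then show "of_real (h s) * (v s i * cnj (v s j)) = (\<Sum>l<N. H i l * (v s l * cnj (v s j)))"
        by (simp add: sum_distrib_right mult.assoc)
    qed
    also have "\<dots> = (\<Sum>l<N. H i l * (\<Sum>s<N. v s l * cnj (v s j)))"
      by (subst sum.swap) (simp add: sum_distrib_left)
    also have "\<dots> = (\<Sum>l<N. if l = j then H i l else 0)"
      by (intro sum.cong refl) (simp add: orthonormal_complete[OF v _ ij(2)])
    also have "\<dots> = H i j" using ij by simp
    finally show ?thesis by simp
  qed
  then have "\<forall>i<N. \<forall>j<N. H i j = (\<Sum>s<N. of_real (h s) * (v s i * cnj (v s j)))" by simp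
  moreover have "\<forall>i j. i \<le> j \<longrightarrow> j < N \<longrightarrow> h j \<le> h i" using \<pi>(2) by (simp add: h_def)
  ultimately show ?thesis using v by (intro exI[of _ v] exI[of _ h] conjI)
qed

section \<open>Ky Fan's principle\<close>

text \<open>The trace of \<open>X*HX\<close>, where \<open>X\<close> is the isometry with columns \<open>u 0, \<dots>, u (k - 1)\<close>.\<close>

definition ctrace :: "nat \<Rightarrow> nat \<Rightarrow> (nat \<Rightarrow> nat \<Rightarrow> complex) \<Rightarrow> (nat \<Rightarrow> nat \<Rightarrow> complex) \<Rightarrow> complex" where
  "ctrace N k H u = (\<Sum>c<k. quad N H (u c))"

text \<open>The squared norm of the orthogonal projection of \<open>x\<close> to the span of the family.\<close>

definition weight :: "nat \<Rightarrow> nat \<Rightarrow> (nat \<Rightarrow> nat \<Rightarrow> complex) \<Rightarrow> (nat \<Rightarrow> complex) \<Rightarrow> real" where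
  "weight N k u x = (\<Sum>c<k. (cmod (ip N (u c) x))\<^sup>2)"

definition spectral :: "nat \<Rightarrow> (nat \<Rightarrow> nat \<Rightarrow> complex) \<Rightarrow> (nat \<Rightarrow> nat \<Rightarrow> complex) \<Rightarrow> (nat \<Rightarrow> real) \<Rightarrow> bool" where
  "spectral N H v h \<longleftrightarrow> orthonormal N N v \<and> (\<forall>i j. i \<le> j \<longrightarrow> j < N \<longrightarrow> h j \<le> h i) \<and>
    (\<forall>i<N. \<forall>j<N. H i j = (\<Sum>s<N. of_real (h s) * (v s i * cnj (v s j))))"

lemma cmod_ip_commute: "cmod (ip N x y) = cmod (ip N y x)"
  by (metis cnj_ip complex_mod_cnj)

lemma weight_nonneg: "0 \<le> weight N k u x"
  by (simp add: weight_def sum_nonneg)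

lemma weight_le: "orthonormal N k u \<Longrightarrow> ip N x x = 1 \<Longrightarrow> weight N k u x \<le> 1"
  using bessel[of N k u x] by (simp add: weight_def)

text \<open>Weight 1 means that \<open>x\<close> lies in the span of the family, weight 0 that \<open>y\<close> is orthogonal to it.\<close>

lemma weight_orthogonal:
  assumes "orthonormal N k u" "weight N k u x = 1" "ip N x x = 1" "weight N k u y = 0"
  shows "ip N x y = 0"
  by (rule bessel_eq_orthogonal[OF assms(1)]) (use assms(2-4) in \<open>simp_all add: weight_def\<close>)

lemma sum_weight:
  assumes "orthonormal N N v" "orthonormal N k u"
  shows "(\<Sum>s<N. weight N k u (v s)) = real k"
proof -
  have "(\<Sum>s<N. weight N k u (v s)) = (\<Sum>c<k. \<Sum>s<N. (cmod (ip N (v s) (u c)))\<^sup>2)"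
    unfolding weight_def by (subst sum.swap) (simp add: cmod_ip_commute)
  also have "\<dots> = (\<Sum>c<k. 1)"
  proof (intro sum.cong refl)
    fix c assume "c \<in> {..<k}"
    then have "complex_of_real (\<Sum>s<N. (cmod (ip N (v s) (u c)))\<^sup>2) = 1"
      using parseval[OF assms(1), of "u c"] orthonormalD[OF assms(2), of c c] by simp
    then show "(\<Sum>s<N. (cmod (ip N (v s) (u c)))\<^sup>2) = 1" using of_real_eq_1_iff by blast
  qed
  finally show ?thesis by simp
qed

lemma quad_spectral:
  assumes "spectral N H v h"
  shows "quad N H x = of_real (\<Sum>s<N. h s * (cmod (ip N (v s) x))\<^sup>2)"
proof -
  have "quad N H x = quad N (\<lambda>i j. \<Sum>s<N. of_real (h s) * (v s i * cnj (v s j))) x"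
    using assms by (intro quad_cong) (auto simp: spectral_def)
  then show ?thesis unfolding quad_sum by (simp add: quad_rank1)
qed

lemma ctrace_spectral:
  assumes "spectral N H v h"
  shows "ctrace N k H u = of_real (\<Sum>s<N. h s * weight N k u (v s))"
proof -
  have "ctrace N k H u = of_real (\<Sum>c<k. \<Sum>s<N. h s * (cmod (ip N (u c) (v s)))\<^sup>2)"
    unfolding ctrace_def quad_spectral[OF assms] by (simp add: cmod_ip_commute)
  then show ?thesis unfolding weight_def by (subst (asm) sum.swap) (simp add: sum_distrib_left)
qed

lemma spectral_quad_eigen:
  assumes "spectral N H v h" "a < N"
  shows "quad N H (v a) = of_real (h a)"
proof -
  have o: "orthonormal N N v" using assms(1) by (simp add: spectral_def)
  have "(\<Sum>s<N. h s * (cmod (ip N (v s) (v a)))\<^sup>2) = (\<Sum>s<N. if s = a then h s else 0)"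
    by (intro sum.cong refl) (use orthonormalD[OF o _ assms(2)] in auto)
  then show ?thesis unfolding quad_spectral[OF assms(1)] using assms(2) by simp
qed

text \<open>For weights between 0 and 1 with total \<open>k\<close>, the defect of \<open>\<Sum> h q\<close> from the sum of the first \<open>k\<close>
  values of \<open>h\<close> is a sum of one term for each index. If \<open>\<tau>\<close> separates the first \<open>k\<close> values from the
  others, all these terms are nonnegative.\<close>

lemma top_sum_gap:
  fixes h q :: "nat \<Rightarrow> real"
  assumes "k \<le> N" "(\<Sum>i<N. q i) = real k"
  shows "(\<Sum>i<k. h i) - (\<Sum>i<N. h i * q i)
    = (\<Sum>i<k. (h i - \<tau>) * (1 - q i)) + (\<Sum>i=k..<N. (\<tau> - h i) * q i)"
proof -
  have split: "(\<Sum>i<N. f i) = (\<Sum>i<k. f i) + (\<Sum>i=k..<N. f i)" for f :: "nat \<Rightarrow> real"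
    using assms(1) by (metis lessThan_atLeast0 sum.atLeastLessThan_concat zero_le)
  have "(\<Sum>i<k. (h i - \<tau>) * (1 - q i)) + (\<Sum>i=k..<N. (\<tau> - h i) * q i)
    = (\<Sum>i<k. h i) - real k * \<tau> - ((\<Sum>i<k. h i * q i) + (\<Sum>i=k..<N. h i * q i))
      + \<tau> * ((\<Sum>i<k. q i) + (\<Sum>i=k..<N. q i))"
    by (simp add: algebra_simps sum.distrib sum_subtractf sum_distrib_left)
  also have "\<dots> = (\<Sum>i<k. h i) - (\<Sum>i<N. h i * q i)"
    unfolding split[symmetric] assms(2) by simp
  finally show ?thesis by simp
qed

lemma top_sum_le:
  fixes h q :: "nat \<Rightarrow> real"
  assumes "k \<le> N" "(\<Sum>i<N. q i) = real k" "\<And>i. i < N \<Longrightarrow> 0 \<le> q i \<and> q i \<le> 1"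
    and "\<And>i. i < k \<Longrightarrow> \<tau> \<le> h i" "\<And>i. k \<le> i \<Longrightarrow> i < N \<Longrightarrow> h i \<le> \<tau>"
  shows "(\<Sum>i<N. h i * q i) \<le> (\<Sum>i<k. h i)"
proof -
  have "0 \<le> (\<Sum>i<k. (h i - \<tau>) * (1 - q i))" using assms by (intro sum_nonneg) auto
  moreover have "0 \<le> (\<Sum>i=k..<N. (\<tau> - h i) * q i)" using assms by (intro sum_nonneg) auto
  ultimately show ?thesis using top_sum_gap[OF assms(1,2), of h \<tau>] by linarith
qed

text \<open>If the defect vanishes, so does each of its terms, and this pins down the weights off the threshold.\<close>

lemma top_sum_eq:
  fixes h q :: "nat \<Rightarrow> real"
  assumes "k \<le> N" "(\<Sum>i<N. q i) = real k" and q: "\<And>i. i < N \<Longrightarrow> 0 \<le> q i \<and> q i \<le> 1"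
    and h: "\<And>i. i < k \<Longrightarrow> \<tau> \<le> h i" "\<And>i. k \<le> i \<Longrightarrow> i < N \<Longrightarrow> h i \<le> \<tau>"
    and eq: "(\<Sum>i<N. h i * q i) = (\<Sum>i<k. h i)" and i: "i < N"
  shows "(h i > \<tau> \<longrightarrow> q i = 1) \<and> (h i < \<tau> \<longrightarrow> q i = 0)"
proof -
  have 1: "0 \<le> (\<Sum>i<k. (h i - \<tau>) * (1 - q i))" using assms by (intro sum_nonneg) auto
  have 2: "0 \<le> (\<Sum>i=k..<N. (\<tau> - h i) * q i)" using assms by (intro sum_nonneg) auto
  have z1: "(\<Sum>i<k. (h i - \<tau>) * (1 - q i)) = 0" and z2: "(\<Sum>i=k..<N. (\<tau> - h i) * q i) = 0"
    using 1 2 top_sum_gap[OF assms(1,2), of h \<tau>] eq by linarith+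
  have z1': "\<forall>i\<in>{..<k}. (h i - \<tau>) * (1 - q i) = 0"
    using z1 assms by (subst (asm) sum_nonneg_eq_0_iff) auto
  have z2': "\<forall>i\<in>{k..<N}. (\<tau> - h i) * q i = 0"
    using z2 assms by (subst (asm) sum_nonneg_eq_0_iff) auto
  show ?thesis
  proof (cases "i < k")
    case True
    then show ?thesis using z1' h(1)[OF True] by auto
  next
    case False
    then have "i \<in> {k..<N}" using i by auto
    then show ?thesis using z2' h(2)[of i] by auto
  qed
qed

text \<open>The weights \<open>1 - q\<close> have total \<open>N - k\<close> and maximize where \<open>q\<close> minimizes.\<close>

lemma bottom_sum_eq:
  fixes h q :: "nat \<Rightarrow> real"
  assumes "k \<le> N" "(\<Sum>i<N. q i) = real k" and q: "\<And>i. i < N \<Longrightarrow> 0 \<le> q i \<and> q i \<le> 1"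
    and h: "\<And>i. i < N - k \<Longrightarrow> \<sigma> \<le> h i" "\<And>i. N - k \<le> i \<Longrightarrow> i < N \<Longrightarrow> h i \<le> \<sigma>"
    and eq: "(\<Sum>i<N. h i * q i) = (\<Sum>i=N - k..<N. h i)" and i: "i < N"
  shows "(h i < \<sigma> \<longrightarrow> q i = 1) \<and> (h i > \<sigma> \<longrightarrow> q i = 0)"
proof -
  define p where "p i = 1 - q i" for i
  have "(\<Sum>i<N. p i) = real (N - k)" using assms(1,2) by (simp add: p_def sum_subtractf of_nat_diff)
  moreover have "(\<Sum>i<N. h i * p i) = (\<Sum>i<N - k. h i)"
  proof -
    have "(\<Sum>i<N. h i) = (\<Sum>i<N - k. h i) + (\<Sum>i=N - k..<N. h i)"
      by (metis diff_le_self lessThan_atLeast0 sum.atLeastLessThan_concat zero_le)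
    then show ?thesis using eq by (simp add: p_def right_diff_distrib sum_subtractf)
  qed
  ultimately have "(h i > \<sigma> \<longrightarrow> p i = 1) \<and> (h i < \<sigma> \<longrightarrow> p i = 0)"
    using q h i by (intro top_sum_eq[of "N - k" N p \<sigma> h]) (auto simp: p_def)
  then show ?thesis by (auto simp: p_def)
qed

lemma ctrace_full:
  assumes "orthonormal N N v"
  shows "ctrace N N H v = (\<Sum>i<N. H i i)"
proof -
  have "ctrace N N H v = (\<Sum>c<N. \<Sum>i<N. \<Sum>j<N. H i j * (v c j * cnj (v c i)))"
    unfolding ctrace_def quad_def by (simp add: mult_ac)
  also have "\<dots> = (\<Sum>i<N. \<Sum>j<N. \<Sum>c<N. H i j * (v c j * cnj (v c i)))"
    by (subst sum.swap, intro sum.cong refl sum.swap)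
  also have "\<dots> = (\<Sum>i<N. \<Sum>j<N. H i j * of_bool (j = i))"
    using orthonormal_complete[OF assms] by (simp add: sum_distrib_left[symmetric])
  also have "\<dots> = (\<Sum>i<N. H i i)"
    by (intro sum.cong refl) (simp add: of_bool_def if_distrib cong: if_cong)
  finally show ?thesis .
qed

text \<open>The complementary part of a basis compresses \<open>H\<close> to the rest of its trace.\<close>

lemma orthonormal_complement:
  assumes "orthonormal N k u"
  obtains u' where "orthonormal N (N - k) u'" "\<And>H. ctrace N (N - k) H u' = (\<Sum>i<N. H i i) - ctrace N k H u"
proof -
  have k: "k \<le> N" by (rule orthonormal_length[OF assms])
  obtain v where v: "orthonormal N N v" "\<forall>a<k. v a = u a" using orthonormal_extend[OF assms k] by auto
  have o: "orthonormal N (N - k) (\<lambda>a. v (k + a))" by (rule orthonormal_reindex[OF v(1)]) auto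
  have "ctrace N (N - k) H (\<lambda>a. v (k + a)) = (\<Sum>i<N. H i i) - ctrace N k H u" for H
  proof -
    have "(\<Sum>c<N. quad N H (v c)) = (\<Sum>c<k. quad N H (v c)) + (\<Sum>c=k..<N. quad N H (v c))"
      using k by (metis lessThan_atLeast0 sum.atLeastLessThan_concat zero_le)
    moreover have "(\<Sum>c=k..<N. quad N H (v c)) = (\<Sum>c<N - k. quad N H (v (k + c)))"
      by (rule sum.reindex_bij_witness[of _ "\<lambda>c. k + c" "\<lambda>c. c - k"]) auto
    ultimately show ?thesis using ctrace_full[OF v(1), of H] v(2) by (simp add: ctrace_def eq_diff_eq add.commute)
  qed
  then show ?thesis using that o by blast
qed

section \<open>Recognising rank one projections\<close>

text \<open>The property that the image of a rank one projection inherits from the projection: its \<open>k\<close>-numerical range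
  spans the interval from 0 to \<open>1/k\<close>.\<close>

definition sharp_range :: "nat \<Rightarrow> nat \<Rightarrow> (nat \<Rightarrow> nat \<Rightarrow> complex) \<Rightarrow> bool" where
  "sharp_range N k H \<longleftrightarrow>
    (\<forall>u. orthonormal N k u \<longrightarrow> 0 \<le> Re (ctrace N k H u) \<and> Re (ctrace N k H u) \<le> 1) \<and>
    (\<exists>u. orthonormal N k u \<and> ctrace N k H u = 1) \<and> (\<exists>u. orthonormal N k u \<and> ctrace N k H u = 0)"

lemma orthonormal_weights:
  assumes "orthonormal N N v" "orthonormal N k u"
  shows "(\<Sum>i<N. weight N k u (v i)) = real k" "\<And>i. i < N \<Longrightarrow> 0 \<le> weight N k u (v i) \<and> weight N k u (v i) \<le> 1"
  using sum_weight[OF assms] weight_nonneg weight_le[OF assms(2)] orthonormalD[OF assms(1)] by auto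

lemma sharp_range_top:
  assumes sp: "spectral N H v h" and sr: "sharp_range N k H" and k: "k \<le> N" "0 < k"
  shows "(\<Sum>i<k. h i) = 1"
proof (rule antisym)
  have v: "orthonormal N N v" and h: "\<And>i j. i \<le> j \<Longrightarrow> j < N \<Longrightarrow> h j \<le> h i"
    using sp by (auto simp: spectral_def)
  have "ctrace N k H v = of_real (\<Sum>i<k. h i)"
    using k by (simp add: ctrace_def spectral_quad_eigen[OF sp])
  then show "(\<Sum>i<k. h i) \<le> 1" using sr orthonormal_mono[OF v k(1)] unfolding sharp_range_def by fastforce
  obtain u where u: "orthonormal N k u" "ctrace N k H u = 1" using sr by (auto simp: sharp_range_def)
  have "(\<Sum>i<N. h i * weight N k u (v i)) = 1" using ctrace_spectral[OF sp, of k u] u(2) by (metis of_real_eq_1_iff)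
  moreover have "(\<Sum>i<N. h i * weight N k u (v i)) \<le> (\<Sum>i<k. h i)"
    by (rule top_sum_le[of _ _ _ "h (k - 1)"]) (use orthonormal_weights[OF v u(1)] k h in auto)
  ultimately show "1 \<le> (\<Sum>i<k. h i)" by simp
qed

lemma sum_split:
  fixes f :: "nat \<Rightarrow> 'a :: comm_monoid_add"
  shows "k \<le> N \<Longrightarrow> (\<Sum>i<N. f i) = (\<Sum>i<k. f i) + (\<Sum>i=k..<N. f i)"
  by (metis lessThan_atLeast0 sum.atLeastLessThan_concat zero_le)

lemma sharp_range_bottom:
  assumes sp: "spectral N H v h" and sr: "sharp_range N k H" and k: "k \<le> N" "0 < k"
  shows "(\<Sum>i=N - k..<N. h i) = 0"
proof (rule antisym)
  have v: "orthonormal N N v" and h: "\<And>i j. i \<le> j \<Longrightarrow> j < N \<Longrightarrow> h j \<le> h i"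
    using sp by (auto simp: spectral_def)
  have o: "orthonormal N k (\<lambda>a. v (N - k + a))" using k by (intro orthonormal_reindex[OF v]) (auto simp: inj_on_def)
  have "ctrace N k H (\<lambda>a. v (N - k + a)) = of_real (\<Sum>a<k. h (N - k + a))"
    using k by (simp add: ctrace_def spectral_quad_eigen[OF sp])
  moreover have "(\<Sum>a<k. h (N - k + a)) = (\<Sum>i=N - k..<N. h i)"
    using k by (intro sum.reindex_bij_witness[of _ "\<lambda>i. i - (N - k)" "\<lambda>a. N - k + a"]) auto
  ultimately show "0 \<le> (\<Sum>i=N - k..<N. h i)" using sr o unfolding sharp_range_def by fastforce
  obtain u where u: "orthonormal N k u" "ctrace N k H u = 0" using sr by (auto simp: sharp_range_def)
  have 0: "(\<Sum>i<N. h i * weight N k u (v i)) = 0" using ctrace_spectral[OF sp, of k u] u(2) by (metis of_real_eq_0_iff)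
  define q where "q i = 1 - weight N k u (v i)" for i
  note w = orthonormal_weights[OF v u(1)]
  have "(\<Sum>i<N. h i * q i) \<le> (\<Sum>i<N - k. h i)"
  proof (cases "N = k")
    case True
    then have "\<forall>i\<in>{..<N}. q i = 0" using w k
      by (subst sum_nonneg_eq_0_iff[symmetric]) (auto simp: q_def sum_subtractf)
    then show ?thesis using True by simp
  next
    case False
    then show ?thesis
      using w k h by (intro top_sum_le[of _ _ _ "h (N - k)"]) (auto simp: q_def sum_subtractf of_nat_diff)
  qed
  then have "(\<Sum>i<N. h i) \<le> (\<Sum>i<N - k. h i)"
    using 0 by (simp add: q_def right_diff_distrib sum_subtractf)
  then show "(\<Sum>i=N - k..<N. h i) \<le> 0" using sum_split[of "N - k" N h] by simp
qed

lemma spectral_trace: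
  assumes "spectral N H v h"
  shows "(\<Sum>i<N. H i i) = of_real (\<Sum>i<N. h i)"
proof -
  have "orthonormal N N v" using assms by (simp add: spectral_def)
  then have "(\<Sum>i<N. H i i) = ctrace N N H v" by (simp add: ctrace_full)
  then show ?thesis by (simp add: ctrace_def spectral_quad_eigen[OF assms])
qed

text \<open>The eigenvalue \<open>h i\<close> is at least the average of the last \<open>k\<close> eigenvalues, which is 0.\<close>

lemma sharp_range_nonneg:
  assumes sp: "spectral N H v h" and sr: "sharp_range N k H" and k: "k \<le> N" "0 < k" and i: "i \<le> N - k"
  shows "0 \<le> h i"
proof -
  have h: "\<And>i j. i \<le> j \<Longrightarrow> j < N \<Longrightarrow> h j \<le> h i" using sp by (auto simp: spectral_def)
  have "(\<Sum>j=N - k..<N. h j) \<le> (\<Sum>j=N - k..<N. h i)" using h i by (intro sum_mono) auto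
  then have "0 \<le> real k * h i" using sharp_range_bottom[OF sp sr k] k by simp
  then show ?thesis using k by (simp add: zero_le_mult_iff)
qed

text \<open>If \<open>2k \<le> N\<close>, the first \<open>k\<close> and the last \<open>k\<close> eigenvalues are disjoint and add up to 1, and those in between
  are nonnegative.\<close>

lemma trace_ge_1:
  assumes sp: "spectral N H v h" and sr: "sharp_range N k H" and k: "2 * k \<le> N" "0 < k"
  shows "(\<Sum>i<N. h i) = 1 + (\<Sum>i=k..<N - k. h i)" "0 \<le> (\<Sum>i=k..<N - k. h i)"
proof -
  have kN: "k \<le> N" using k by simp
  have "(\<Sum>i<N. h i) = (\<Sum>i<N - k. h i) + (\<Sum>i=N - k..<N. h i)" by (rule sum_split) simp
  moreover have "(\<Sum>i<N - k. h i) = (\<Sum>i<k. h i) + (\<Sum>i=k..<N - k. h i)" using k by (intro sum_split) simp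
  ultimately show "(\<Sum>i<N. h i) = 1 + (\<Sum>i=k..<N - k. h i)"
    using sharp_range_top[OF sp sr kN k(2)] sharp_range_bottom[OF sp sr kN k(2)] by simp
  show "0 \<le> (\<Sum>i=k..<N - k. h i)" using sharp_range_nonneg[OF sp sr kN k(2)] by (intro sum_nonneg) auto
qed

text \<open>If \<open>N \<le> 2k\<close>, the first \<open>k\<close> and the last \<open>k\<close> eigenvalues overlap. The overlap counts twice in their total,
  which is 1, and it is nonnegative because it consists of the largest among the last \<open>k\<close> eigenvalues.\<close>

lemma trace_le_1:
  assumes sp: "spectral N H v h" and sr: "sharp_range N k H" and k: "N \<le> 2 * k" "k \<le> N" "0 < k"
  shows "(\<Sum>i<N. h i) \<le> 1"
proof -
  have h: "\<And>i j. i \<le> j \<Longrightarrow> j < N \<Longrightarrow> h j \<le> h i" using sp by (auto simp: spectral_def)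
  have b: "(\<Sum>i=N - k..<N. h i) = (\<Sum>i=N - k..<k. h i) + (\<Sum>i=k..<N. h i)"
    using k by (intro sum.atLeastLessThan_concat[symmetric]) auto
  have t: "(\<Sum>i<N. h i) = (\<Sum>i<k. h i) + (\<Sum>i=k..<N. h i)" using k by (intro sum_split)
  have "0 \<le> (\<Sum>i=N - k..<k. h i)"
  proof (rule ccontr)
    assume neg: "\<not> 0 \<le> (\<Sum>i=N - k..<k. h i)"
    then obtain i where i: "i \<in> {N - k..<k}" "h i < 0" using sum_nonneg[of "{N - k..<k}" h] by force
    have "h j \<le> 0" if "j \<in> {k..<N}" for j using h[of i j] i that by auto
    then have "(\<Sum>i=k..<N. h i) \<le> 0" by (rule sum_nonpos)
    then show False using neg b sharp_range_bottom[OF sp sr k(2,3)] by simp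
  qed
  then show ?thesis using b t sharp_range_top[OF sp sr k(2,3)] sharp_range_bottom[OF sp sr k(2,3)] by simp
qed

text \<open>The bounds for the single traces all point in the same direction, and the traces add up to the trace of the
  identity, so all bounds are attained.\<close>

lemma sharp_resolution_trace:
  assumes sp: "\<And>s. s < N \<Longrightarrow> spectral N (H s) (V s) (h s)" and sr: "\<And>s. s < N \<Longrightarrow> sharp_range N k (H s)"
    and k: "k \<le> N" "0 < k"
    and S: "\<And>i. i < N \<Longrightarrow> (\<Sum>s<N. H s i i) = 1" and s: "s < N"
  shows "(\<Sum>i<N. h s i) = 1"
proof -
  have "complex_of_real (\<Sum>s<N. \<Sum>i<N. h s i) = (\<Sum>s<N. \<Sum>i<N. H s i i)"
    using spectral_trace[OF sp] by simp
  also have "\<dots> = (\<Sum>i<N. \<Sum>s<N. H s i i)" by (rule sum.swap)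
  also have "\<dots> = complex_of_real (real N)" by (simp add: S)
  finally have tot: "(\<Sum>s<N. \<Sum>i<N. h s i) = real N" by (simp only: of_real_eq_iff)
  have tot0: "(\<Sum>s<N. (\<Sum>i<N. h s i) - 1) = 0" using tot by (simp add: sum_subtractf)
  show ?thesis
  proof (cases "2 * k \<le> N")
    case True
    have "\<forall>s\<in>{..<N}. (\<Sum>i<N. h s i) - 1 = 0"
      using tot0 trace_ge_1[OF sp sr True k(2)] by (subst (asm) sum_nonneg_eq_0_iff) auto
    then show ?thesis using s by simp
  next
    case False
    have tot1: "(\<Sum>s<N. 1 - (\<Sum>i<N. h s i)) = 0" using tot by (simp add: sum_subtractf)
    have "\<forall>s\<in>{..<N}. 1 - (\<Sum>i<N. h s i) = 0"
      using tot1 trace_le_1[OF sp sr _ k] False by (subst (asm) sum_nonneg_eq_0_iff) auto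
    then show ?thesis using s by simp
  qed
qed

text \<open>If for each matrix the eigenvectors that do not belong to \<open>\<kappa> s\<close> are orthogonal to those of the other matrices,
  then there is room for only one of them in each matrix: \<open>N\<close> of them, one for each \<open>s\<close>, already form a basis.\<close>

lemma rank1_perturbations:
  fixes \<kappa> :: "nat \<Rightarrow> real"
  assumes sp: "\<And>s. s < N \<Longrightarrow> spectral N (H s) (V s) (h s)"
    and orth: "\<And>s t i j. s < N \<Longrightarrow> t < N \<Longrightarrow> s \<noteq> t \<Longrightarrow> i < N \<Longrightarrow> j < N \<Longrightarrow> h s i \<noteq> \<kappa> s \<Longrightarrow> h t j \<noteq> \<kappa> t \<Longrightarrow>
      ip N (V s i) (V t j) = 0"
    and ne: "\<And>s. s < N \<Longrightarrow> \<exists>i<N. h s i \<noteq> \<kappa> s"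
  obtains v and \<mu> :: "nat \<Rightarrow> real" where "orthonormal N N v" "\<And>s. s < N \<Longrightarrow> \<mu> s \<noteq> 0"
    "\<And>s i j. s < N \<Longrightarrow> i < N \<Longrightarrow> j < N \<Longrightarrow> H s i j = of_real (\<kappa> s) * of_bool (i = j) + of_real (\<mu> s) * (v s i * cnj (v s j))"
proof -
  have V: "orthonormal N N (V s)" if "s < N" for s using sp[OF that] by (simp add: spectral_def)
  obtain \<iota> where \<iota>: "\<And>s. s < N \<Longrightarrow> \<iota> s < N \<and> h s (\<iota> s) \<noteq> \<kappa> s" using ne by metis
  define v where "v s = V s (\<iota> s)" for s
  have v: "orthonormal N N v"
    unfolding orthonormal_def
  proof (intro allI impI)
    fix s t assume st: "s < N" "t < N"
    show "ip N (v s) (v t) = of_bool (s = t)"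
    proof (cases "s = t")
      case True
      then show ?thesis using orthonormalD[OF V[OF st(1)], of "\<iota> s" "\<iota> s"] \<iota>[OF st(1)] by (simp add: v_def)
    next
      case False
      then show ?thesis using orth[OF st False] \<iota>[OF st(1)] \<iota>[OF st(2)] by (simp add: v_def)
    qed
  qed
  have single: "h s i = \<kappa> s" if s: "s < N" and i: "i < N" "i \<noteq> \<iota> s" for s i
  proof (rule ccontr)
    assume c: "h s i \<noteq> \<kappa> s"
    have z: "ip N (v t) (V s i) = 0" if t: "t < N" for t
    proof (cases "t = s")
      case True
      then show ?thesis using orthonormalD[OF V[OF s], of "\<iota> s" i] \<iota>[OF s] i by (simp add: v_def)
    next
      case False
      then show ?thesis using orth[OF t s False _ i(1) _ c] \<iota>[OF t] by (simp add: v_def)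
    qed
    have "ip N (V s i) (V s i) = 0"
      unfolding parseval_ip[OF v, of "V s i" "V s i"] by (simp add: z)
    then show False using orthonormalD[OF V[OF s] i(1) i(1)] by simp
  qed
  define \<mu> where "\<mu> s = h s (\<iota> s) - \<kappa> s" for s
  have "H s i j = of_real (\<kappa> s) * of_bool (i = j) + of_real (\<mu> s) * (v s i * cnj (v s j))"
    if s: "s < N" and ij: "i < N" "j < N" for s i j
  proof -
    have "H s i j = (\<Sum>a<N. of_real (h s a) * (V s a i * cnj (V s a j)))"
      using sp[OF s] ij by (simp add: spectral_def)
    also have "\<dots> = (\<Sum>a<N. of_real (\<kappa> s) * (V s a i * cnj (V s a j))
        + (if a = \<iota> s then of_real (\<mu> s) * (V s a i * cnj (V s a j)) else 0))"
      using single[OF s] by (intro sum.cong refl) (auto simp: \<mu>_def algebra_simps)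
    also have "\<dots> = of_real (\<kappa> s) * (\<Sum>a<N. V s a i * cnj (V s a j)) + of_real (\<mu> s) * (v s i * cnj (v s j))"
      using \<iota>[OF s] by (simp add: sum.distrib sum_distrib_left v_def)
    finally show ?thesis using orthonormal_complete[OF V[OF s] ij] by simp
  qed
  moreover have "\<mu> s \<noteq> 0" if "s < N" for s using \<iota>[OF that] by (simp add: \<mu>_def)
  ultimately show ?thesis using that[OF v] by blast
qed

text \<open>Together with \<open>compatible\<close>: the traces of an orthogonal family of rank one projections, seen through the
  numerical ranges of their differences and sums.\<close>

definition separated :: "nat \<Rightarrow> nat \<Rightarrow> (nat \<Rightarrow> nat \<Rightarrow> nat \<Rightarrow> complex) \<Rightarrow> bool" where
  "separated N k H \<longleftrightarrow> (\<forall>s<N. \<forall>t<N. s \<noteq> t \<longrightarrow>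
    (\<exists>u. orthonormal N k u \<and> ctrace N k (H s) u = 1 \<and> ctrace N k (H t) u = 0))"

definition compatible :: "nat \<Rightarrow> nat \<Rightarrow> (nat \<Rightarrow> nat \<Rightarrow> nat \<Rightarrow> complex) \<Rightarrow> bool" where
  "compatible N k H \<longleftrightarrow> (\<forall>s<N. \<forall>t<N. s \<noteq> t \<longrightarrow>
    (\<exists>u. orthonormal N k u \<and> ctrace N k (H s) u = 1 \<and> ctrace N k (H t) u = 1))"

lemma separatedD:
  assumes "separated N k H" "s < N" "t < N" "s \<noteq> t"
  obtains u where "orthonormal N k u" "ctrace N k (H s) u = 1" "ctrace N k (H t) u = 0"
  using assms by (auto simp: separated_def)

lemma compatibleD:
  assumes "compatible N k H" "s < N" "t < N" "s \<noteq> t"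
  obtains u where "orthonormal N k u" "ctrace N k (H s) u = 1" "ctrace N k (H t) u = 1"
  using assms by (auto simp: compatible_def)

lemma spectral_weights:
  assumes sp: "spectral N H v h" and u: "orthonormal N k u"
  shows "(\<Sum>i<N. weight N k u (v i)) = real k" "\<And>i. i < N \<Longrightarrow> 0 \<le> weight N k u (v i) \<and> weight N k u (v i) \<le> 1"
    "\<And>r. ctrace N k H u = of_real r \<Longrightarrow> (\<Sum>i<N. h i * weight N k u (v i)) = r"
proof -
  have v: "orthonormal N N v" using sp by (simp add: spectral_def)
  note w = orthonormal_weights[OF v u]
  show "(\<Sum>i<N. weight N k u (v i)) = real k" by (rule w)
  show "\<And>i. i < N \<Longrightarrow> 0 \<le> weight N k u (v i) \<and> weight N k u (v i) \<le> 1" by (rule w)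
  show "\<And>r. ctrace N k H u = of_real r \<Longrightarrow> (\<Sum>i<N. h i * weight N k u (v i)) = r"
    unfolding ctrace_spectral[OF sp] by (simp only: of_real_eq_iff)
qed

text \<open>A family that attains the value 1 contains all eigenvectors above the threshold and is orthogonal to all
  eigenvectors below it; for the value 0 it is the other way round.\<close>

lemma sharp_range_attain_1:
  assumes sp: "spectral N H v h" and sr: "sharp_range N k H" and k: "k \<le> N" "0 < k"
    and tau: "\<And>i. i < k \<Longrightarrow> \<tau> \<le> h i" "\<And>i. k \<le> i \<Longrightarrow> i < N \<Longrightarrow> h i \<le> \<tau>"
    and u: "orthonormal N k u" "ctrace N k H u = 1" and i: "i < N"
  shows "h i > \<tau> \<Longrightarrow> weight N k u (v i) = 1" "h i < \<tau> \<Longrightarrow> weight N k u (v i) = 0"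
proof -
  note w = spectral_weights[OF sp u(1)]
  have "(\<Sum>i<N. h i * weight N k u (v i)) = (\<Sum>i<k. h i)"
    using w(3)[of 1] u(2) sharp_range_top[OF sp sr k] by simp
  then have "(h i > \<tau> \<longrightarrow> weight N k u (v i) = 1) \<and> (h i < \<tau> \<longrightarrow> weight N k u (v i) = 0)"
    using w(1,2) tau i k by (intro top_sum_eq[of k N "\<lambda>i. weight N k u (v i)" \<tau> h]) auto
  then show "h i > \<tau> \<Longrightarrow> weight N k u (v i) = 1" "h i < \<tau> \<Longrightarrow> weight N k u (v i) = 0" by auto
qed

lemma sharp_range_attain_0:
  assumes sp: "spectral N H v h" and sr: "sharp_range N k H" and k: "k \<le> N" "0 < k"
    and sigma: "\<And>i. i < N - k \<Longrightarrow> \<sigma> \<le> h i" "\<And>i. N - k \<le> i \<Longrightarrow> i < N \<Longrightarrow> h i \<le> \<sigma>"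
    and u: "orthonormal N k u" "ctrace N k H u = 0" and i: "i < N"
  shows "h i < \<sigma> \<Longrightarrow> weight N k u (v i) = 1" "h i > \<sigma> \<Longrightarrow> weight N k u (v i) = 0"
proof -
  note w = spectral_weights[OF sp u(1)]
  have "(\<Sum>i<N. h i * weight N k u (v i)) = (\<Sum>i=N - k..<N. h i)"
    using w(3)[of 0] u(2) sharp_range_bottom[OF sp sr k] by simp
  then have "(h i < \<sigma> \<longrightarrow> weight N k u (v i) = 1) \<and> (h i > \<sigma> \<longrightarrow> weight N k u (v i) = 0)"
    using w(1,2) sigma i k by (intro bottom_sum_eq[of k N "\<lambda>i. weight N k u (v i)" \<sigma> h]) auto
  then show "h i < \<sigma> \<Longrightarrow> weight N k u (v i) = 1" "h i > \<sigma> \<Longrightarrow> weight N k u (v i) = 0" by auto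
qed

text \<open>For \<open>2k < N\<close> trace 1 leaves no room for eigenvalues in the middle, so the matrices are positive
  semidefinite with threshold 0. The family that separates \<open>s\<close> from \<open>t\<close> contains the range of \<open>H s\<close> and is
  orthogonal to the range of \<open>H t\<close>.\<close>

lemma exceptional_orthogonal_small:
  assumes sp: "\<And>s. s < N \<Longrightarrow> spectral N (H s) (V s) (h s)" and sr: "\<And>s. s < N \<Longrightarrow> sharp_range N k (H s)"
    and k: "2 * k < N" "0 < k"
    and tr: "\<And>s. s < N \<Longrightarrow> (\<Sum>i<N. h s i) = 1" and D: "separated N k H"
  shows "\<And>s t i j. s < N \<Longrightarrow> t < N \<Longrightarrow> s \<noteq> t \<Longrightarrow> i < N \<Longrightarrow> j < N \<Longrightarrow> h s i \<noteq> 0 \<Longrightarrow> h t j \<noteq> 0 \<Longrightarrow>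
      ip N (V s i) (V t j) = 0"
    and "\<And>s. s < N \<Longrightarrow> \<exists>i<N. h s i \<noteq> 0"
proof -
  have kN: "k \<le> N" "2 * k \<le> N" using k by auto
  have anti: "h s j \<le> h s i" if "s < N" "i \<le> j" "j < N" for s i j
    using sp[OF that(1)] that by (auto simp: spectral_def)
  have pos: "0 \<le> h s i" if "s < N" "i \<le> N - k" for s i
    by (rule sharp_range_nonneg[OF sp sr kN(1) k(2)]) (use that in auto)
  have hk: "h s k = 0" if s: "s < N" for s
  proof -
    have "(\<Sum>i=k..<N - k. h s i) = 0"
      using trace_ge_1[OF sp[OF s] sr[OF s] kN(2) k(2)] tr[OF s] by simp
    then have "\<forall>i\<in>{k..<N - k}. h s i = 0"
      using pos[OF s] by (subst (asm) sum_nonneg_eq_0_iff) auto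
    then show ?thesis using k by simp
  qed
  have bot: "h s i = 0" if s: "s < N" and i: "k \<le> i" "i < N" for s i
  proof (cases "i < N - k")
    case True
    then show ?thesis using pos[OF s, of i] anti[OF s i] hk[OF s] by simp
  next
    case False
    have 0: "(\<Sum>i=N - k..<N. - h s i) = 0"
      using sharp_range_bottom[OF sp[OF s] sr[OF s] kN(1) k(2)] by (simp add: sum_negf)
    have "h s j \<le> 0" if "j \<in> {N - k..<N}" for j using anti[OF s, of k j] hk[OF s] that k by auto
    then have "\<forall>i\<in>{N - k..<N}. - h s i = 0" using 0 by (subst (asm) sum_nonneg_eq_0_iff) auto
    then show ?thesis using False i by simp
  qed
  have nonneg: "0 \<le> h s i" if "s < N" "i < N" for s i
    using bot[OF that(1), of i] pos[OF that(1), of i] that kN by (cases "k \<le> i") auto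
  show "\<exists>i<N. h s i \<noteq> 0" if s: "s < N" for s
    using tr[OF s] by (metis lessThan_iff sum.neutral zero_neq_one)
  fix s t i j assume st: "s < N" "t < N" "s \<noteq> t" and ij: "i < N" "j < N" and ne: "h s i \<noteq> 0" "h t j \<noteq> 0"
  obtain u where u: "orthonormal N k u" "ctrace N k (H s) u = 1" "ctrace N k (H t) u = 0"
    by (rule separatedD[OF D st])
  have 1: "weight N k u (V s i) = 1"
    by (rule sharp_range_attain_1[OF sp[OF st(1)] sr[OF st(1)] kN(1) k(2), of 0])
      (use u ij ne nonneg[OF st(1)] bot[OF st(1)] kN in \<open>auto simp: less_le\<close>)
  have "(\<Sum>i<N. h t i * weight N k u (V t i)) = 0"
    using spectral_weights(3)[OF sp[OF st(2)] u(1), of 0] u(3) by simp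
  then have "\<forall>i\<in>{..<N}. h t i * weight N k u (V t i) = 0"
    using nonneg[OF st(2)] weight_nonneg by (subst (asm) sum_nonneg_eq_0_iff) auto
  then have 0: "weight N k u (V t j) = 0" using ij ne by auto
  have "ip N (V s i) (V s i) = 1"
    using sp[OF st(1)] orthonormalD[of N N "V s" i i] ij by (simp add: spectral_def)
  then show "ip N (V s i) (V t j) = 0" by (rule weight_orthogonal[OF u(1) 1 _ 0])
qed

text \<open>For \<open>N = 2k\<close> the value \<open>h s k\<close> separates the first \<open>k\<close> eigenvalues from the last \<open>k\<close>, so it is a threshold
  for maxima and for minima at the same time. Eigenvectors on the same side of the thresholds are orthogonal
  because of a family that separates \<open>s\<close> from \<open>t\<close>, eigenvectors on different sides because of a family that
  attains the value 1 at both.\<close>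

lemma exceptional_orthogonal_half:
  assumes sp: "\<And>s. s < N \<Longrightarrow> spectral N (H s) (V s) (h s)" and sr: "\<And>s. s < N \<Longrightarrow> sharp_range N k (H s)"
    and k: "N = 2 * k" "0 < k" and D: "separated N k H" and E: "compatible N k H"
  shows "\<And>s t i j. s < N \<Longrightarrow> t < N \<Longrightarrow> s \<noteq> t \<Longrightarrow> i < N \<Longrightarrow> j < N \<Longrightarrow> h s i \<noteq> h s k \<Longrightarrow> h t j \<noteq> h t k \<Longrightarrow>
      ip N (V s i) (V t j) = 0"
    and "\<And>s. s < N \<Longrightarrow> \<exists>i<N. h s i \<noteq> h s k"
proof -
  have kN: "k \<le> N" "0 < k" "N - k = k" using k by auto
  have anti: "h s j \<le> h s i" if "s < N" "i \<le> j" "j < N" for s i j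
    using sp[OF that(1)] that by (auto simp: spectral_def)
  have hi: "h s k \<le> h s i" if "s < N" "i < k" for s i using anti[OF that(1), of i k] that k by auto
  have lo: "h s i \<le> h s k" if "s < N" "k \<le> i" "i < N" for s i using anti[OF that(1), of k i] that by auto
  show "\<exists>i<N. h s i \<noteq> h s k" if s: "s < N" for s
  proof (rule ccontr)
    assume "\<not> ?thesis"
    then have c: "h s i = h s k" if "i < N" for i using that by auto
    have "(\<Sum>i<k. h s i) = (\<Sum>i<k. h s k)" by (intro sum.cong refl c) (use kN in auto)
    moreover have "(\<Sum>i=N - k..<N. h s i) = (\<Sum>i=N - k..<N. h s k)" by (intro sum.cong refl c) auto
    ultimately show False
      using sharp_range_top[OF sp[OF s] sr[OF s] kN(1,2)] sharp_range_bottom[OF sp[OF s] sr[OF s] kN(1,2)] kN by auto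
  qed
  have unit: "ip N (V s i) (V s i) = 1" if "s < N" "i < N" for s i
    using sp[OF that(1)] orthonormalD[of N N "V s" i i] that by (simp add: spectral_def)
  fix s t i j assume st: "s < N" "t < N" "s \<noteq> t" and ij: "i < N" "j < N" and ne: "h s i \<noteq> h s k" "h t j \<noteq> h t k"
  obtain u where u: "orthonormal N k u" "ctrace N k (H s) u = 1" "ctrace N k (H t) u = 0"
    by (rule separatedD[OF D st])
  obtain u' where u': "orthonormal N k u'" "ctrace N k (H s) u' = 1" "ctrace N k (H t) u' = 1"
    by (rule compatibleD[OF E st])
  have thr: "i < k \<Longrightarrow> h s k \<le> h s i" "i < N - k \<Longrightarrow> h s k \<le> h s i"
    "k \<le> i \<Longrightarrow> i < N \<Longrightarrow> h s i \<le> h s k" "N - k \<le> i \<Longrightarrow> i < N \<Longrightarrow> h s i \<le> h s k" if "s < N" for s i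
    using hi[OF that] lo[OF that] kN by auto
  note us = sharp_range_attain_1[OF sp[OF st(1)] sr[OF st(1)] kN(1,2) thr(1,3)[OF st(1)] u(1,2) ij(1)]
  note ut = sharp_range_attain_0[OF sp[OF st(2)] sr[OF st(2)] kN(1,2) thr(2,4)[OF st(2)] u(1,3) ij(2)]
  note us' = sharp_range_attain_1[OF sp[OF st(1)] sr[OF st(1)] kN(1,2) thr(1,3)[OF st(1)] u'(1,2) ij(1)]
  note ut' = sharp_range_attain_1[OF sp[OF st(2)] sr[OF st(2)] kN(1,2) thr(1,3)[OF st(2)] u'(1,3) ij(2)]
  note o = weight_orthogonal[OF u(1) _ unit[OF st(1) ij(1)]] weight_orthogonal[OF u(1) _ unit[OF st(2) ij(2)]]
    weight_orthogonal[OF u'(1) _ unit[OF st(1) ij(1)]] weight_orthogonal[OF u'(1) _ unit[OF st(2) ij(2)]]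
  have swap: "ip N (V s i) (V t j) = 0" if "ip N (V t j) (V s i) = 0"
    using that cnj_ip[of N "V t j" "V s i"] by simp
  consider "h s i > h s k" "h t j > h t k" | "h s i < h s k" "h t j < h t k"
    | "h s i > h s k" "h t j < h t k" | "h s i < h s k" "h t j > h t k"
    using ne by linarith
  then show "ip N (V s i) (V t j) = 0"
  proof cases
    case 1
    then show ?thesis using o(1)[OF us(1) ut(2)] by simp
  next
    case 2
    then show ?thesis using o(2)[OF ut(1) us(2)] swap by simp
  next
    case 3
    then show ?thesis using o(3)[OF us'(1) ut'(2)] by simp
  next
    case 4
    then show ?thesis using o(4)[OF ut'(1) us'(2)] swap by simp
  qed
qed

lemma quad_scalar_rank1:
  assumes "\<And>i j. i < N \<Longrightarrow> j < N \<Longrightarrow> H i j = of_real \<kappa> * of_bool (i = j) + of_real \<mu> * (v i * cnj (v j))"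
  shows "quad N H x = of_real \<kappa> * ip N x x + of_real (\<mu> * (cmod (ip N v x))\<^sup>2)"
proof -
  let ?c = "\<lambda>b. if b then of_real \<kappa> else complex_of_real \<mu>"
  let ?G = "\<lambda>b i j. if b then of_bool (i = j) else v i * cnj (v j)"
  have "quad N H x = quad N (\<lambda>i j. \<Sum>b\<in>{True, False}. ?c b * ?G b i j) x"
    by (intro quad_cong) (simp add: assms)
  also have "\<dots> = of_real \<kappa> * quad N (\<lambda>i j. of_bool (i = j)) x + of_real \<mu> * quad N (\<lambda>i j. v i * cnj (v j)) x"
    by (subst quad_sum) simp
  also have "quad N (\<lambda>i j. of_bool (i = j)) x = ip N x x"
    unfolding quad_def ip_def by (intro sum.cong refl) (simp add: of_bool_def if_distrib if_distribR cong: if_cong)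
  finally show ?thesis by (simp add: quad_rank1)
qed

text \<open>The extreme values of a scalar plus a rank one matrix are taken on families that contain \<open>v\<close> and on families
  that are orthogonal to it. They have to be 0 and 1, in one order or the other.\<close>

lemma sharp_range_scalar_rank1:
  assumes H: "\<And>i j. i < N \<Longrightarrow> j < N \<Longrightarrow> H i j = of_real \<kappa> * of_bool (i = j) + of_real \<mu> * (v i * cnj (v j))"
    and v: "ip N v v = 1" and mu: "\<mu> \<noteq> 0" and sr: "sharp_range N k H" and k: "0 < k" "k < N"
  shows "(\<kappa> = 0 \<and> \<mu> = 1) \<or> (\<kappa> = 1 / real k \<and> \<mu> = - 1)"
proof -
  have c: "ctrace N k H u = of_real (real k * \<kappa> + \<mu> * weight N k u v)" if u: "orthonormal N k u" for u
  proof -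
    have "ctrace N k H u = (\<Sum>c<k. of_real \<kappa> + of_real (\<mu> * (cmod (ip N (u c) v))\<^sup>2))"
      unfolding ctrace_def
      by (intro sum.cong refl) (use orthonormalD[OF u] in \<open>simp add: quad_scalar_rank1[OF H] cmod_ip_commute[of N v]\<close>)
    then show ?thesis by (simp add: weight_def sum.distrib sum_distrib_left)
  qed
  obtain w where w: "orthonormal N N w" "w 0 = v"
    using orthonormal_extend[OF orthonormal_single[OF v]] k by fastforce
  have o1: "orthonormal N k w" using orthonormal_mono[OF w(1)] k by simp
  have o2: "orthonormal N k (\<lambda>a. w (Suc a))" using k by (intro orthonormal_reindex[OF w(1)]) auto
  have "weight N k w v = (\<Sum>c<k. if c = 0 then 1 else 0)"
    unfolding weight_def w(2)[symmetric] using k orthonormalD[OF w(1)] by (intro sum.cong refl) auto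
  then have w1: "weight N k w v = 1" using k by simp
  have w2: "weight N k (\<lambda>a. w (Suc a)) v = 0"
    unfolding weight_def w(2)[symmetric] using k orthonormalD[OF w(1)] by (intro sum.neutral) auto
  have b: "0 \<le> real k * \<kappa> + \<mu>" "real k * \<kappa> + \<mu> \<le> 1" "0 \<le> real k * \<kappa>" "real k * \<kappa> \<le> 1"
    using sr c[OF o1] c[OF o2] w1 w2 o1 o2 unfolding sharp_range_def by fastforce+
  obtain u1 u0 where u1: "orthonormal N k u1" "ctrace N k H u1 = 1" and u0: "orthonormal N k u0" "ctrace N k H u0 = 0"
    using sr unfolding sharp_range_def by blast
  have e1: "real k * \<kappa> + \<mu> * weight N k u1 v = 1" using c[OF u1(1)] u1(2) by (metis of_real_eq_1_iff)
  have e0: "real k * \<kappa> + \<mu> * weight N k u0 v = 0" using c[OF u0(1)] u0(2) by (metis of_real_eq_0_iff)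
  have q1: "0 \<le> weight N k u1 v" "weight N k u1 v \<le> 1" using weight_nonneg weight_le[OF u1(1) v] by auto
  have q0: "0 \<le> weight N k u0 v" "weight N k u0 v \<le> 1" using weight_nonneg weight_le[OF u0(1) v] by auto
  show ?thesis
  proof (cases "\<mu> > 0")
    case True
    have "\<mu> * weight N k u1 v \<le> \<mu>" "0 \<le> \<mu> * weight N k u0 v" using True q1 q0 by (simp_all add: mult_left_le)
    then have "real k * \<kappa> + \<mu> = 1" "real k * \<kappa> = 0" using e1 e0 b by linarith+
    then show ?thesis using k by simp
  next
    case False
    then have neg: "\<mu> < 0" using mu by simp
    have "\<mu> * weight N k u1 v \<le> 0" "\<mu> \<le> \<mu> * weight N k u0 v"
      using neg q1 q0 by (simp_all add: mult_nonpos_nonneg mult_le_cancel_left1)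
    then have "real k * \<kappa> + \<mu> = 0" "real k * \<kappa> = 1" using e1 e0 b by linarith+
    then show ?thesis using k by (auto simp: field_simps)
  qed
qed

text \<open>For \<open>N < 2k\<close> the complement of a family of length \<open>k\<close> reduces the claim to \<open>N - k\<close>, because all traces
  are 1.\<close>

theorem resolution_rank1:
  assumes k: "0 < k" "k < N"
    and herm: "\<And>s. s < N \<Longrightarrow> hermitian N (H s)" and sr: "\<And>s. s < N \<Longrightarrow> sharp_range N k (H s)"
    and D: "separated N k H" and E: "N = 2 * k \<Longrightarrow> compatible N k H"
    and S: "\<And>i j. i < N \<Longrightarrow> j < N \<Longrightarrow> (\<Sum>s<N. H s i j) = of_bool (i = j)"
  obtains v where "orthonormal N N v"
    "(\<forall>s<N. \<forall>i<N. \<forall>j<N. H s i j = v s i * cnj (v s j)) \<or>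
     N = 2 * k \<and> (\<forall>s<N. \<forall>i<N. \<forall>j<N. H s i j = of_bool (i = j) / of_nat k - v s i * cnj (v s j))"
proof -
  have "\<exists>v h. spectral N (H s) v h" if "s < N" for s
    using hermitian_spectral[OF herm[OF that]] unfolding spectral_def by blast
  then obtain V h where sp: "\<And>s. s < N \<Longrightarrow> spectral N (H s) (V s) (h s)" by metis
  have tr: "(\<Sum>i<N. h s i) = 1" if "s < N" for s
    by (rule sharp_resolution_trace[OF sp sr _ k(1) _ that]) (use k S in auto)
  have trH: "(\<Sum>i<N. H s i i) = 1" if "s < N" for s using spectral_trace[OF sp[OF that]] tr[OF that] by simp
  obtain \<kappa> v and \<mu> :: "nat \<Rightarrow> real" where v: "orthonormal N N v" and mu: "\<And>s. s < N \<Longrightarrow> \<mu> s \<noteq> 0"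
    and H: "\<And>s i j. s < N \<Longrightarrow> i < N \<Longrightarrow> j < N \<Longrightarrow>
      H s i j = of_real (\<kappa> s) * of_bool (i = j) + of_real (\<mu> s) * (v s i * cnj (v s j))"
    and kappa: "N \<noteq> 2 * k \<Longrightarrow> \<forall>s. \<kappa> s = 0"
  proof (cases "N = 2 * k")
    case True
    obtain v \<mu> where "orthonormal N N v" "\<And>s. s < N \<Longrightarrow> \<mu> s \<noteq> 0"
      "\<And>s i j. s < N \<Longrightarrow> i < N \<Longrightarrow> j < N \<Longrightarrow>
        H s i j = of_real (h s k) * of_bool (i = j) + of_real (\<mu> s) * (v s i * cnj (v s j))"
      by (rule rank1_perturbations[OF sp exceptional_orthogonal_half[OF sp sr True k(1) D E[OF True]]])
        auto
    then show ?thesis using that[of v \<mu> "\<lambda>s. h s k"] True by blast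
  next
    case False
    show ?thesis
    proof (cases "2 * k < N")
      case True
      obtain v and \<mu> :: "nat \<Rightarrow> real" where "orthonormal N N v" "\<And>s. s < N \<Longrightarrow> \<mu> s \<noteq> 0"
        "\<And>s i j. s < N \<Longrightarrow> i < N \<Longrightarrow> j < N \<Longrightarrow>
          H s i j = of_real 0 * of_bool (i = j) + of_real (\<mu> s) * (v s i * cnj (v s j))"
        by (rule rank1_perturbations[of N H V h "\<lambda>_. 0"])
          (use sp exceptional_orthogonal_small[of N H V h, OF sp sr True k(1) tr D] in auto)
      then show ?thesis using that[of v \<mu> "\<lambda>_. 0"] by blast
    next
      case large: False
      define l where "l = N - k"
      have l: "2 * l < N" "0 < l" "N - l = k" using large False k by (auto simp: l_def)
      have co: "\<exists>u'. orthonormal N l u' \<and> (\<forall>s<N. ctrace N l (H s) u' = 1 - ctrace N k (H s) u)"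
        if u: "orthonormal N k u" for u
        using orthonormal_complement[OF u] trH unfolding l_def by metis
      have co': "\<exists>u'. orthonormal N k u' \<and> (\<forall>s<N. ctrace N k (H s) u' = 1 - ctrace N l (H s) u)"
        if u: "orthonormal N l u" for u
        using orthonormal_complement[OF u] trH unfolding l(3) by metis
      have sr': "sharp_range N l (H s)" if s: "s < N" for s
        unfolding sharp_range_def
      proof (intro conjI allI impI)
        fix u assume u: "orthonormal N l u"
        obtain u' where u': "orthonormal N k u'" "\<forall>s<N. ctrace N k (H s) u' = 1 - ctrace N l (H s) u"
          using co'[OF u] by blast
        have "0 \<le> Re (1 - ctrace N l (H s) u) \<and> Re (1 - ctrace N l (H s) u) \<le> 1"
          using sr[OF s] u' s unfolding sharp_range_def by metis
        then show "0 \<le> Re (ctrace N l (H s) u)" "Re (ctrace N l (H s) u) \<le> 1" by auto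
      next
        obtain u1 u0 where u: "orthonormal N k u1" "ctrace N k (H s) u1 = 1" "orthonormal N k u0" "ctrace N k (H s) u0 = 0"
          using sr[OF s] unfolding sharp_range_def by blast
        show "\<exists>u. orthonormal N l u \<and> ctrace N l (H s) u = 1" using co[OF u(3)] u(4) s by auto
        show "\<exists>u. orthonormal N l u \<and> ctrace N l (H s) u = 0" using co[OF u(1)] u(2) s by auto
      qed
      have D': "separated N l H"
        unfolding separated_def
      proof (intro allI impI)
        fix s t assume st: "s < N" "t < N" "s \<noteq> t"
        obtain u where u: "orthonormal N k u" "ctrace N k (H t) u = 1" "ctrace N k (H s) u = 0"
          by (rule separatedD[OF D st(2,1) st(3)[symmetric]])
        show "\<exists>u. orthonormal N l u \<and> ctrace N l (H s) u = 1 \<and> ctrace N l (H t) u = 0"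
          using co[OF u(1)] u(2,3) st by auto
      qed
      obtain v and \<mu> :: "nat \<Rightarrow> real" where "orthonormal N N v" "\<And>s. s < N \<Longrightarrow> \<mu> s \<noteq> 0"
        "\<And>s i j. s < N \<Longrightarrow> i < N \<Longrightarrow> j < N \<Longrightarrow>
          H s i j = of_real 0 * of_bool (i = j) + of_real (\<mu> s) * (v s i * cnj (v s j))"
        by (rule rank1_perturbations[of N H V h "\<lambda>_. 0"])
          (use sp exceptional_orthogonal_small[of N H V h, OF sp sr' l(1,2) tr D'] in auto)
      then show ?thesis using that[of v \<mu> "\<lambda>_. 0"] by blast
    qed
  qed
  have unit: "ip N (v s) (v s) = 1" if "s < N" for s using orthonormalD[OF v that that] by simp
  have alt: "(\<kappa> s = 0 \<and> \<mu> s = 1) \<or> (\<kappa> s = 1 / real k \<and> \<mu> s = - 1)" if s: "s < N" for s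
    by (rule sharp_range_scalar_rank1[OF H[OF s] unit[OF s] mu[OF s] sr[OF s] k])
  \<comment> \<open>Evaluating the resolution of the identity at \<open>v t\<close> rules out mixtures of the two types.\<close>
  have tot: "(\<Sum>s<N. \<kappa> s) + \<mu> t = 1" if t: "t < N" for t
  proof -
    have "complex_of_real ((\<Sum>s<N. \<kappa> s) + \<mu> t) = (\<Sum>s<N. of_real (\<kappa> s) + (if s = t then of_real (\<mu> s) else 0))"
      using t by (simp add: sum.distrib)
    also have "\<dots> = (\<Sum>s<N. quad N (H s) (v t))"
      using t orthonormalD[OF v] by (intro sum.cong refl) (auto simp: quad_scalar_rank1[OF H])
    also have "\<dots> = quad N (\<lambda>i j. \<Sum>s<N. 1 * H s i j) (v t)" by (subst quad_sum) simp
    also have "\<dots> = 1"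
    proof -
      have "quad N (\<lambda>i j. \<Sum>s<N. 1 * H s i j) (v t)
        = of_real 1 * ip N (v t) (v t) + of_real (0 * (cmod (ip N (v t) (v t)))\<^sup>2)"
        by (rule quad_scalar_rank1) (simp add: S)
      then show ?thesis by (simp add: unit[OF t])
    qed
    finally show ?thesis by (simp only: of_real_eq_1_iff)
  qed
  have nonneg: "0 \<le> \<kappa> s" if "s < N" for s using alt[OF that] by auto
  show ?thesis
  proof (cases "\<exists>t<N. \<mu> t = 1")
    case True
    then have z: "(\<Sum>s<N. \<kappa> s) = 0" using tot by fastforce
    have "\<forall>s\<in>{..<N}. \<kappa> s = 0" using z nonneg by (subst (asm) sum_nonneg_eq_0_iff) auto
    then have "\<kappa> s = 0 \<and> \<mu> s = 1" if "s < N" for s using alt[OF that] that k by auto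
    then show ?thesis using H by (intro that[OF v] disjI1) simp
  next
    case False
    then have m: "\<kappa> s = 1 / real k \<and> \<mu> s = - 1" if "s < N" for s using alt[OF that] that by auto
    have "N = 2 * k" using kappa m[of 0] k by fastforce
    then show ?thesis using H m by (intro that[OF v] disjI2) (simp add: algebra_simps)
  qed
qed

section \<open>Numerical ranges of tensor products\<close>

text \<open>The \<open>k\<close>-numerical range, scaled by \<open>k\<close>.\<close>

definition trace_range :: "nat \<Rightarrow> nat \<Rightarrow> (nat \<Rightarrow> nat \<Rightarrow> complex) \<Rightarrow> complex set" where
  "trace_range N k H = {ctrace N k H u | u. orthonormal N k u}"

lemma trace_range_transfer:
  assumes "trace_range N k H = trace_range N k G" "orthonormal N k u"
  obtains u' where "orthonormal N k u'" "ctrace N k G u' = ctrace N k H u"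
proof -
  have "ctrace N k H u \<in> trace_range N k G" using assms by (auto simp: trace_range_def)
  then show ?thesis using that by (auto simp: trace_range_def)
qed

lemma sum_two:
  fixes f g :: "nat \<Rightarrow> 'a :: comm_monoid_add"
  assumes "i < N" "j < N" "i \<noteq> j"
  shows "(\<Sum>l<N. if l = i then f l else if l = j then g l else 0) = f i + g j"
proof -
  have "(\<Sum>l<N. if l = i then f l else if l = j then g l else 0)
    = (\<Sum>l<N. (if l = i then f l else 0) + (if l = j then g l else 0))"
    using assms(3) by (intro sum.cong refl) auto
  then show ?thesis using assms by (simp add: sum.distrib)
qed

lemma quad_scale: "quad N G (\<lambda>i. c * x i) = cnj c * c * quad N G x"
  by (simp add: quad_def sum_distrib_left mult_ac)

lemma quad_two:
  assumes "i < N" "j < N" "i \<noteq> j"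
  shows "quad N G (\<lambda>l. if l = i then a else if l = j then b else 0)
    = cnj a * G i i * a + cnj a * G i j * b + (cnj b * G j i * a + cnj b * G j j * b)"
proof -
  have "mat_app N G (\<lambda>l. if l = i then a else if l = j then b else 0) p = G p i * a + G p j * b" for p
  proof -
    have "mat_app N G (\<lambda>l. if l = i then a else if l = j then b else 0) p
      = (\<Sum>l<N. if l = i then G p l * a else if l = j then G p l * b else 0)"
      unfolding mat_app_def by (intro sum.cong refl) auto
    then show ?thesis by (simp add: sum_two[OF assms])
  qed
  then have "quad N G (\<lambda>l. if l = i then a else if l = j then b else 0)
    = (\<Sum>l<N. if l = i then cnj a * (G l i * a + G l j * b) else if l = j then cnj b * (G l i * a + G l j * b) else 0)"
    unfolding quad_mat_app ip_def by (intro sum.cong refl) auto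
  then show ?thesis by (simp add: sum_two[OF assms] algebra_simps)
qed

text \<open>Exchanging one member of the family shows that the quadratic form takes the same value at all members of an
  orthonormal basis. As \<open>k\<close> of these values add up to 0, the form vanishes at every unit vector.\<close>

lemma ctrace_eq_0_imp_eq_0:
  assumes k: "0 < k" "k < N" and z: "\<And>u. orthonormal N k u \<Longrightarrow> ctrace N k G u = 0"
    and ij: "i < N" "j < N"
  shows "G i j = 0"
proof -
  have unit: "quad N G x = 0" if x: "ip N x x = 1" for x
  proof -
    obtain v where v: "orthonormal N N v" "v 0 = x"
      using orthonormal_extend[OF orthonormal_single[OF x]] k by fastforce
    have "orthonormal N k v" using orthonormal_mono[OF v(1)] k by simp
    then have s0: "(\<Sum>c<k. quad N G (v c)) = 0" using z by (simp add: ctrace_def)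
    have eq: "quad N G (v a) = quad N G (v k)" if a: "a < k" for a
    proof -
      have "orthonormal N k (\<lambda>c. v (if c = a then k else c))"
        using k by (intro orthonormal_reindex[OF v(1)]) (auto simp: inj_on_def)
      then have "(\<Sum>c<k. quad N G (v (if c = a then k else c))) = 0" using z by (simp add: ctrace_def)
      moreover have "(\<Sum>c<k. quad N G (v (if c = a then k else c)))
        = (\<Sum>c<k. quad N G (v c) + (if c = a then quad N G (v k) - quad N G (v a) else 0))"
        by (intro sum.cong refl) auto
      ultimately show ?thesis using s0 a by (simp add: sum.distrib)
    qed
    have "(\<Sum>c<k. quad N G (v c)) = of_nat k * quad N G (v k)" using eq by simp
    then have "quad N G (v k) = 0" using s0 k by simp
    then show ?thesis using eq[OF k(1)] v(2) by simp
  qed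
  have all: "quad N G x = 0" for x
  proof (cases "\<exists>i<N. x i \<noteq> 0")
    case True
    then obtain i where i: "i < N" "x i \<noteq> 0" by blast
    obtain c where "c \<noteq> 0" "ip N (\<lambda>i. c * x i) (\<lambda>i. c * x i) = 1" using normalize[of i N x, OF i] by blast
    then show ?thesis using unit[of "\<lambda>i. c * x i"] by (simp add: quad_scale)
  next
    case False
    then show ?thesis by (simp add: quad_def)
  qed
  show ?thesis
  proof (cases "i = j")
    case True
    have "(1::nat) < N" using k by simp
    then obtain l where l: "l < N" "i \<noteq> l" using that[of "if i = 0 then 1 else 0"] k by auto
    show ?thesis using all[of "\<lambda>p. if p = i then 1 else if p = l then 0 else 0"] True
      unfolding quad_two[OF ij(1) l] by simp
  next
    case False
    have d: "G i i = 0" using all[of "\<lambda>p. if p = i then 1 else if p = j then 0 else 0"]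
      unfolding quad_two[OF ij False] by simp
    have e: "G j j = 0" using all[of "\<lambda>p. if p = i then 0 else if p = j then 1 else 0"]
      unfolding quad_two[OF ij False] by simp
    have 1: "G i j + G j i = 0" using all[of "\<lambda>p. if p = i then 1 else if p = j then 1 else 0"]
      unfolding quad_two[OF ij False] by (simp add: d e)
    have 2: "G i j * \<i> - \<i> * G j i = 0" using all[of "\<lambda>p. if p = i then 1 else if p = j then \<i> else 0"]
      unfolding quad_two[OF ij False] by (simp add: d e)
    have "\<i> * (G i j - G j i) = 0" using 2 by (simp add: algebra_simps)
    then have "G i j = G j i" by simp
    then show ?thesis using 1 by simp
  qed
qed

lemma ctrace_add: "ctrace N k (\<lambda>i j. G i j + H i j) u = ctrace N k G u + ctrace N k H u"
  by (simp add: ctrace_def quad_def ring_distribs sum.distrib)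

lemma ctrace_scale: "ctrace N k (\<lambda>i j. c * G i j) u = c * ctrace N k G u"
  by (simp add: ctrace_def quad_def sum_distrib_left mult_ac)

lemma ctrace_cong: "(\<And>i j. i < N \<Longrightarrow> j < N \<Longrightarrow> H i j = H' i j) \<Longrightarrow> ctrace N k H u = ctrace N k H' u"
  by (simp add: ctrace_def quad_def)

lemma quad_adjoint: "quad N (\<lambda>i j. cnj (H j i)) x = cnj (quad N H x)"
  unfolding quad_def by (subst sum.swap) (simp add: mult_ac)

lemma ctrace_adjoint: "ctrace N k (\<lambda>i j. cnj (H j i)) u = cnj (ctrace N k H u)"
  by (simp add: ctrace_def quad_adjoint)

text \<open>Real values make the traces of \<open>H - H*\<close> vanish.\<close>

lemma real_ctrace_imp_hermitian:
  assumes k: "0 < k" "k < N" and r: "\<And>u. orthonormal N k u \<Longrightarrow> ctrace N k H u \<in> \<real>"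
  shows "hermitian N H"
  unfolding hermitian_def
proof (intro allI impI)
  fix i j assume ij: "i < N" "j < N"
  have "ctrace N k (\<lambda>i j. H i j + (- 1) * cnj (H j i)) u = 0" if "orthonormal N k u" for u
    unfolding ctrace_add ctrace_scale ctrace_adjoint using r[OF that] by (simp add: Reals_cnj_iff)
  then have "H j i + (- 1) * cnj (H i j) = 0" by (rule ctrace_eq_0_imp_eq_0[OF k _ ij(2,1)])
  then show "H j i = cnj (H i j)" by simp
qed

lemma ctrace_identity:
  assumes "orthonormal N k u"
  shows "ctrace N k (\<lambda>i j. of_bool (i = j)) u = of_nat k"
proof -
  have "quad N (\<lambda>i j. of_bool (i = j)) x = ip N x x" for x
    unfolding quad_def ip_def by (intro sum.cong refl) (simp add: of_bool_def if_distrib if_distribR cong: if_cong)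
  then show ?thesis using orthonormalD[OF assms] by (simp add: ctrace_def)
qed

definition outer :: "(nat \<Rightarrow> complex) \<Rightarrow> nat \<Rightarrow> nat \<Rightarrow> complex" where
  "outer x i j = x i * cnj (x j)"

definition tvec :: "nat \<Rightarrow> (nat \<Rightarrow> complex) \<Rightarrow> (nat \<Rightarrow> complex) \<Rightarrow> nat \<Rightarrow> complex" where
  "tvec n x y s = x (s div n) * y (s mod n)"

definition tmat :: "nat \<Rightarrow> (nat \<Rightarrow> nat \<Rightarrow> complex) \<Rightarrow> (nat \<Rightarrow> nat \<Rightarrow> complex) \<Rightarrow> nat \<Rightarrow> nat \<Rightarrow> complex" where
  "tmat n A B s t = A (s div n) (t div n) * B (s mod n) (t mod n)"

text \<open>The linear map that sends the matrix unit with entry 1 at \<open>(p, q)\<close> to \<open>D p q\<close>.\<close>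

definition lin_ext :: "nat \<Rightarrow> (nat \<Rightarrow> nat \<Rightarrow> nat \<Rightarrow> nat \<Rightarrow> complex) \<Rightarrow> (nat \<Rightarrow> nat \<Rightarrow> complex) \<Rightarrow> nat \<Rightarrow> nat \<Rightarrow> complex" where
  "lin_ext N D M s t = (\<Sum>p<N. \<Sum>q<N. M p q * D p q s t)"

lemma lin_ext_add: "lin_ext N D (\<lambda>i j. A i j + B i j) = (\<lambda>i j. lin_ext N D A i j + lin_ext N D B i j)"
  by (intro ext) (simp add: lin_ext_def ring_distribs sum.distrib)

lemma lin_ext_scale: "lin_ext N D (\<lambda>i j. c * A i j) = (\<lambda>i j. c * lin_ext N D A i j)"
  by (intro ext) (simp add: lin_ext_def sum_distrib_left mult.assoc)

lemma lin_ext_sum: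
  "finite S \<Longrightarrow> lin_ext N D (\<lambda>i j. \<Sum>x\<in>S. f x i j) = (\<lambda>i j. \<Sum>x\<in>S. lin_ext N D (f x) i j)"
proof (induction S rule: finite_induct)
  case empty
  show ?case by (intro ext) (simp add: lin_ext_def)
next
  case (insert x F)
  then show ?case by (simp add: lin_ext_add)
qed

lemma lin_ext_cong: "(\<And>i j. i < N \<Longrightarrow> j < N \<Longrightarrow> A i j = B i j) \<Longrightarrow> lin_ext N D A = lin_ext N D B"
  by (intro ext) (simp add: lin_ext_def)

lemma tmat_outer: "tmat n (outer x) (outer y) = outer (tvec n x y)"
  by (intro ext) (simp add: tmat_def outer_def tvec_def)

lemma quad_outer: "quad N (outer z) x = of_real ((cmod (ip N z x))\<^sup>2)"
  using quad_rank1[of N z x] by (simp add: outer_def[abs_def])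

lemma ctrace_outer: "ctrace N k (outer z) u = of_real (weight N k u z)"
  by (simp add: ctrace_def quad_outer weight_def cmod_ip_commute)

lemma div_mod_lt: "s < m * n \<Longrightarrow> s div n < m \<and> s mod n < (n::nat)"
  by (metis less_mult_imp_div_less mod_less_divisor mult_0_right not_gr_zero not_less_zero)

lemma pair_lt: "i < m \<Longrightarrow> j < n \<Longrightarrow> i * n + j < m * (n::nat)"
proof -
  assume "i < m" "j < n"
  then have "i * n + j < Suc i * n" by simp
  also have "\<dots> \<le> m * n" using \<open>i < m\<close> by (intro mult_le_mono1) simp
  finally show ?thesis .
qed

lemma sum_div_mod: "(\<Sum>s<m * n. f (s div n) (s mod n)) = (\<Sum>i<m. \<Sum>j<(n::nat). f i j)"
proof -
  have "(\<Sum>i<m. \<Sum>j<n. f i j) = (\<Sum>p\<in>{..<m} \<times> {..<n}. f (fst p) (snd p))"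
    by (simp add: sum.cartesian_product case_prod_beta)
  also have "\<dots> = (\<Sum>s<m * n. f (s div n) (s mod n))"
    by (rule sum.reindex_bij_witness[of _ "\<lambda>s. (s div n, s mod n)" "\<lambda>p. fst p * n + snd p"])
      (auto simp: pair_lt div_mod_lt)
  finally show ?thesis by simp
qed

lemma ip_tvec: "ip (m * n) (tvec n x y) (tvec n x' y') = ip m x x' * ip n y y'"
proof -
  have "ip (m * n) (tvec n x y) (tvec n x' y')
    = (\<Sum>s<m * n. (\<lambda>i j. (cnj (x i) * x' i) * (cnj (y j) * y' j)) (s div n) (s mod n))"
    by (simp add: ip_def tvec_def mult_ac)
  also have "\<dots> = (\<Sum>i<m. \<Sum>j<n. (cnj (x i) * x' i) * (cnj (y j) * y' j))" by (rule sum_div_mod)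
  finally show ?thesis by (simp add: ip_def sum_product)
qed

lemma index_eq_iff: "s = t \<longleftrightarrow> s div n = t div n \<and> s mod n = t mod (n::nat)"
  by (metis div_mult_mod_eq)

lemma orthonormal_tvec_left:
  assumes "orthonormal m m b" "\<And>i. i < m \<Longrightarrow> orthonormal n n (c i)"
  shows "orthonormal (m * n) (m * n) (\<lambda>s. tvec n (b (s div n)) (c (s div n) (s mod n)))"
  unfolding orthonormal_def
proof (intro allI impI)
  fix s t assume st: "s < m * n" "t < m * n"
  have d: "s div n < m" "t div n < m" "s mod n < n" "t mod n < n" using div_mod_lt[OF st(1)] div_mod_lt[OF st(2)] by auto
  show "ip (m * n) (tvec n (b (s div n)) (c (s div n) (s mod n))) (tvec n (b (t div n)) (c (t div n) (t mod n)))
    = of_bool (s = t)"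
    unfolding ip_tvec index_eq_iff[of s t n] orthonormalD[OF assms(1) d(1,2)]
    using orthonormalD[OF assms(2)[OF d(1)] d(3,4)] by (cases "s div n = t div n") auto
qed

lemma orthonormal_tvec_right:
  assumes "orthonormal n n c" "\<And>j. j < n \<Longrightarrow> orthonormal m m (b j)"
  shows "orthonormal (m * n) (m * n) (\<lambda>s. tvec n (b (s mod n) (s div n)) (c (s mod n)))"
  unfolding orthonormal_def
proof (intro allI impI)
  fix s t assume st: "s < m * n" "t < m * n"
  have d: "s div n < m" "t div n < m" "s mod n < n" "t mod n < n" using div_mod_lt[OF st(1)] div_mod_lt[OF st(2)] by auto
  show "ip (m * n) (tvec n (b (s mod n) (s div n)) (c (s mod n))) (tvec n (b (t mod n) (t div n)) (c (t mod n)))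
    = of_bool (s = t)"
    unfolding ip_tvec index_eq_iff[of s t n] orthonormalD[OF assms(1) d(3,4)]
    using orthonormalD[OF assms(2)[OF d(3)] d(1,2)] by (cases "s mod n = t mod n") auto
qed

lemma exists_permutation_two:
  fixes s t a b N :: nat
  assumes "s < N" "t < N" "s \<noteq> t" "a < N" "b < N" "a \<noteq> b"
  shows "\<exists>\<pi>. inj \<pi> \<and> (\<forall>i<N. \<pi> i < N) \<and> \<pi> a = s \<and> \<pi> b = t"
proof -
  define sw where "sw p q i = (if i = p then q else if i = q then p else i)" for p q i :: nat
  have inj: "inj (sw p q)" for p q by (auto simp: inj_def sw_def split: if_splits)
  have "inj (sw (sw a s b) t \<circ> sw a s)" by (intro inj_compose inj)
  moreover have "\<forall>i<N. (sw (sw a s b) t \<circ> sw a s) i < N" using assms by (auto simp: sw_def)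
  moreover have "(sw (sw a s b) t \<circ> sw a s) a = s" "(sw (sw a s b) t \<circ> sw a s) b = t" using assms by (auto simp: sw_def)
  ultimately show ?thesis by blast
qed

lemma weight_reindex:
  assumes "orthonormal N N z" "inj \<pi>" "\<forall>i<N. \<pi> i < N" "a < N" "k \<le> N"
  shows "weight N k (\<lambda>c. z (\<pi> c)) (z (\<pi> a)) = of_bool (a < k)"
proof -
  have "weight N k (\<lambda>c. z (\<pi> c)) (z (\<pi> a)) = (\<Sum>c<k. if c = a then 1 else 0)"
    unfolding weight_def
  proof (intro sum.cong refl)
    fix c assume "c \<in> {..<k}"
    then have c: "c < N" using assms(5) by simp
    then show "(cmod (ip N (z (\<pi> c)) (z (\<pi> a))))\<^sup>2 = (if c = a then 1 else 0)"
      using orthonormalD[OF assms(1), of "\<pi> c" "\<pi> a"] assms(3,4) inj_eq[OF assms(2), of c a] by simp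
  qed
  then show ?thesis by simp
qed

lemma orthonormal_avoiding:
  assumes "0 < N"
  shows "\<exists>b. orthonormal N N b \<and> (\<forall>a. 0 < a \<longrightarrow> a < N \<longrightarrow> ip N w (b a) = 0)"
proof (cases "\<exists>i<N. w i \<noteq> 0")
  case True
  then obtain i where i: "i < N" "w i \<noteq> 0" by blast
  obtain c where c: "c \<noteq> 0" "ip N (\<lambda>i. c * w i) (\<lambda>i. c * w i) = 1" using normalize[of i N w, OF i] by blast
  obtain b where b: "orthonormal N N b" "b 0 = (\<lambda>i. c * w i)"
    using orthonormal_extend[OF orthonormal_single[OF c(2)]] assms by fastforce
  have "ip N w (b a) = 0" if "0 < a" "a < N" for a
    using orthonormalD[OF b(1) assms that(2)] that c(1) by (simp add: b(2) ip_scale_left)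
  then show ?thesis using b(1) by blast
next
  case False
  have "orthonormal N 0 (\<lambda>_ _. 0)" by (simp add: orthonormal_def)
  then obtain b where "orthonormal N N b" using orthonormal_extend by blast
  moreover have "ip N w x = 0" for x using False by (simp add: ip_def)
  ultimately show ?thesis by blast
qed

text \<open>A linear map that preserves the \<open>k\<close>-numerical range of tensor products, given by the images of the matrix
  units.\<close>

locale preserver =
  fixes m n k :: nat and D :: "nat \<Rightarrow> nat \<Rightarrow> nat \<Rightarrow> nat \<Rightarrow> complex"
  assumes m: "2 \<le> m" and n: "2 \<le> n" and k: "0 < k" "k < m * n"
    and pres: "\<And>A B. trace_range (m * n) k (lin_ext (m * n) D (tmat n A B)) = trace_range (m * n) k (tmat n A B)"
begin

abbreviation "N \<equiv> m * n"
abbreviation "L \<equiv> lin_ext N D"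

abbreviation "sends xs ys v \<equiv>
  \<forall>s<N. \<forall>i<N. \<forall>j<N. L (outer (tvec n (xs s) (ys s))) i j = outer (v s) i j"

abbreviation "reflects xs ys v \<equiv>
  \<forall>s<N. \<forall>i<N. \<forall>j<N. L (outer (tvec n (xs s) (ys s))) i j = of_bool (i = j) / of_nat k - outer (v s) i j"

lemma N_ge_4: "4 \<le> N"
  using mult_le_mono[OF m n] by simp

lemma N_gt: "0 < N" "1 < N" "2 < N"
  using N_ge_4 by linarith+

lemma attained_in_image:
  assumes "orthonormal N k u"
  obtains u' where "orthonormal N k u'" "ctrace N k (L (tmat n A B)) u' = ctrace N k (tmat n A B) u"
  using trace_range_transfer[OF pres[symmetric] assms] by metis

lemma attained_in_source:
  assumes "orthonormal N k u"
  obtains u' where "orthonormal N k u'" "ctrace N k (tmat n A B) u' = ctrace N k (L (tmat n A B)) u"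
  using trace_range_transfer[OF pres assms] by metis

lemma ctrace_image_outer:
  assumes "orthonormal N k u"
  shows "ctrace N k (L (outer (tvec n x y))) u \<in> \<real>"
    and "ip N (tvec n x y) (tvec n x y) = 1 \<Longrightarrow> 0 \<le> Re (ctrace N k (L (outer (tvec n x y))) u)"
    and "ip N (tvec n x y) (tvec n x y) = 1 \<Longrightarrow> Re (ctrace N k (L (outer (tvec n x y))) u) \<le> 1"
proof -
  obtain u' where u': "orthonormal N k u'" "ctrace N k (tmat n (outer x) (outer y)) u' = ctrace N k (L (tmat n (outer x) (outer y))) u"
    by (rule attained_in_source[OF assms])
  have e: "ctrace N k (L (outer (tvec n x y))) u = of_real (weight N k u' (tvec n x y))"
    using u'(2) unfolding tmat_outer ctrace_outer by simp
  show "ctrace N k (L (outer (tvec n x y))) u \<in> \<real>" by (simp add: e)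
  show "0 \<le> Re (ctrace N k (L (outer (tvec n x y))) u)" by (simp add: e weight_nonneg)
  show "Re (ctrace N k (L (outer (tvec n x y))) u) \<le> 1" if "ip N (tvec n x y) (tvec n x y) = 1"
    using weight_le[OF u'(1) that] by (simp add: e)
qed

lemma hermitian_image_outer: "hermitian N (L (outer (tvec n x y)))"
  by (rule real_ctrace_imp_hermitian[OF k ctrace_image_outer(1)])

text \<open>The real part of \<open>(xx* + \<i>x'x'*) \<otimes> (yy* + \<i>\<epsilon>y'y'*)\<close> is \<open>xx* \<otimes> yy* - \<epsilon> x'x'* \<otimes> y'y'*\<close>. So
  numerical ranges of tensor products also control sums and differences of product projections that do not
  share a factor.\<close>

lemma attained_pair:
  fixes \<epsilon> :: real
  assumes "orthonormal N k u"
  obtains u' where "orthonormal N k u'"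
    "Re (ctrace N k (L (outer (tvec n x y))) u') - \<epsilon> * Re (ctrace N k (L (outer (tvec n x' y'))) u')
      = weight N k u (tvec n x y) - \<epsilon> * weight N k u (tvec n x' y')"
proof -
  define A where "A = (\<lambda>i j. outer x i j + \<i> * outer x' i j)"
  define B where "B = (\<lambda>i j. outer y i j + (\<i> * of_real \<epsilon>) * outer y' i j)"
  have tmat: "tmat n A B = (\<lambda>i j. (outer (tvec n x y) i j + (- of_real \<epsilon>) * outer (tvec n x' y') i j)
      + \<i> * (of_real \<epsilon> * outer (tvec n x y') i j + outer (tvec n x' y) i j))"
    by (intro ext) (simp add: tmat_def A_def B_def tmat_outer[symmetric] algebra_simps)
  obtain u' where u': "orthonormal N k u'" "ctrace N k (L (tmat n A B)) u' = ctrace N k (tmat n A B) u"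
    by (rule attained_in_image[OF assms])
  have "Re (ctrace N k (tmat n A B) u) = weight N k u (tvec n x y) - \<epsilon> * weight N k u (tvec n x' y')"
    unfolding tmat ctrace_add ctrace_scale ctrace_outer by simp
  moreover have "Im (ctrace N k (L (outer (tvec n a b))) u') = 0" for a b
    using ctrace_image_outer(1)[OF u'(1)] by (simp add: complex_is_Real_iff)
  then have "Re (ctrace N k (L (tmat n A B)) u')
      = Re (ctrace N k (L (outer (tvec n x y))) u') - \<epsilon> * Re (ctrace N k (L (outer (tvec n x' y'))) u')"
    unfolding tmat lin_ext_add lin_ext_scale ctrace_add ctrace_scale by simp
  ultimately show ?thesis using that[OF u'(1)] u'(2) by simp
qed

text \<open>The numerical range of the identity is the single point 1, and no other matrix has this range.\<close>

lemma image_identity: "i < N \<Longrightarrow> j < N \<Longrightarrow> L (\<lambda>i j. of_bool (i = j)) i j = of_bool (i = j)"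
proof -
  assume ij: "i < N" "j < N"
  have one: "tmat n (\<lambda>i j. of_bool (i = j)) (\<lambda>i j. of_bool (i = j)) = (\<lambda>i j. of_bool (i = j))"
    by (intro ext) (simp add: tmat_def index_eq_iff[of _ _ n, symmetric] flip: of_bool_conj)
  have "ctrace N k (\<lambda>i j. L (\<lambda>i j. of_bool (i = j)) i j + (- 1) * of_bool (i = j)) u = 0" if u: "orthonormal N k u" for u
  proof -
    obtain u' where u': "orthonormal N k u'" "ctrace N k (\<lambda>i j. of_bool (i = j)) u' = ctrace N k (L (\<lambda>i j. of_bool (i = j))) u"
      using attained_in_source[OF u, of "\<lambda>i j. of_bool (i = j)" "\<lambda>i j. of_bool (i = j)"] unfolding one by blast
    show ?thesis unfolding ctrace_add ctrace_scale using ctrace_identity[OF u] ctrace_identity[OF u'(1)] u'(2) by simp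
  qed
  from ctrace_eq_0_imp_eq_0[OF k this ij] show ?thesis by simp
qed

text \<open>A family taken from the basis itself gives any two prescribed projections of the basis the values 1 and 0,
  or 1 and 1 if \<open>k \<ge> 2\<close>.\<close>

theorem product_basis_image:
  assumes z: "orthonormal N N (\<lambda>s. tvec n (xs s) (ys s))"
  obtains v where "orthonormal N N v"
    "sends xs ys v \<or> N = 2 * k \<and> reflects xs ys v"
proof -
  define H where "H s = L (outer (tvec n (xs s) (ys s)))" for s
  have unit: "ip N (tvec n (xs s) (ys s)) (tvec n (xs s) (ys s)) = 1" if "s < N" for s
    using orthonormalD[OF z that that] by simp
  note bounds = ctrace_image_outer[where x = "xs s" and y = "ys s" for s, folded H_def]
  have real_eq: "ctrace N k (H s) u = of_real (Re (ctrace N k (H s) u))" if "orthonormal N k u" for s u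
    using bounds(1)[OF that, of s] by simp
  have pair: "\<exists>u. orthonormal N k u \<and>
      Re (ctrace N k (H s) u) - \<epsilon> * Re (ctrace N k (H t) u) = of_bool (a < k) - \<epsilon> * of_bool (b < k)"
    if st: "s < N" "t < N" "s \<noteq> t" and ab: "a < N" "b < N" "a \<noteq> b" for s t a b \<epsilon>
  proof -
    obtain \<pi> where \<pi>: "inj \<pi>" "\<forall>i<N. \<pi> i < N" "\<pi> a = s" "\<pi> b = t"
      using exists_permutation_two[OF st ab] by blast
    have u: "orthonormal N k (\<lambda>c. tvec n (xs (\<pi> c)) (ys (\<pi> c)))"
      using \<pi>(1,2) k by (intro orthonormal_reindex[OF z]) (auto simp: inj_on_def inj_def)
    note w = weight_reindex[OF z \<pi>(1,2) _ less_imp_le[OF k(2)]]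
    obtain u' where "orthonormal N k u'" "Re (ctrace N k (H s) u') - \<epsilon> * Re (ctrace N k (H t) u')
      = weight N k (\<lambda>c. tvec n (xs (\<pi> c)) (ys (\<pi> c))) (tvec n (xs s) (ys s))
        - \<epsilon> * weight N k (\<lambda>c. tvec n (xs (\<pi> c)) (ys (\<pi> c))) (tvec n (xs t) (ys t))"
      using attained_pair[OF u, of "xs s" "ys s" \<epsilon> "xs t" "ys t"] unfolding H_def by blast
    then show ?thesis using w[OF ab(1)] w[OF ab(2)] \<pi>(3,4) by auto
  qed
  have sep: "separated N k H"
    unfolding separated_def
  proof (intro allI impI)
    fix s t assume st: "s < N" "t < N" "s \<noteq> t"
    obtain u where u: "orthonormal N k u" "Re (ctrace N k (H s) u) - Re (ctrace N k (H t) u) = 1"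
    proof -
      have *: "N - 1 < N" "0 \<noteq> N - 1" "\<not> N - 1 < k" using N_gt k by linarith+
      show ?thesis using pair[OF st N_gt(1) *(1,2), of 1] *(3) k(1) that by auto
    qed
    have "Re (ctrace N k (H s) u) = 1" "Re (ctrace N k (H t) u) = 0"
      using u(2) bounds(3)[OF u(1) unit[OF st(1)]] bounds(2)[OF u(1) unit[OF st(2)]] by linarith+
    then show "\<exists>u. orthonormal N k u \<and> ctrace N k (H s) u = 1 \<and> ctrace N k (H t) u = 0"
      using u(1) real_eq[OF u(1)] by (metis of_real_0 of_real_1)
  qed
  have comp: "compatible N k H" if k2: "2 \<le> k"
    unfolding compatible_def
  proof (intro allI impI)
    fix s t assume st: "s < N" "t < N" "s \<noteq> t"
    obtain u where u: "orthonormal N k u" "Re (ctrace N k (H s) u) + Re (ctrace N k (H t) u) = 2"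
      using pair[OF st N_gt(1,2), of "- 1"] k k2 by auto
    have "Re (ctrace N k (H s) u) = 1" "Re (ctrace N k (H t) u) = 1"
      using u(2) bounds(3)[OF u(1) unit[OF st(1)]] bounds(3)[OF u(1) unit[OF st(2)]] by linarith+
    then show "\<exists>u. orthonormal N k u \<and> ctrace N k (H s) u = 1 \<and> ctrace N k (H t) u = 1"
      using u(1) real_eq[OF u(1)] by (metis of_real_1)
  qed
  have sr: "sharp_range N k (H s)" if s: "s < N" for s
  proof -
    obtain t where t: "t < N" "t \<noteq> s" using that[OF N_gt(1)] that[OF N_gt(2)] by (cases "s = 0") auto
    show ?thesis
      unfolding sharp_range_def
      using bounds(2,3)[OF _ unit[OF s]] separatedD[OF sep s t(1) t(2)[symmetric]] separatedD[OF sep t(1) s t(2)]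
      by metis
  qed
  have S: "(\<Sum>s<N. H s i j) = of_bool (i = j)" if ij: "i < N" "j < N" for i j
  proof -
    have "(\<Sum>s<N. H s i j) = L (\<lambda>i j. \<Sum>s<N. outer (tvec n (xs s) (ys s)) i j) i j"
      by (simp add: H_def lin_ext_sum)
    also have "L (\<lambda>i j. \<Sum>s<N. outer (tvec n (xs s) (ys s)) i j) = L (\<lambda>i j. of_bool (i = j))"
      by (intro lin_ext_cong) (simp add: outer_def orthonormal_complete[OF z])
    finally show ?thesis using image_identity[OF ij] by simp
  qed
  obtain v where v: "orthonormal N N v"
    "(\<forall>s<N. \<forall>i<N. \<forall>j<N. H s i j = v s i * cnj (v s j)) \<or>
     N = 2 * k \<and> (\<forall>s<N. \<forall>i<N. \<forall>j<N. H s i j = of_bool (i = j) / of_nat k - v s i * cnj (v s j))"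
  proof (rule resolution_rank1[OF k _ sr sep _ S])
    show "hermitian N (H s)" for s unfolding H_def by (rule hermitian_image_outer)
    show "compatible N k H" if "N = 2 * k" using N_ge_4 that comp by auto
  qed
  show ?thesis by (rule that[OF v(1)]) (use v(2) in \<open>simp add: H_def outer_def\<close>)
qed

definition pos :: "(nat \<Rightarrow> complex) \<Rightarrow> (nat \<Rightarrow> complex) \<Rightarrow> bool" where
  "pos x y \<longleftrightarrow> (\<exists>w. \<forall>i<N. \<forall>j<N. L (outer (tvec n x y)) i j = outer w i j)"

definition neg :: "(nat \<Rightarrow> complex) \<Rightarrow> (nat \<Rightarrow> complex) \<Rightarrow> bool" where
  "neg x y \<longleftrightarrow> (\<exists>w. \<forall>i<N. \<forall>j<N. L (outer (tvec n x y)) i j = of_bool (i = j) / of_nat k - outer w i j)"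

lemma posI: "sends xs ys v \<Longrightarrow> s < N \<Longrightarrow> pos (xs s) (ys s)"
  unfolding pos_def by (rule exI[of _ "v s"]) simp

lemma negI: "reflects xs ys v \<Longrightarrow>
    s < N \<Longrightarrow> neg (xs s) (ys s)"
  unfolding neg_def by (rule exI[of _ "v s"]) simp

text \<open>Otherwise \<open>I/k\<close> would have rank at most 2, whereas \<open>N \<ge> 4\<close>.\<close>

lemma not_pos_neg:
  assumes "pos x y" "neg x y"
  shows False
proof -
  obtain w w' where w: "\<forall>i<N. \<forall>j<N. L (outer (tvec n x y)) i j = outer w i j"
    and w': "\<forall>i<N. \<forall>j<N. L (outer (tvec n x y)) i j = of_bool (i = j) / of_nat k - outer w' i j"
    using assms by (auto simp: pos_def neg_def)
  obtain b where b: "orthonormal N N b" "\<And>a. 0 < a \<Longrightarrow> a < N \<Longrightarrow> ip N w (b a) = 0"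
    using orthonormal_avoiding[OF N_gt(1), of w] by auto
  note lt = N_gt(2,3)
  have rep: "L (outer (tvec n x y)) i j = of_real (1 / real k) * of_bool (i = j) + of_real (- 1) * (w' i * cnj (w' j))"
    if "i < N" "j < N" for i j using w' that by (simp add: outer_def)
  have key: "(cmod (ip N w' z))\<^sup>2 = Re (ip N z z) / real k" if z: "ip N w z = 0" for z
  proof -
    have "quad N (L (outer (tvec n x y))) z = quad N (outer w) z" using w by (intro quad_cong) simp
    also have "\<dots> = 0" by (simp add: quad_outer z)
    finally have "of_real (1 / real k) * ip N z z + of_real (- 1 * (cmod (ip N w' z))\<^sup>2) = 0"
      using quad_scalar_rank1[of N "L (outer (tvec n x y))" "1 / real k" "- 1" w' z, OF rep] by simp
    then have "complex_of_real ((1 / real k) * Re (ip N z z) + - 1 * (cmod (ip N w' z))\<^sup>2) = 0"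
      by (subst (asm) ip_self_Re) simp
    then show ?thesis by (simp only: of_real_eq_0_iff) simp
  qed
  \<comment> \<open>Some combination of two basis vectors orthogonal to \<open>w\<close> is orthogonal to \<open>w'\<close> as well.\<close>
  define \<alpha> \<beta> where "\<alpha> = ip N w' (b 1)" and "\<beta> = ip N w' (b 2)"
  define c where "c a = (if a = 1 then \<beta> else - \<alpha>)" for a :: nat
  define z where "z = (\<lambda>i. \<Sum>a\<in>{1, 2}. c a * b a i)"
  have wz: "ip N w z = 0" unfolding z_def ip_sum_right using b(2) lt by simp
  have w'z: "ip N w' z = 0" unfolding z_def ip_sum_right by (simp add: c_def \<alpha>_def \<beta>_def)
  have "ip N z z = cnj \<beta> * \<beta> + cnj \<alpha> * \<alpha>"
    unfolding z_def ip_sum_right ip_sum_left using orthonormalD[OF b(1)] lt by (simp add: c_def)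
  then have "Re (ip N z z) = (cmod \<beta>)\<^sup>2 + (cmod \<alpha>)\<^sup>2" by (simp only: cmod_power2) (simp add: power2_eq_square)
  then have "(cmod \<beta>)\<^sup>2 + (cmod \<alpha>)\<^sup>2 = 0" using key[OF wz] w'z k by simp
  then have "(cmod \<alpha>)\<^sup>2 = 0" by (simp add: sum_power2_eq_zero_iff)
  then show False
    using key[of "b 1"] b(2)[of 1] lt k orthonormalD[OF b(1), of 1 1] by (simp add: \<alpha>_def)
qed

lemma pos_or_neg_basis:
  assumes z: "orthonormal N N (\<lambda>s. tvec n (xs s) (ys s))"
  shows "(\<forall>s<N. pos (xs s) (ys s)) \<or> N = 2 * k \<and> (\<forall>s<N. neg (xs s) (ys s))"
  using product_basis_image[OF z] unfolding pos_def neg_def by metis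

text \<open>Given bases with \<open>b 0 = x\<close> and \<open>b 1 = x'\<close> on the left, the right basis may change with the left index. So \<open>y\<close>
  next to \<open>x\<close> and an arbitrary \<open>y'\<close> next to \<open>x'\<close> fit into one product basis.\<close>

lemma same_type_left:
  assumes "ip m x x = 1" "ip m x' x' = 1" "ip m x x' = 0" "ip n y y = 1" "ip n y' y' = 1" "pos x y"
  shows "pos x' y'"
proof -
  have "orthonormal m (Suc 1) ((\<lambda>_. x)(1 := x'))"
    by (rule orthonormal_Suc[OF orthonormal_single[OF assms(1)] assms(2)]) (simp add: assms(3))
  then obtain b where b: "orthonormal m m b" "\<forall>a<Suc 1. b a = ((\<lambda>_. x)(1 := x')) a"
    using orthonormal_extend m by (metis One_nat_def Suc_1)
  obtain c where c: "orthonormal n n c" "c 0 = y"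
    using orthonormal_extend[OF orthonormal_single[OF assms(4)]] n by fastforce
  obtain c' where c': "orthonormal n n c'" "c' 0 = y'"
    using orthonormal_extend[OF orthonormal_single[OF assms(5)]] n by fastforce
  define cc where "cc i = (if i = 1 then c' else c)" for i :: nat
  have z: "orthonormal N N (\<lambda>s. tvec n (b (s div n)) (cc (s div n) (s mod n)))"
    by (rule orthonormal_tvec_left[OF b(1)]) (simp add: cc_def c c')
  have lt: "0 < N" "n < N" using N_gt(1) m n by auto
  have s0: "b (0 div n) = x" "cc (0 div n) (0 mod n) = y" using b(2) c by (auto simp: cc_def)
  have s1: "b (n div n) = x'" "cc (n div n) (n mod n) = y'" using b(2) c' n by (auto simp: cc_def)
  show ?thesis
    using pos_or_neg_basis[OF z] lt s0 s1 assms(6) not_pos_neg by metis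
qed

lemma same_type_right:
  assumes "ip m x x = 1" "ip m x' x' = 1" "ip n y y' = 0" "ip n y y = 1" "ip n y' y' = 1" "pos x y"
  shows "pos x' y'"
proof -
  have "orthonormal n (Suc 1) ((\<lambda>_. y)(1 := y'))"
    by (rule orthonormal_Suc[OF orthonormal_single[OF assms(4)] assms(5)]) (simp add: assms(3))
  then obtain c where c: "orthonormal n n c" "\<forall>a<Suc 1. c a = ((\<lambda>_. y)(1 := y')) a"
    using orthonormal_extend n by (metis One_nat_def Suc_1)
  obtain b where b: "orthonormal m m b" "b 0 = x"
    using orthonormal_extend[OF orthonormal_single[OF assms(1)]] m by fastforce
  obtain b' where b': "orthonormal m m b'" "b' 0 = x'"
    using orthonormal_extend[OF orthonormal_single[OF assms(2)]] m by fastforce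
  define bb where "bb j = (if j = 1 then b' else b)" for j :: nat
  have z: "orthonormal N N (\<lambda>s. tvec n (bb (s mod n) (s div n)) (c (s mod n)))"
    by (rule orthonormal_tvec_right[OF c(1)]) (simp add: bb_def b b')
  note lt = N_gt(1,2)
  have s0: "bb (0 mod n) (0 div n) = x" "c (0 mod n) = y" using c(2) b by (auto simp: bb_def)
  have s1: "bb (1 mod n) (1 div n) = x'" "c (1 mod n) = y'" using c(2) b' n by (auto simp: bb_def)
  show ?thesis
    using pos_or_neg_basis[OF z] lt s0 s1 assms(6) not_pos_neg by metis
qed

text \<open>From \<open>(x0, y0)\<close> change to \<open>(x1, y1)\<close> and back to \<open>(x0, y1)\<close>, where \<open>x1\<close> is orthogonal to \<open>x0\<close>, and \<open>y1\<close> is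
  chosen orthogonal to \<open>y\<close> so that \<open>(x, y)\<close> can be reached in the last step.\<close>

lemma pos_everywhere:
  assumes p: "pos x0 y0" and u0: "ip m x0 x0 = 1" "ip n y0 y0 = 1" and u: "ip m x x = 1" "ip n y y = 1"
  shows "pos x y"
proof -
  obtain x1 where x1: "ip m x1 x1 = 1" "ip m x0 x1 = 0"
    using orthonormal_extend_step[OF orthonormal_single[OF u0(1)]] m by auto
  obtain y1 where y1: "ip n y1 y1 = 1" "ip n y y1 = 0"
    using orthonormal_extend_step[OF orthonormal_single[OF u(2)]] n by auto
  have x1': "ip m x1 x0 = 0" using x1(2) cnj_ip[of m x0 x1] by simp
  have y1': "ip n y1 y = 0" using y1(2) cnj_ip[of n y y1] by simp
  have "pos x1 y1" by (rule same_type_left[OF u0(1) x1 u0(2) y1(1) p])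
  then have "pos x0 y1" by (rule same_type_left[OF x1(1) u0(1) x1' y1(1) y1(1)])
  then show ?thesis by (rule same_type_right[OF u0(1) u(1) y1' y1(1) u(2)])
qed

end

definition product_basis :: "nat \<Rightarrow> nat \<Rightarrow> (nat \<Rightarrow> nat \<Rightarrow> complex) \<Rightarrow> (nat \<Rightarrow> nat \<Rightarrow> complex) \<Rightarrow> bool" where
  "product_basis m n xs ys \<longleftrightarrow> (\<forall>s<m * n. ip m (xs s) (xs s) = 1) \<and> (\<forall>s<m * n. ip n (ys s) (ys s) = 1) \<and>
    orthonormal (m * n) (m * n) (\<lambda>s. tvec n (xs s) (ys s))"

definition basis_preserving :: "nat \<Rightarrow> nat \<Rightarrow> (nat \<Rightarrow> nat \<Rightarrow> nat \<Rightarrow> nat \<Rightarrow> complex) \<Rightarrow> bool" where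
  "basis_preserving m n D \<longleftrightarrow> (\<forall>xs ys. product_basis m n xs ys \<longrightarrow>
    (\<exists>v. orthonormal (m * n) (m * n) v \<and>
      (\<forall>s<m * n. \<forall>i<m * n. \<forall>j<m * n. lin_ext (m * n) D (outer (tvec n (xs s) (ys s))) i j = outer (v s) i j)))"

text \<open>The composition with \<open>X \<mapsto> (tr X / k) I - X\<close>, for maps that preserve the trace of the arguments considered.\<close>

definition reflected :: "nat \<Rightarrow> (nat \<Rightarrow> nat \<Rightarrow> nat \<Rightarrow> nat \<Rightarrow> complex) \<Rightarrow> nat \<Rightarrow> nat \<Rightarrow> nat \<Rightarrow> nat \<Rightarrow> complex" where
  "reflected k D p q i j = of_bool (p = q) / of_nat k * of_bool (i = j) - D p q i j"

lemma lin_ext_reflected: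
  "lin_ext N (reflected k D) M i j = (\<Sum>l<N. M l l) / of_nat k * of_bool (i = j) - lin_ext N D M i j"
proof -
  have "(\<Sum>p<N. \<Sum>q<N. M p q * (of_bool (p = q) / of_nat k * of_bool (i = j)))
    = (\<Sum>p<N. M p p / of_nat k * of_bool (i = j))"
  proof (intro sum.cong refl)
    fix p assume "p \<in> {..<N}"
    moreover have "(\<Sum>q<N. M p q * (of_bool (p = q) / of_nat k * of_bool (i = j)))
      = (\<Sum>q<N. if q = p then M p p / of_nat k * of_bool (i = j) else 0)"
      by (intro sum.cong refl) auto
    ultimately show "(\<Sum>q<N. M p q * (of_bool (p = q) / of_nat k * of_bool (i = j)))
      = M p p / of_nat k * of_bool (i = j)" by simp
  qed
  then show ?thesis
    by (simp add: lin_ext_def reflected_def right_diff_distrib sum_subtractf sum_divide_distrib sum_distrib_right)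
qed

context preserver
begin

theorem basis_preserving_or_reflected:
  "basis_preserving m n D \<or> N = 2 * k \<and> basis_preserving m n (reflected k D)"
proof -
  have "orthonormal m 0 (\<lambda>_ _. 0)" "orthonormal n 0 (\<lambda>_ _. 0)" by (auto simp: orthonormal_def)
  then obtain b c where b: "orthonormal m m b" and c: "orthonormal n n c"
    using orthonormal_extend[of m 0] orthonormal_extend[of n 0] by blast
  have u0: "ip m (b 0) (b 0) = 1" "ip n (c 0) (c 0) = 1" using orthonormalD[OF b, of 0 0] orthonormalD[OF c, of 0 0] m n by auto
  show ?thesis
  proof (cases "pos (b 0) (c 0)")
    case True
    have "basis_preserving m n D"
      unfolding basis_preserving_def
    proof (intro allI impI)
      fix xs ys assume pb: "product_basis m n xs ys"
      then have z: "orthonormal N N (\<lambda>s. tvec n (xs s) (ys s))" by (simp add: product_basis_def)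
      have "pos (xs 0) (ys 0)"
        by (rule pos_everywhere[OF True u0]) (use pb N_gt(1) in \<open>simp_all add: product_basis_def\<close>)
      then have nn: "\<not> neg (xs 0) (ys 0)" using not_pos_neg by blast
      obtain v where v: "orthonormal N N v"
        "sends xs ys v \<or> N = 2 * k \<and> reflects xs ys v"
        by (rule product_basis_image[OF z])
      then show "\<exists>v. orthonormal N N v \<and> sends xs ys v"
        using nn negI[where v = v and xs = xs and ys = ys and s = 0] N_gt(1) by auto
    qed
    then show ?thesis ..
  next
    case False
    have np: "\<not> pos x y" if "ip m x x = 1" "ip n y y = 1" for x y
      using pos_everywhere[OF _ that u0] False by blast
    have ne: "N = 2 * k \<and> (\<exists>v. orthonormal N N v \<and> reflects xs ys v)"
      if pb: "product_basis m n xs ys" for xs ys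
    proof -
      have z: "orthonormal N N (\<lambda>s. tvec n (xs s) (ys s))" using pb by (simp add: product_basis_def)
      have "\<not> pos (xs 0) (ys 0)" by (rule np) (use pb N_gt(1) in \<open>simp_all add: product_basis_def\<close>)
      moreover obtain v where v: "orthonormal N N v"
        "sends xs ys v \<or> N = 2 * k \<and> reflects xs ys v"
        by (rule product_basis_image[OF z])
      ultimately show ?thesis using posI[where v = v and xs = xs and ys = ys and s = 0] N_gt(1) by auto
    qed
    have "product_basis m n (\<lambda>s. b (s div n)) (\<lambda>s. c (s mod n))"
      unfolding product_basis_def
    proof (intro conjI allI impI)
      show "orthonormal N N (\<lambda>s. tvec n (b (s div n)) (c (s mod n)))" by (rule orthonormal_tvec_left[OF b c])
    qed (use orthonormalD[OF b] orthonormalD[OF c] div_mod_lt in auto)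
    then have half: "N = 2 * k" using ne by blast
    have "basis_preserving m n (reflected k D)"
      unfolding basis_preserving_def
    proof (intro allI impI)
      fix xs ys assume pb: "product_basis m n xs ys"
      then obtain v where v: "orthonormal N N v"
        "reflects xs ys v"
        using ne by blast
      have "(\<Sum>l<N. outer (tvec n (xs s) (ys s)) l l) = 1" if s: "s < N" for s
      proof -
        have "(\<Sum>l<N. outer (tvec n (xs s) (ys s)) l l) = ip N (tvec n (xs s) (ys s)) (tvec n (xs s) (ys s))"
          by (simp add: outer_def ip_def mult.commute)
        then show ?thesis using pb s by (simp add: product_basis_def ip_tvec)
      qed
      then show "\<exists>v. orthonormal N N v \<and>
          (\<forall>s<N. \<forall>i<N. \<forall>j<N. lin_ext N (reflected k D) (outer (tvec n (xs s) (ys s))) i j = outer (v s) i j)"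
        using v by (intro exI[of _ v]) (simp add: lin_ext_reflected)
    qed
    then show ?thesis using half by simp
  qed
qed

end

section \<open>Linear maps that preserve rank one projections\<close>

definition basis_vec :: "nat \<Rightarrow> nat \<Rightarrow> complex" where
  "basis_vec l i = of_bool (i = l)"

definition two_point :: "nat \<Rightarrow> complex \<Rightarrow> nat \<Rightarrow> complex \<Rightarrow> nat \<Rightarrow> complex" where
  "two_point p a q b l = (if l = p then a else if l = q then b else 0)"

lemma lin_ext_outer: "lin_ext m C (outer x) i j = quad m (\<lambda>q p. C p q i j) x"
  unfolding lin_ext_def quad_def outer_def by (subst sum.swap) (simp add: mult_ac)

text \<open>A linear map on \<open>m \<times> m\<close> matrices that sends \<open>xx*\<close> to some \<open>ww*\<close> of the same trace and fixes the diagonal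
  matrix units. It is determined by its values on matrices \<open>xx*\<close> with few nonzero coordinates of \<open>x\<close>.\<close>

locale rank1_map =
  fixes m :: nat and C :: "nat \<Rightarrow> nat \<Rightarrow> nat \<Rightarrow> nat \<Rightarrow> complex"
  assumes rank1: "\<And>x. \<exists>w. (\<forall>p<m. \<forall>q<m. lin_ext m C (outer x) p q = outer w p q) \<and> ip m w w = ip m x x"
    and diag: "\<And>l i j. l < m \<Longrightarrow> i < m \<Longrightarrow> j < m \<Longrightarrow> lin_ext m C (outer (basis_vec l)) i j = of_bool (i = l \<and> j = l)"
begin

lemma image_two:
  assumes pq: "p < m" "q < m" "p \<noteq> q" and ij: "i < m" "j < m"
  shows "lin_ext m C (outer (two_point p a q b)) i j = cnj a * a * of_bool (i = p \<and> j = p) + cnj b * b * of_bool (i = q \<and> j = q)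
    + (cnj b * a * C p q i j + cnj a * b * C q p i j)"
proof -
  have two_point: "two_point p a q b = (\<lambda>l. if l = p then a else if l = q then b else 0)" for a b by (simp add: two_point_def fun_eq_iff)
  have "basis_vec p = two_point p 1 q 0" "basis_vec q = two_point p 0 q 1" using pq(3) by (auto simp: two_point_def basis_vec_def fun_eq_iff)
  then have "C p p i j = of_bool (i = p \<and> j = p)" "C q q i j = of_bool (i = q \<and> j = q)"
    using diag[OF pq(1) ij] diag[OF pq(2) ij] unfolding lin_ext_outer by (simp_all add: two_point quad_two[OF pq])
  then show ?thesis unfolding lin_ext_outer two_point quad_two[OF pq] by (simp add: algebra_simps)
qed

lemma image_two_diag:
  assumes pq: "p < m" "q < m" "p \<noteq> q" and i: "i < m"
  shows "\<exists>r\<ge>0. lin_ext m C (outer (two_point p a q b)) i i = complex_of_real r"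
proof -
  obtain w where "\<forall>p'<m. \<forall>q'<m. lin_ext m C (outer (two_point p a q b)) p' q' = outer w p' q'" using rank1 by blast
  then have "lin_ext m C (outer (two_point p a q b)) i i = of_real ((cmod (w i))\<^sup>2)"
    using i by (simp add: outer_def complex_norm_square del: of_real_power)
  then show ?thesis by (metis zero_le_power2)
qed

lemma real_nonneg_forms:
  fixes X Y :: complex
  assumes "\<And>a b. \<exists>r\<ge>0. cnj a * a * of_bool P + (cnj b * a * X + cnj a * b * Y) = complex_of_real r"
  shows "X = 0 \<and> Y = 0"
proof -
  \<comment> \<open>A form without \<open>|b|\<^sup>2\<close> term becomes negative for small \<open>a\<close> unless the mixed terms vanish.\<close>
  have z: "cnj b * X + b * Y = 0" for b
  proof -
    obtain r where "cnj 1 * 1 * of_bool P + (cnj b * 1 * X + cnj 1 * b * Y) = complex_of_real r" using assms by blast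
    then have rr: "cnj b * X + b * Y = of_real (r - of_bool P)" by (cases P) (simp_all add: algebra_simps)
    define t where "t = r - of_bool P"
    obtain r' where r': "r' \<ge> 0" "cnj (of_real (- t / 2)) * of_real (- t / 2) * of_bool P
        + (cnj b * of_real (- t / 2) * X + cnj (of_real (- t / 2)) * b * Y) = complex_of_real r'" using assms by blast
    have e: "cnj b * of_real (- t / 2) * X + cnj (of_real (- t / 2)) * b * Y = of_real (- t / 2 * t)"
    proof -
      have "cnj b * of_real (- t / 2) * X + cnj (of_real (- t / 2)) * b * Y = of_real (- t / 2) * (cnj b * X + b * Y)"
        by (simp add: algebra_simps)
      then show ?thesis by (simp add: rr t_def)
    qed
    have f: "cnj (of_real (- t / 2)) * of_real (- t / 2) * of_bool P = complex_of_real (t * t / 4 * of_bool P)"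
      by (cases P) simp_all
    have "complex_of_real (t * t / 4 * of_bool P + - t / 2 * t) = of_real r'"
      using r'(2) by (simp only: e f of_real_add)
    then have "t * t / 4 * of_bool P + - t / 2 * t = r'" by (simp only: of_real_eq_iff)
    then have "t * t \<le> 0" using r'(1) by (cases P) auto
    then have "t = 0" by (metis mult_eq_0_iff not_square_less_zero order_antisym_conv linorder_not_le)
    then show ?thesis using rr by (simp add: t_def)
  qed
  have "X + Y = 0" using z[of 1] by simp
  moreover have "\<i> * (Y - X) = 0" using z[of "\<i>"] by (simp add: algebra_simps)
  ultimately show ?thesis by auto
qed

lemma mixed_diag:
  assumes pq: "p < m" "q < m" "p \<noteq> q" and i: "i < m"
  shows "C p q i i = 0"
proof (cases "i = q")
  case True
  have "C q p i i = 0 \<and> C p q i i = 0"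
  proof (rule real_nonneg_forms[of True])
    fix a b
    show "\<exists>r\<ge>0. cnj a * a * of_bool True + (cnj b * a * C q p i i + cnj a * b * C p q i i) = complex_of_real r"
      using image_two_diag[OF pq i, of b a] True pq(3) unfolding image_two[OF pq i i] by (simp add: add.commute)
  qed
  then show ?thesis by simp
next
  case False
  have "C p q i i = 0 \<and> C q p i i = 0"
  proof (rule real_nonneg_forms[of "i = p"])
    fix a b
    show "\<exists>r\<ge>0. cnj a * a * of_bool (i = p) + (cnj b * a * C p q i i + cnj a * b * C q p i i) = complex_of_real r"
      using image_two_diag[OF pq i, of a b] False unfolding image_two[OF pq i i] by simp
  qed
  then show ?thesis by simp
qed

text \<open>A diagonal entry of \<open>ww*\<close> that vanishes takes its row and its column with it.\<close>

lemma mixed_outside: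
  assumes pq: "p < m" "q < m" "p \<noteq> q" and ij: "i < m" "j < m" and out: "i \<noteq> p \<and> i \<noteq> q \<or> j \<noteq> p \<and> j \<noteq> q"
  shows "C p q i j = 0"
proof (cases "i = j")
  case True
  then show ?thesis using mixed_diag[OF pq ij(1)] by simp
next
  case False
  have z: "lin_ext m C (outer (two_point p a q b)) i j = 0" for a b
  proof -
    obtain w where w: "\<forall>p'<m. \<forall>q'<m. lin_ext m C (outer (two_point p a q b)) p' q' = outer w p' q'" using rank1 by blast
    have d: "w l = 0" if "l < m" "l \<noteq> p" "l \<noteq> q" for l
    proof -
      have "outer w l l = 0"
        using w that image_two[OF pq that(1,1), of a b] mixed_diag[OF pq that(1)] mixed_diag[OF pq(2,1) pq(3)[symmetric] that(1)]
        by simp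
      then show ?thesis by (simp add: outer_def)
    qed
    show ?thesis using w ij out d by (auto simp: outer_def)
  qed
  have nb: "\<not> (i = p \<and> j = p)" "\<not> (i = q \<and> j = q)" using False by auto
  have "C p q i j + C q p i j = 0" using z[of 1 1] unfolding image_two[OF pq ij] by (simp add: nb)
  moreover have "\<i> * (C q p i j - C p q i j) = 0" using z[of 1 "\<i>"] unfolding image_two[OF pq ij]
    by (simp add: nb algebra_simps)
  ultimately show ?thesis by auto
qed

text \<open>In the block of the indices \<open>p\<close> and \<open>q\<close> the matrix unit \<open>E\<^sub>p\<^sub>q\<close> goes to a unimodular multiple of itself or of
  its transpose: since \<open>ww*\<close> has rank one, the modulus of \<open>cnj b X + b Y\<close> is \<open>|b|\<close> for all \<open>b\<close>.\<close>

lemma mixed_entries: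
  assumes pq: "p < m" "q < m" "p \<noteq> q"
  shows "C q p p q = 0 \<and> cmod (C p q p q) = 1 \<or> C p q p q = 0 \<and> cmod (C q p p q) = 1"
proof -
  let ?X = "C p q p q" and ?Y = "C q p p q"
  have e: "(cmod (cnj b * ?X + b * ?Y))\<^sup>2 = (cmod b)\<^sup>2" for b
  proof -
    obtain w where w: "\<forall>p'<m. \<forall>q'<m. lin_ext m C (outer (two_point p 1 q b)) p' q' = outer w p' q'" using rank1 by blast
    note md = mixed_diag[OF pq] mixed_diag[OF pq(2,1) pq(3)[symmetric]]
    have pp: "w p * cnj (w p) = 1" and qq: "w q * cnj (w q) = cnj b * b" and o: "w p * cnj (w q) = cnj b * ?X + b * ?Y"
      using w pq image_two[OF pq pq(1,1), of 1 b] image_two[OF pq pq(2,2), of 1 b] image_two[OF pq pq(1,2), of 1 b] md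
      by (simp_all add: outer_def)
    have "complex_of_real ((cmod (cnj b * ?X + b * ?Y))\<^sup>2) = (w p * cnj (w p)) * (w q * cnj (w q))"
      unfolding o[symmetric] complex_norm_square by simp
    also have "\<dots> = complex_of_real ((cmod b)\<^sup>2)" unfolding pp qq complex_norm_square by simp
    finally show ?thesis by (simp only: of_real_eq_iff)
  qed
  \<comment> \<open>The values at \<open>1\<close>, \<open>\<i>\<close> and \<open>1 + \<i>\<close> give \<open>|X|\<^sup>2 + |Y|\<^sup>2 = 1\<close> and \<open>X cnj Y = 0\<close>.\<close>
  have e1: "(cmod (?X + ?Y))\<^sup>2 = 1" using e[of 1] by simp
  have e2: "(cmod (?Y - ?X))\<^sup>2 = 1"
  proof -
    have "cnj \<i> * ?X + \<i> * ?Y = \<i> * (?Y - ?X)" by (simp add: algebra_simps)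
    then show ?thesis using e[of "\<i>"] by (simp add: norm_mult)
  qed
  have e3: "(cmod (?X + \<i> * ?Y))\<^sup>2 = 1"
  proof -
    have "cnj (1 + \<i>) * ?X + (1 + \<i>) * ?Y = (1 - \<i>) * (?X + \<i> * ?Y)" by (simp add: algebra_simps)
    moreover have "(cmod (1 + \<i>))\<^sup>2 = 2" "(cmod (1 - \<i>))\<^sup>2 = 2" by (simp_all only: cmod_power2) simp_all
    ultimately show ?thesis using e[of "1 + \<i>"] by (simp add: norm_mult power_mult_distrib)
  qed
  define x1 x2 y1 y2 where "x1 = Re ?X" and "x2 = Im ?X" and "y1 = Re ?Y" and "y2 = Im ?Y"
  have 1: "(x1 + y1)\<^sup>2 + (x2 + y2)\<^sup>2 = 1" using e1 unfolding cmod_power2 by (simp add: x1_def x2_def y1_def y2_def)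
  have 2: "(y1 - x1)\<^sup>2 + (y2 - x2)\<^sup>2 = 1" using e2 unfolding cmod_power2 by (simp add: x1_def x2_def y1_def y2_def)
  have 3: "(x1 - y2)\<^sup>2 + (x2 + y1)\<^sup>2 = 1" using e3 unfolding cmod_power2 by (simp add: x1_def x2_def y1_def y2_def)
  have re: "x1 * y1 + x2 * y2 = 0" using 1 2 by (simp add: power2_eq_square algebra_simps)
  have s: "x1\<^sup>2 + x2\<^sup>2 + (y1\<^sup>2 + y2\<^sup>2) = 1" using 1 2 by (simp add: power2_eq_square algebra_simps)
  have im: "x2 * y1 - x1 * y2 = 0" using 3 s by (simp add: power2_eq_square algebra_simps)
  have "?X * cnj ?Y = 0" using re im by (simp add: complex_eq_iff x1_def x2_def y1_def y2_def)
  then have "?X = 0 \<or> ?Y = 0" by simp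
  moreover have "(cmod ?X)\<^sup>2 + (cmod ?Y)\<^sup>2 = 1" using s unfolding cmod_power2 by (simp add: x1_def x2_def y1_def y2_def)
  ultimately show ?thesis
    using norm_ge_zero[of ?X] norm_ge_zero[of ?Y] by (auto simp: power2_eq_1_iff simp del: norm_ge_zero)
qed

text \<open>The coefficients with which the entry at \<open>(p, q)\<close> of the image depends on the same entry of the argument and
  on the transposed one.\<close>

definition straight :: "nat \<Rightarrow> nat \<Rightarrow> complex" where "straight p q = C p q p q"
definition flipped :: "nat \<Rightarrow> nat \<Rightarrow> complex" where "flipped p q = C q p p q"

lemma image_entry:
  assumes ij: "i < m" "j < m"
  shows "lin_ext m C A i j = (if i = j then A i i else straight i j * A i j + flipped i j * A j i)"
proof -
  have Cd: "C l l i j = of_bool (i = l \<and> j = l)" if l: "l < m" for l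
  proof -
    have "lin_ext m C (outer (basis_vec l)) i j = (\<Sum>p<m. \<Sum>q<m. if q = l then (if p = l then C l l i j else 0) else 0)"
      unfolding lin_ext_def by (intro sum.cong refl) (auto simp: outer_def basis_vec_def)
    then have "lin_ext m C (outer (basis_vec l)) i j = C l l i j" using l by simp
    then show ?thesis using diag[OF l ij] by simp
  qed
  show ?thesis
  proof (cases "i = j")
    case True
    have "lin_ext m C A i j = (\<Sum>p<m. \<Sum>q<m. if q = p then (if p = i then A i i else 0) else 0)"
      unfolding lin_ext_def
    proof (intro sum.cong refl)
      fix p q assume "p \<in> {..<m}" "q \<in> {..<m}"
      then show "A p q * C p q i j = (if q = p then (if p = i then A i i else 0) else 0)"
        using Cd[of p] mixed_diag[of p q i] ij True by auto
    qed
    then show ?thesis using ij True by simp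
  next
    case False
    have "lin_ext m C A i j = (\<Sum>p<m. \<Sum>q<m. (if q = j then (if p = i then A i j * straight i j else 0) else 0)
        + (if q = i then (if p = j then A j i * flipped i j else 0) else 0))"
      unfolding lin_ext_def
    proof (intro sum.cong refl)
      fix p q assume pq: "p \<in> {..<m}" "q \<in> {..<m}"
      have "C p q i j = 0" if "\<not> (p = i \<and> q = j)" "\<not> (p = j \<and> q = i)"
      proof (cases "p = q")
        case True
        then show ?thesis using Cd[of p] pq False by auto
      next
        case False
        then show ?thesis using mixed_outside[of p q i j] pq ij that \<open>i \<noteq> j\<close> by auto
      qed
      then show "A p q * C p q i j = (if q = j then (if p = i then A i j * straight i j else 0) else 0)
        + (if q = i then (if p = j then A j i * flipped i j else 0) else 0)"
        using False by (auto simp: straight_def flipped_def)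
    qed
    then show ?thesis using ij False by (simp add: sum.distrib mult.commute)
  qed
qed

lemma straight_or_flipped: "p < m \<Longrightarrow> q < m \<Longrightarrow> p \<noteq> q \<Longrightarrow> flipped p q = 0 \<and> cmod (straight p q) = 1 \<or> straight p q = 0 \<and> cmod (flipped p q) = 1"
  using mixed_entries[of p q] by (simp add: straight_def flipped_def)

lemma straight_hermitian:
  assumes "p < m" "q < m" "p \<noteq> q"
  shows "straight q p = cnj (straight p q)"
proof -
  have h: "lin_ext m C (outer x) q p = cnj (lin_ext m C (outer x) p q)" for x
  proof -
    obtain w where "\<forall>p'<m. \<forall>q'<m. lin_ext m C (outer x) p' q' = outer w p' q'" using rank1 by blast
    then show ?thesis using assms by (simp add: outer_def)
  qed
  have e: "straight q p * b + flipped q p * cnj b = cnj (straight p q) * b + cnj (flipped p q) * cnj b" for b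
    using h[of "two_point p 1 q b"] assms unfolding image_entry[OF assms(1,2)] image_entry[OF assms(2,1)]
    by (auto simp: outer_def two_point_def)
  have 1: "straight q p + flipped q p = cnj (straight p q) + cnj (flipped p q)" using e[of 1] by simp
  have "\<i> * (straight q p - flipped q p) = \<i> * (cnj (straight p q) - cnj (flipped p q))" using e[of "\<i>"] by (simp add: algebra_simps)
  then have 2: "straight q p - flipped q p = cnj (straight p q) - cnj (flipped p q)" by simp
  have "2 * straight q p = (straight q p + flipped q p) + (straight q p - flipped q p)" by simp
  also have "\<dots> = 2 * cnj (straight p q)" unfolding 1 2 by simp
  finally show ?thesis by simp
qed

text \<open>In \<open>ww*\<close> the product of the entries at \<open>(p, q)\<close> and \<open>(q, r)\<close> is the product of those at \<open>(p, r)\<close> and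
  \<open>(q, q)\<close>. Comparing how both sides depend on the phases of the coordinates excludes mixed orientations.\<close>

lemma straight_cocycle:
  assumes "p < m" "q < m" "r < m" "p \<noteq> q" "q \<noteq> r" "p \<noteq> r" and straight: "straight p q \<noteq> 0"
  shows "straight p r = straight p q * straight q r" "flipped p r = 0"
proof -
  have d: "flipped p q = 0" using straight_or_flipped[OF assms(1,2,4)] straight by auto
  have e: "straight p q * (straight q r * cnj c + cnj b * cnj b * flipped q r * c) = straight p r * cnj c + flipped p r * c"
    if b: "cnj b * b = 1" for b c
  proof -
    let ?x = "\<lambda>l. if l = p then 1 else if l = q then b else if l = r then c else 0"
    obtain w where w: "\<forall>p'<m. \<forall>q'<m. lin_ext m C (outer ?x) p' q' = outer w p' q'" using rank1 by blast
    have "outer w p q * outer w q r = outer w p r * outer w q q" by (simp add: outer_def)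
    then have "lin_ext m C (outer ?x) p q * lin_ext m C (outer ?x) q r = lin_ext m C (outer ?x) p r * lin_ext m C (outer ?x) q q"
      using w assms by simp
    then have "straight p q * cnj b * (straight q r * (b * cnj c) + flipped q r * (c * cnj b))
      = (straight p r * cnj c + flipped p r * c) * (b * cnj b)"
      using assms d by (simp add: image_entry outer_def)
    moreover have "b * cnj b = 1" using b by (simp add: mult.commute)
    moreover have "straight p q * cnj b * (straight q r * (b * cnj c) + flipped q r * (c * cnj b))
      = straight p q * (straight q r * cnj c * (b * cnj b) + cnj b * cnj b * flipped q r * c)" by (simp add: algebra_simps)
    ultimately show ?thesis by simp
  qed
  have 1: "straight p q * (straight q r + flipped q r) = straight p r + flipped p r" using e[of 1 1] by simp
  have 2: "straight p q * (straight q r - flipped q r) = straight p r + flipped p r" using e[of "\<i>" 1] by (simp add: algebra_simps)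
  have "straight p q * (2 * flipped q r) = straight p q * (straight q r + flipped q r) - straight p q * (straight q r - flipped q r)" by (simp add: algebra_simps)
  then have dq: "flipped q r = 0" using 1 2 straight by simp
  have "\<i> * (flipped p r - straight p r) = \<i> * (- (straight p q * straight q r))" using e[of 1 "\<i>"] dq by (simp add: algebra_simps)
  then have 3: "flipped p r - straight p r = - (straight p q * straight q r)" by (simp only: mult_cancel_left complex_i_not_zero) simp
  have 4: "straight p r + flipped p r = straight p q * straight q r" using 1 dq by simp
  have "2 * flipped p r = (flipped p r - straight p r) + (straight p r + flipped p r)" by simp
  then show "flipped p r = 0" unfolding 3 4 by simp
  then show "straight p r = straight p q * straight q r" using 4 by simp
qed

text \<open>Row 0 of the cocycle gives the diagonal unitary: \<open>d p = cnj (straight 0 p)\<close>.\<close>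

lemma direct_form:
  assumes m: "2 \<le> m" and straight: "straight 0 1 \<noteq> 0"
  shows "\<exists>d. (\<forall>p<m. cmod (d p) = 1) \<and>
    (\<forall>A. \<forall>p<m. \<forall>q<m. lin_ext m C A p q = d p * cnj (d q) * A p q)"
proof -
  have m01: "0 < m" "1 < m" using m by auto
  have up0: "straight 0 r \<noteq> 0" if r: "r < m" "r \<noteq> 0" for r
  proof (cases "r = 1")
    case False
    have "flipped 0 r = 0" by (rule straight_cocycle(2)[of 0 1 r]) (use m01 r False straight in auto)
    then show ?thesis using straight_or_flipped[of 0 r] r m01 by auto
  qed (use straight in simp)
  define d where "d p = (if p = 0 then 1 else cnj (straight 0 p))" for p
  have d1: "cmod (d p) = 1" if "p < m" for p
    using straight_or_flipped[of 0 p] up0[of p] that m01 by (auto simp: d_def)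
  have d1': "d p * cnj (d p) = 1" if "p < m" for p
    using d1[OF that] by (metis complex_norm_square of_real_1 one_power2)
  have all: "straight p q = d p * cnj (d q) \<and> flipped p q = 0" if pq: "p < m" "q < m" "p \<noteq> q" for p q
  proof -
    have upe: "straight p q = d p * cnj (d q)"
    proof (cases "p = 0 \<or> q = 0")
      case True
      then show ?thesis using pq straight_hermitian[of 0 p] by (auto simp: d_def)
    next
      case False
      have "straight 0 q = straight 0 p * straight p q" using False pq m01 up0[of p] by (intro straight_cocycle) auto
      then have "d p * cnj (d q) = (d p * cnj (d p)) * straight p q" using False by (simp add: d_def)
      then show ?thesis using d1'[OF pq(1)] by simp
    qed
    have "cmod (straight p q) = 1" unfolding upe using d1 pq by (simp add: norm_mult)
    then show ?thesis using upe straight_or_flipped[OF pq] by auto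
  qed
  have "lin_ext m C A p q = d p * cnj (d q) * A p q" if "p < m" "q < m" for A p q
    using all[OF that] d1'[OF that(1)] image_entry[OF that, of A] by (cases "p = q") auto
  then show ?thesis using d1 by blast
qed

end

lemma lin_ext_swap_args: "lin_ext m (\<lambda>p q. C q p) A = lin_ext m C (\<lambda>i j. A j i)"
  by (intro ext) (simp add: lin_ext_def sum.swap[of "\<lambda>p q. A p q * C q p _ _"])

lemma outer_cnj: "(\<lambda>i j. outer x j i) = outer (\<lambda>i. cnj (x i))"
  by (intro ext) (simp add: outer_def mult.commute)

text \<open>If the first off-diagonal entry is transposed, the composition with the transposition is straight there.\<close>

theorem (in rank1_map) rank1_map_form:
  assumes m: "2 \<le> m"
  shows "\<exists>d T. (\<forall>p<m. cmod (d p) = 1) \<and>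
    (\<forall>A. \<forall>p<m. \<forall>q<m. lin_ext m C A p q = d p * cnj (d q) * (if T then A q p else A p q))"
proof (cases "straight 0 1 = 0")
  case False
  obtain d where "(\<forall>p<m. cmod (d p) = 1) \<and> (\<forall>A. \<forall>p<m. \<forall>q<m. lin_ext m C A p q = d p * cnj (d q) * A p q)"
    using direct_form[OF m False] by blast
  then show ?thesis by (intro exI[of _ d] exI[of _ False]) simp
next
  case True
  interpret T: rank1_map m "\<lambda>p q. C q p"
  proof
    fix x
    have "ip m (\<lambda>i. cnj (x i)) (\<lambda>i. cnj (x i)) = ip m x x" by (simp add: ip_def mult.commute)
    then show "\<exists>w. (\<forall>p<m. \<forall>q<m. lin_ext m (\<lambda>p q. C q p) (outer x) p q = outer w p q) \<and> ip m w w = ip m x x"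
      using rank1[of "\<lambda>i. cnj (x i)"] unfolding lin_ext_swap_args[of m C] outer_cnj by simp
  next
    fix l i j assume "l < m" "i < m" "j < m"
    moreover have "(\<lambda>i. cnj (basis_vec l i)) = basis_vec l" by (intro ext) (simp add: basis_vec_def)
    ultimately show "lin_ext m (\<lambda>p q. C q p) (outer (basis_vec l)) i j = of_bool (i = l \<and> j = l)"
      unfolding lin_ext_swap_args[of m C] outer_cnj using diag by simp
  qed
  have "T.straight 0 1 = flipped 0 1" by (simp add: T.straight_def flipped_def)
  then have "T.straight 0 1 \<noteq> 0" using straight_or_flipped[of 0 1] True m by auto
  then obtain d where d: "\<forall>p<m. cmod (d p) = 1"
    "\<forall>A. \<forall>p<m. \<forall>q<m. lin_ext m C (\<lambda>i j. A j i) p q = d p * cnj (d q) * A p q"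
    using T.direct_form[OF m] unfolding lin_ext_swap_args[of m C] by blast
  have "\<forall>p<m. \<forall>q<m. lin_ext m C A p q = d p * cnj (d q) * A q p" for A
    using d(2)[rule_format, of _ _ "\<lambda>i j. A j i"] by simp
  then show ?thesis using d(1) by (intro exI[of _ d] exI[of _ True]) simp
qed

section \<open>Linear maps that preserve product bases\<close>

definition mat_unit :: "nat \<Rightarrow> nat \<Rightarrow> nat \<Rightarrow> nat \<Rightarrow> complex" where
  "mat_unit p q i j = of_bool (i = p) * of_bool (j = q)"

lemma expand_mat_unit:
  assumes "i < m" "j < m"
  shows "A i j = (\<Sum>r\<in>{..<m} \<times> {..<m}. A (fst r) (snd r) * mat_unit (fst r) (snd r) i j)"
proof -
  have "(\<Sum>r\<in>{..<m} \<times> {..<m}. A (fst r) (snd r) * mat_unit (fst r) (snd r) i j)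
    = (\<Sum>r\<in>{..<m} \<times> {..<m}. if r = (i, j) then A i j else 0)"
    by (intro sum.cong refl) (auto simp: mat_unit_def)
  then show ?thesis using assms by simp
qed

lemma sum_pair: "(\<Sum>r\<in>{..<m} \<times> {..<m}. f (fst r) (snd r)) = (\<Sum>p<m. \<Sum>q<m. f p q)"
  by (simp add: sum.cartesian_product case_prod_beta)

lemma lin_ext_tmat_sum_right:
  assumes "finite S" "\<And>p q. p < n \<Longrightarrow> q < n \<Longrightarrow> B p q = (\<Sum>r\<in>S. c r * G r p q)"
  shows "lin_ext (m * n) D (tmat n A B) s t = (\<Sum>r\<in>S. c r * lin_ext (m * n) D (tmat n A (G r)) s t)"
proof -
  have "lin_ext (m * n) D (tmat n A B) = lin_ext (m * n) D (\<lambda>i j. \<Sum>r\<in>S. c r * tmat n A (G r) i j)"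
  proof (intro lin_ext_cong)
    fix i j assume "i < m * n" "j < m * n"
    then have "i mod n < n" "j mod n < n" using div_mod_lt by auto
    then show "tmat n A B i j = (\<Sum>r\<in>S. c r * tmat n A (G r) i j)"
      unfolding tmat_def using assms(2) by (simp add: sum_distrib_left mult.left_commute)
  qed
  then show ?thesis by (simp add: lin_ext_sum[OF assms(1)] lin_ext_scale)
qed

lemma lin_ext_tmat_sum_left:
  assumes "finite S" "\<And>p q. p < m \<Longrightarrow> q < m \<Longrightarrow> A p q = (\<Sum>r\<in>S. c r * G r p q)"
  shows "lin_ext (m * n) D (tmat n A B) s t = (\<Sum>r\<in>S. c r * lin_ext (m * n) D (tmat n (G r) B) s t)"
proof -
  have "lin_ext (m * n) D (tmat n A B) = lin_ext (m * n) D (\<lambda>i j. \<Sum>r\<in>S. c r * tmat n (G r) B i j)"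
  proof (intro lin_ext_cong)
    fix i j assume "i < m * n" "j < m * n"
    then have "i div n < m" "j div n < m" using div_mod_lt by auto
    then show "tmat n A B i j = (\<Sum>r\<in>S. c r * tmat n (G r) B i j)"
      unfolding tmat_def using assms(2) by (simp add: sum_distrib_right mult.assoc)
  qed
  then show ?thesis by (simp add: lin_ext_sum[OF assms(1)] lin_ext_scale)
qed

text \<open>Polarization: \<open>4 ab* = \<Sum> \<omega> (a + \<omega>b)(a + \<omega>b)*\<close>, where \<open>\<omega>\<close> runs through the fourth roots of unity.\<close>

lemma span_outer:
  obtains S :: "((nat \<times> nat) \<times> nat) set" and c x where "finite S"
    "\<forall>p<m. \<forall>q<m. A p q = (\<Sum>r\<in>S. c r * outer (x r) p q)"
proof -
  define c where "c r = A (fst (fst r)) (snd (fst r)) * (\<i> ^ snd r / 4)" for r :: "(nat \<times> nat) \<times> nat"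
  define x where "x r = (\<lambda>p. basis_vec (fst (fst r)) p + \<i> ^ snd r * basis_vec (snd (fst r)) p)" for r :: "(nat \<times> nat) \<times> nat"
  have pol: "(\<Sum>l<4. \<i> ^ l / 4 * outer (\<lambda>p. basis_vec a p + \<i> ^ l * basis_vec b p) p q) = mat_unit a b p q" for a b p q
    by (simp add: outer_def basis_vec_def mat_unit_def numeral_eq_Suc of_bool_def algebra_simps)
  have "A p q = (\<Sum>r\<in>({..<m} \<times> {..<m}) \<times> {..<4}. c r * outer (x r) p q)" if pq: "p < m" "q < m" for p q
  proof -
    have "(\<Sum>r\<in>({..<m} \<times> {..<m}) \<times> {..<4}. c r * outer (x r) p q)
      = (\<Sum>r\<in>{..<m} \<times> {..<m}. \<Sum>l<4. c (r, l) * outer (x (r, l)) p q)"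
      by (simp add: sum.cartesian_product)
    also have "\<dots> = (\<Sum>r\<in>{..<m} \<times> {..<m}. A (fst r) (snd r) * (\<Sum>l<4. \<i> ^ l / 4 * outer (\<lambda>p. basis_vec (fst r) p + \<i> ^ l * basis_vec (snd r) p) p q))"
      by (simp add: c_def x_def sum_distrib_left mult.assoc)
    finally show ?thesis unfolding pol using expand_mat_unit[OF pq, of A] by simp
  qed
  then show ?thesis by (intro that[of "({..<m} \<times> {..<m}) \<times> {..<4}" c x]) auto
qed

lemma orthonormal_basis_vec: "orthonormal n n basis_vec"
  unfolding orthonormal_def
proof (intro allI impI)
  fix a b assume "a < n" "b < n"
  have "ip n (basis_vec a) (basis_vec b) = (\<Sum>i<n. if i = a then of_bool (a = b) else 0)"
    unfolding ip_def basis_vec_def by (intro sum.cong refl) auto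
  then show "ip n (basis_vec a) (basis_vec b) = of_bool (a = b)" using \<open>a < n\<close> by simp
qed

lemma tvec_basis_vec:
  assumes "j < n"
  shows "tvec n (basis_vec i) (basis_vec j) = basis_vec (i * n + j)"
  unfolding tvec_def basis_vec_def fun_eq_iff index_eq_iff[of _ "i * n + j" n] using assms by (auto simp: of_bool_def)

lemma rank1_scaled:
  assumes unit: "\<And>x. ip m x x = 1 \<Longrightarrow> \<exists>w. (\<forall>p<m. \<forall>q<m. lin_ext m C (outer x) p q = outer w p q) \<and> ip m w w = 1"
  shows "\<exists>w. (\<forall>p<m. \<forall>q<m. lin_ext m C (outer x) p q = outer w p q) \<and> ip m w w = ip m x x"
proof (cases "\<exists>i<m. x i \<noteq> 0")
  case True
  then obtain i where i: "i < m" "x i \<noteq> 0" by blast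
  obtain c where c: "c \<noteq> 0" "ip m (\<lambda>i. c * x i) (\<lambda>i. c * x i) = 1" using normalize[of i m x, OF i] by blast
  obtain w where w: "\<forall>p<m. \<forall>q<m. lin_ext m C (outer (\<lambda>i. c * x i)) p q = outer w p q" "ip m w w = 1"
    using unit[OF c(2)] by blast
  have "outer x = (\<lambda>i j. 1 / (c * cnj c) * outer (\<lambda>i. c * x i) i j)" using c(1) by (intro ext) (simp add: outer_def)
  then have l: "lin_ext m C (outer x) = (\<lambda>i j. 1 / (c * cnj c) * lin_ext m C (outer (\<lambda>i. c * x i)) i j)" by (metis lin_ext_scale)
  have "ip m x x = 1 / (cnj c * c)" using c by (simp add: ip_scale_left ip_scale_right field_simps)
  moreover have "ip m (\<lambda>i. 1 / c * w i) (\<lambda>i. 1 / c * w i) = 1 / (cnj c * c)"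
    unfolding ip_scale_left ip_scale_right w(2) by simp
  ultimately show ?thesis
    using w(1) l by (intro exI[of _ "\<lambda>i. 1 / c * w i"] conjI) (simp_all add: outer_def)
next
  case False
  have "outer x i j = 0" if "i < m" for i j using False that by (simp add: outer_def)
  then have "lin_ext m C (outer x) = (\<lambda>_ _. 0)" by (intro ext) (simp add: lin_ext_def)
  then show ?thesis using False by (intro exI[of _ "\<lambda>_. 0"]) (simp add: outer_def ip_def)
qed

text \<open>A map that sends product bases to bases, after a unitary similarity that makes it fix the diagonal matrix
  units.\<close>

locale product_map =
  fixes m n :: nat and D :: "nat \<Rightarrow> nat \<Rightarrow> nat \<Rightarrow> nat \<Rightarrow> complex"
  assumes m: "2 \<le> m" and n: "2 \<le> n" and bp: "basis_preserving m n D"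
    and std: "\<And>s i j. s < m * n \<Longrightarrow> i < m * n \<Longrightarrow> j < m * n \<Longrightarrow> lin_ext (m * n) D (outer (basis_vec s)) i j = of_bool (i = s \<and> j = s)"
begin

abbreviation "N \<equiv> m * n"
abbreviation "f \<equiv> lin_ext N D"
abbreviation "delta \<equiv> (\<lambda>i j. of_bool (i = j)) :: nat \<Rightarrow> nat \<Rightarrow> complex"

lemma product_basis_images:
  assumes b: "orthonormal m m b" and c: "orthonormal n n c"
  obtains v where "orthonormal N N v"
    "\<forall>i<m. \<forall>j<n. \<forall>s<N. \<forall>t<N. f (outer (tvec n (b i) (c j))) s t = outer (v (i * n + j)) s t"
proof -
  have "product_basis m n (\<lambda>s. b (s div n)) (\<lambda>s. c (s mod n))"
    unfolding product_basis_def
  proof (intro conjI allI impI)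
    show "orthonormal N N (\<lambda>s. tvec n (b (s div n)) (c (s mod n)))" by (rule orthonormal_tvec_left[OF b c])
  qed (use orthonormalD[OF b] orthonormalD[OF c] div_mod_lt in auto)
  then obtain v where v: "orthonormal N N v"
    "\<forall>s<N. \<forall>i<N. \<forall>j<N. f (outer (tvec n (b (s div n)) (c (s mod n)))) i j = outer (v s) i j"
    using bp unfolding basis_preserving_def by blast
  have "f (outer (tvec n (b i) (c j))) s t = outer (v (i * n + j)) s t" if "i < m" "j < n" "s < N" "t < N" for i j s t
  proof -
    have "i * n + j < N" by (rule pair_lt[OF that(1,2)])
    then show ?thesis using v(2)[rule_format, of "i * n + j" s t] that by simp
  qed
  then show ?thesis using that[OF v(1)] by blast
qed

lemma resolve_right:
  assumes "orthonormal n n c"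
  shows "f (tmat n A delta) s t = (\<Sum>j<n. f (tmat n A (outer (c j))) s t)"
  using lin_ext_tmat_sum_right[of "{..<n}" n delta "\<lambda>_. 1" "\<lambda>j. outer (c j)" m D A s t] orthonormal_complete[OF assms]
  by (simp add: outer_def[abs_def])

lemma resolve_left:
  assumes "orthonormal m m b"
  shows "f (tmat n delta B) s t = (\<Sum>i<m. f (tmat n (outer (b i)) B) s t)"
  using lin_ext_tmat_sum_left[of "{..<m}" m delta "\<lambda>_. 1" "\<lambda>i. outer (b i)" n D B s t] orthonormal_complete[OF assms]
  by (simp add: outer_def[abs_def])

lemma unit_extend:
  assumes "ip l x x = 1" "0 < l"
  obtains b where "orthonormal l l b" "b 0 = x"
  using orthonormal_extend[OF orthonormal_single[OF assms(1)]] assms(2) by fastforce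

text \<open>Extend \<open>x\<close> and \<open>y\<close> to bases. Both \<open>\<phi>(xx* \<otimes> I)\<close> and \<open>\<phi>(I \<otimes> yy*)\<close> are sums of members of one family of
  mutually orthogonal rank one projections, and only \<open>\<phi>(xx* \<otimes> yy*)\<close> occurs in both.\<close>

lemma factor:
  assumes x: "ip m x x = 1" and y: "ip n y y = 1" and st: "s < N" "t < N"
  shows "f (outer (tvec n x y)) s t = (\<Sum>l<N. f (tmat n (outer x) delta) s l * f (tmat n delta (outer y)) l t)"
    and "f (outer (tvec n x y)) s t = (\<Sum>l<N. f (tmat n delta (outer y)) s l * f (tmat n (outer x) delta) l t)"
proof -
  have m0: "0 < m" "0 < n" using m n by auto
  obtain b where b: "orthonormal m m b" "b 0 = x" by (rule unit_extend[OF x m0(1)])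
  obtain c where c: "orthonormal n n c" "c 0 = y" by (rule unit_extend[OF y m0(2)])
  obtain v where v0: "orthonormal N N v"
    "\<forall>i<m. \<forall>j<n. \<forall>s<N. \<forall>t<N. f (outer (tvec n (b i) (c j))) s t = outer (v (i * n + j)) s t"
    by (rule product_basis_images[OF b(1) c(1)])
  note v = v0(1) v0(2)[rule_format]
  have al: "f (tmat n (outer x) delta) p q = (\<Sum>j<n. v j p * cnj (v j q))" if "p < N" "q < N" for p q
    unfolding resolve_right[OF c(1)] using v(2)[of 0] b(2) that m0 by (simp add: tmat_outer) (simp add: outer_def)
  have be: "f (tmat n delta (outer y)) p q = (\<Sum>i<m. v (i * n) p * cnj (v (i * n) q))" if "p < N" "q < N" for p q
    unfolding resolve_left[OF b(1)] using v(2)[of _ 0] c(2) that m0 by (simp add: tmat_outer) (simp add: outer_def)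
  have e: "f (outer (tvec n x y)) s t = v 0 s * cnj (v 0 t)"
    using v(2)[OF m0 st] b(2) c(2) by (simp add: outer_def)
  have o: "ip N (v j) (v (i * n)) = of_bool (j = 0 \<and> i = 0)" if "i < m" "j < n" for i j
  proof -
    have "i * n < N" using pair_lt[OF that(1) m0(2)] by simp
    moreover have "j < N" using pair_lt[OF m0(1) that(2)] by simp
    moreover have "j = i * n \<longleftrightarrow> j = 0 \<and> i = 0" using that(2) m0 by (cases i) auto
    ultimately show ?thesis using orthonormalD[OF v(1), of j "i * n"] by simp
  qed
  have expand: "(\<Sum>l<N. (\<Sum>a<p. g a s * cnj (g a l)) * (\<Sum>b<q. h b l * cnj (h b t)))
    = (\<Sum>a<p. \<Sum>b<q. g a s * cnj (h b t) * ip N (g a) (h b))" for g h :: "nat \<Rightarrow> nat \<Rightarrow> complex" and p q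
  proof -
    have "(\<Sum>l<N. (\<Sum>a<p. g a s * cnj (g a l)) * (\<Sum>b<q. h b l * cnj (h b t)))
      = (\<Sum>l<N. \<Sum>a<p. \<Sum>b<q. g a s * cnj (h b t) * (cnj (g a l) * h b l))"
      by (simp add: sum_product mult_ac)
    also have "\<dots> = (\<Sum>a<p. \<Sum>b<q. \<Sum>l<N. g a s * cnj (h b t) * (cnj (g a l) * h b l))"
      by (subst sum.swap, intro sum.cong refl sum.swap)
    finally show ?thesis by (simp add: ip_def sum_distrib_left)
  qed
  have d1: "(\<Sum>j<n. \<Sum>i<m. v j s * cnj (v (i * n) t) * of_bool (j = 0 \<and> i = 0)) = v 0 s * cnj (v 0 t)"
  proof -
    have "(\<Sum>j<n. \<Sum>i<m. v j s * cnj (v (i * n) t) * of_bool (j = 0 \<and> i = 0))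
      = (\<Sum>j<n. \<Sum>i<m. if i = 0 then (if j = 0 then v 0 s * cnj (v 0 t) else 0) else 0)"
      by (intro sum.cong refl) auto
    then show ?thesis using m0 by simp
  qed
  have d2: "(\<Sum>i<m. \<Sum>j<n. v (i * n) s * cnj (v j t) * of_bool (j = 0 \<and> i = 0)) = v 0 s * cnj (v 0 t)"
  proof -
    have "(\<Sum>i<m. \<Sum>j<n. v (i * n) s * cnj (v j t) * of_bool (j = 0 \<and> i = 0))
      = (\<Sum>i<m. \<Sum>j<n. if j = 0 then (if i = 0 then v 0 s * cnj (v 0 t) else 0) else 0)"
      by (intro sum.cong refl) auto
    then show ?thesis using m0 by simp
  qed
  have o': "ip N (v (i * n)) (v j) = of_bool (j = 0 \<and> i = 0)" if "i < m" "j < n" for i j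
    using o[OF that] cnj_ip[of N "v j" "v (i * n)"] by (cases "j = 0 \<and> i = 0") auto
  have "(\<Sum>l<N. f (tmat n (outer x) delta) s l * f (tmat n delta (outer y)) l t)
    = (\<Sum>l<N. (\<Sum>j<n. v j s * cnj (v j l)) * (\<Sum>i<m. v (i * n) l * cnj (v (i * n) t)))"
    using al be st by simp
  also have "\<dots> = (\<Sum>j<n. \<Sum>i<m. v j s * cnj (v (i * n) t) * ip N (v j) (v (i * n)))" by (rule expand)
  also have "\<dots> = (\<Sum>j<n. \<Sum>i<m. v j s * cnj (v (i * n) t) * of_bool (j = 0 \<and> i = 0))"
    by (intro sum.cong refl) (simp only: o lessThan_iff)
  finally show "f (outer (tvec n x y)) s t = (\<Sum>l<N. f (tmat n (outer x) delta) s l * f (tmat n delta (outer y)) l t)"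
    unfolding d1 e by simp
  have "(\<Sum>l<N. f (tmat n delta (outer y)) s l * f (tmat n (outer x) delta) l t)
    = (\<Sum>l<N. (\<Sum>i<m. v (i * n) s * cnj (v (i * n) l)) * (\<Sum>j<n. v j l * cnj (v j t)))"
    using al be st by simp
  also have "\<dots> = (\<Sum>i<m. \<Sum>j<n. v (i * n) s * cnj (v j t) * ip N (v (i * n)) (v j))" by (rule expand)
  also have "\<dots> = (\<Sum>i<m. \<Sum>j<n. v (i * n) s * cnj (v j t) * of_bool (j = 0 \<and> i = 0))"
    by (intro sum.cong refl) (simp only: o' lessThan_iff)
  finally show "f (outer (tvec n x y)) s t = (\<Sum>l<N. f (tmat n delta (outer y)) s l * f (tmat n (outer x) delta) l t)"
    unfolding d2 e by simp
qed

lemma image_diag_vanishes: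
  fixes g :: "nat \<Rightarrow> nat \<Rightarrow> complex"
  assumes "(\<Sum>i<l. outer (g i) s s) = 0" "i < l"
  shows "g i s = 0"
proof -
  have "complex_of_real (\<Sum>i<l. (cmod (g i s))\<^sup>2) = 0"
    using assms(1) by (simp add: outer_def complex_norm_square del: of_real_power)
  then have "(\<Sum>i<l. (cmod (g i s))\<^sup>2) = 0" by (simp only: of_real_eq_0_iff)
  then show ?thesis using assms(2) by (subst (asm) sum_nonneg_eq_0_iff) auto
qed

text \<open>The images of \<open>b\<^sub>ib\<^sub>i* \<otimes> E\<^sub>j\<^sub>j\<close> for a basis \<open>b\<close> add up to \<open>I \<otimes> E\<^sub>j\<^sub>j\<close>. Being positive semidefinite, none of them
  can leave the block \<open>j\<close>.\<close>

lemma left_image: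
  assumes x: "ip m x x = 1" and j: "j < n"
  obtains w where "ip N w w = 1" "\<forall>s<N. s mod n \<noteq> j \<longrightarrow> w s = 0"
    "\<forall>s<N. \<forall>t<N. f (tmat n (outer x) (outer (basis_vec j))) s t = outer w s t"
proof -
  have m0: "0 < m" "0 < n" using m n by auto
  obtain b where b: "orthonormal m m b" "b 0 = x" by (rule unit_extend[OF x m0(1)])
  obtain v where v0: "orthonormal N N v"
    "\<forall>i<m. \<forall>j<n. \<forall>s<N. \<forall>t<N. f (outer (tvec n (b i) (basis_vec j))) s t = outer (v (i * n + j)) s t"
    by (rule product_basis_images[OF b(1) orthonormal_basis_vec])
  note v = v0(1) v0(2)[rule_format]
  have "v (0 * n + j) s = 0" if s: "s < N" "s mod n \<noteq> j" for s
  proof (rule image_diag_vanishes[OF _ m0(1), of "\<lambda>i. v (i * n + j)"])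
    have "(\<Sum>i<m. outer (v (i * n + j)) s s) = f (tmat n delta (outer (basis_vec j))) s s"
      unfolding resolve_left[OF b(1)] tmat_outer using v(2) j s by simp
    also have "\<dots> = (\<Sum>i<m. f (outer (basis_vec (i * n + j))) s s)"
      unfolding resolve_left[OF orthonormal_basis_vec] tmat_outer tvec_basis_vec[OF j] ..
    also have "\<dots> = 0" using s std[OF pair_lt[OF _ j] s(1) s(1)] j by (intro sum.neutral) auto
    finally show "(\<Sum>i<m. outer (v (i * n + j)) s s) = 0" .
  qed
  moreover have "ip N (v j) (v j) = 1" using orthonormalD[OF v(1), of j j] pair_lt[OF m0(1) j] by simp
  ultimately show ?thesis using that[of "v j"] v(2)[OF m0(1) j] b(2) by (simp add: tmat_outer)
qed

lemma right_image:
  assumes y: "ip n y y = 1" and i: "i < m"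
  obtains w where "ip N w w = 1" "\<forall>s<N. s div n \<noteq> i \<longrightarrow> w s = 0"
    "\<forall>s<N. \<forall>t<N. f (tmat n (outer (basis_vec i)) (outer y)) s t = outer w s t"
proof -
  have m0: "0 < m" "0 < n" using m n by auto
  obtain c where c: "orthonormal n n c" "c 0 = y" by (rule unit_extend[OF y m0(2)])
  obtain v where v0: "orthonormal N N v"
    "\<forall>i<m. \<forall>j<n. \<forall>s<N. \<forall>t<N. f (outer (tvec n (basis_vec i) (c j))) s t = outer (v (i * n + j)) s t"
    by (rule product_basis_images[OF orthonormal_basis_vec c(1)])
  note v = v0(1) v0(2)[rule_format]
  have "v (i * n + 0) s = 0" if s: "s < N" "s div n \<noteq> i" for s
  proof (rule image_diag_vanishes[OF _ m0(2), of "\<lambda>j. v (i * n + j)"])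
    have "(\<Sum>j<n. outer (v (i * n + j)) s s) = f (tmat n (outer (basis_vec i)) delta) s s"
      unfolding resolve_right[OF c(1)] tmat_outer using v(2) i s by simp
    also have "\<dots> = (\<Sum>j<n. f (outer (basis_vec (i * n + j))) s s)"
      unfolding resolve_right[OF orthonormal_basis_vec] tmat_outer by (simp add: tvec_basis_vec)
    also have "\<dots> = 0" using s std[OF pair_lt[OF i] s(1) s(1)] by (intro sum.neutral) auto
    finally show "(\<Sum>j<n. outer (v (i * n + j)) s s) = 0" .
  qed
  moreover have "ip N (v (i * n)) (v (i * n)) = 1"
    using orthonormalD[OF v(1), of "i * n" "i * n"] pair_lt[OF i m0(2)] by simp
  ultimately show ?thesis using that[of "v (i * n)"] v(2)[OF i m0(2)] c(2) by (simp add: tmat_outer)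
qed

text \<open>The induced maps on one factor: \<open>A \<mapsto> \<phi>(A \<otimes> E\<^sub>j\<^sub>j)\<close> compressed to the block \<open>j\<close>, and
  \<open>B \<mapsto> \<phi>(E\<^sub>i\<^sub>i \<otimes> B)\<close> compressed to the block \<open>i\<close>.\<close>

definition left_map :: "nat \<Rightarrow> nat \<Rightarrow> nat \<Rightarrow> nat \<Rightarrow> nat \<Rightarrow> complex" where
  "left_map j p q i i' = f (tmat n (mat_unit p q) (outer (basis_vec j))) (i * n + j) (i' * n + j)"

definition right_map :: "nat \<Rightarrow> nat \<Rightarrow> nat \<Rightarrow> nat \<Rightarrow> nat \<Rightarrow> complex" where
  "right_map i p q j j' = f (tmat n (outer (basis_vec i)) (mat_unit p q)) (i * n + j) (i * n + j')"

lemma lin_ext_left_map: "lin_ext m (left_map j) A i i' = f (tmat n A (outer (basis_vec j))) (i * n + j) (i' * n + j)"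
proof -
  have "f (tmat n A (outer (basis_vec j))) (i * n + j) (i' * n + j)
    = (\<Sum>r\<in>{..<m} \<times> {..<m}. A (fst r) (snd r) * f (tmat n (mat_unit (fst r) (snd r)) (outer (basis_vec j))) (i * n + j) (i' * n + j))"
    by (rule lin_ext_tmat_sum_left[OF _ expand_mat_unit]) auto
  also have "\<dots> = (\<Sum>p<m. \<Sum>q<m. A p q * f (tmat n (mat_unit p q) (outer (basis_vec j))) (i * n + j) (i' * n + j))"
    by (rule sum_pair)
  finally show ?thesis by (simp add: lin_ext_def[of m] left_map_def)
qed

lemma lin_ext_right_map: "lin_ext n (right_map i) B j j' = f (tmat n (outer (basis_vec i)) B) (i * n + j) (i * n + j')"
proof -
  have "f (tmat n (outer (basis_vec i)) B) (i * n + j) (i * n + j')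
    = (\<Sum>r\<in>{..<n} \<times> {..<n}. B (fst r) (snd r) * f (tmat n (outer (basis_vec i)) (mat_unit (fst r) (snd r))) (i * n + j) (i * n + j'))"
    by (rule lin_ext_tmat_sum_right[OF _ expand_mat_unit]) auto
  also have "\<dots> = (\<Sum>p<n. \<Sum>q<n. B p q * f (tmat n (outer (basis_vec i)) (mat_unit p q)) (i * n + j) (i * n + j'))"
    by (rule sum_pair)
  finally show ?thesis by (simp add: lin_ext_def[of n] right_map_def)
qed

lemma rank1_map_left_map:
  assumes j: "j < n"
  shows "rank1_map m (left_map j)"
proof
  show "\<exists>w. (\<forall>p<m. \<forall>q<m. lin_ext m (left_map j) (outer x) p q = outer w p q) \<and> ip m w w = ip m x x" for x
  proof (rule rank1_scaled)
    fix x assume x: "ip m x x = 1"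
    obtain w where w: "ip N w w = 1" "\<forall>s<N. s mod n \<noteq> j \<longrightarrow> w s = 0"
      "\<forall>s<N. \<forall>t<N. f (tmat n (outer x) (outer (basis_vec j))) s t = outer w s t"
      by (rule left_image[OF x j])
    let ?w = "\<lambda>i. w (i * n + j)"
    have "ip N w w = (\<Sum>s<m * n. (\<lambda>i l. cnj (w (i * n + l)) * w (i * n + l)) (s div n) (s mod n))"
      by (simp add: ip_def)
    also have "\<dots> = (\<Sum>i<m. \<Sum>l<n. cnj (w (i * n + l)) * w (i * n + l))" by (rule sum_div_mod)
    also have "\<dots> = (\<Sum>i<m. \<Sum>l<n. if l = j then cnj (?w i) * ?w i else 0)"
    proof (intro sum.cong refl)
      fix i l assume "i \<in> {..<m}" "l \<in> {..<n}"
      then show "cnj (w (i * n + l)) * w (i * n + l) = (if l = j then cnj (?w i) * ?w i else 0)"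
        using w(2)[rule_format, of "i * n + l"] pair_lt[of i m l n] by auto
    qed
    also have "\<dots> = ip m ?w ?w" using j by (simp add: ip_def)
    finally have "ip m ?w ?w = 1" using w(1) by simp
    moreover have "lin_ext m (left_map j) (outer x) p q = outer ?w p q" if "p < m" "q < m" for p q
      unfolding lin_ext_left_map w(3)[rule_format, OF pair_lt[OF that(1) j] pair_lt[OF that(2) j]] by (simp add: outer_def)
    ultimately show "\<exists>w. (\<forall>p<m. \<forall>q<m. lin_ext m (left_map j) (outer x) p q = outer w p q) \<and> ip m w w = 1" by blast
  qed
next
  fix l i i' assume "l < m" "i < m" "i' < m"
  then show "lin_ext m (left_map j) (outer (basis_vec l)) i i' = of_bool (i = l \<and> i' = l)"
    unfolding lin_ext_left_map tmat_outer tvec_basis_vec[OF j] using std pair_lt[OF _ j] n by simp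
qed

lemma rank1_map_right_map:
  assumes i: "i < m"
  shows "rank1_map n (right_map i)"
proof
  show "\<exists>w. (\<forall>p<n. \<forall>q<n. lin_ext n (right_map i) (outer y) p q = outer w p q) \<and> ip n w w = ip n y y" for y
  proof (rule rank1_scaled)
    fix y assume y: "ip n y y = 1"
    obtain w where w: "ip N w w = 1" "\<forall>s<N. s div n \<noteq> i \<longrightarrow> w s = 0"
      "\<forall>s<N. \<forall>t<N. f (tmat n (outer (basis_vec i)) (outer y)) s t = outer w s t"
      by (rule right_image[OF y i])
    let ?w = "\<lambda>j. w (i * n + j)"
    have "ip N w w = (\<Sum>s<m * n. (\<lambda>i l. cnj (w (i * n + l)) * w (i * n + l)) (s div n) (s mod n))"
      by (simp add: ip_def)
    also have "\<dots> = (\<Sum>h<m. \<Sum>l<n. cnj (w (h * n + l)) * w (h * n + l))" by (rule sum_div_mod)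
    also have "\<dots> = (\<Sum>h<m. if h = i then (\<Sum>l<n. cnj (?w l) * ?w l) else 0)"
    proof (intro sum.cong refl)
      fix h assume "h \<in> {..<m}"
      then show "(\<Sum>l<n. cnj (w (h * n + l)) * w (h * n + l)) = (if h = i then (\<Sum>l<n. cnj (?w l) * ?w l) else 0)"
        using w(2)[rule_format, OF pair_lt[of h m _ n]] by (auto intro!: sum.neutral)
    qed
    also have "\<dots> = ip n ?w ?w" using i by (simp add: ip_def)
    finally have "ip n ?w ?w = 1" using w(1) by simp
    moreover have "lin_ext n (right_map i) (outer y) p q = outer ?w p q" if "p < n" "q < n" for p q
      unfolding lin_ext_right_map w(3)[rule_format, OF pair_lt[OF i that(1)] pair_lt[OF i that(2)]] by (simp add: outer_def)
    ultimately show "\<exists>w. (\<forall>p<n. \<forall>q<n. lin_ext n (right_map i) (outer y) p q = outer w p q) \<and> ip n w w = 1" by blast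
  qed
next
  fix l j j' assume "l < n" "j < n" "j' < n"
  then show "lin_ext n (right_map i) (outer (basis_vec l)) j j' = of_bool (j = l \<and> j' = l)"
    unfolding lin_ext_right_map tmat_outer using std pair_lt[OF i] by (simp add: tvec_basis_vec)
qed

lemma left_block:
  assumes x: "ip m x x = 1" and st: "s < N" "t < N"
  shows "f (tmat n (outer x) delta) s t = (if s mod n = t mod n then lin_ext m (left_map (s mod n)) (outer x) (s div n) (t div n) else 0)"
proof -
  have z: "f (tmat n (outer x) (outer (basis_vec j))) s t = 0" if "j < n" "s mod n \<noteq> j \<or> t mod n \<noteq> j" for j
  proof -
    note jz = that
    obtain w where "ip N w w = 1" "\<forall>s<N. s mod n \<noteq> j \<longrightarrow> w s = 0"
      "\<forall>s<N. \<forall>t<N. f (tmat n (outer x) (outer (basis_vec j))) s t = outer w s t"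
      by (rule left_image[OF x jz(1)])
    then show ?thesis using st jz by (auto simp: outer_def)
  qed
  have sn: "s mod n < n" using div_mod_lt[OF st(1)] by simp
  have "f (tmat n (outer x) delta) s t = (\<Sum>j<n. f (tmat n (outer x) (outer (basis_vec j))) s t)" by (rule resolve_right[OF orthonormal_basis_vec])
  also have "\<dots> = (\<Sum>j<n. if j = s mod n then f (tmat n (outer x) (outer (basis_vec (s mod n)))) s t else 0)"
    using z by (intro sum.cong refl) auto
  also have "\<dots> = f (tmat n (outer x) (outer (basis_vec (s mod n)))) s t" using sn by simp
  finally have main: "f (tmat n (outer x) delta) s t = f (tmat n (outer x) (outer (basis_vec (s mod n)))) s t" .
  show ?thesis
  proof (cases "s mod n = t mod n")
    case True
    have st_eq: "t div n * n + s mod n = t" using True by simp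
    show ?thesis unfolding if_P[OF True] main lin_ext_left_map st_eq div_mult_mod_eq ..
  qed (use main z[OF sn] in auto)
qed

lemma right_block:
  assumes y: "ip n y y = 1" and st: "s < N" "t < N"
  shows "f (tmat n delta (outer y)) s t = (if s div n = t div n then lin_ext n (right_map (s div n)) (outer y) (s mod n) (t mod n) else 0)"
proof -
  have z: "f (tmat n (outer (basis_vec i)) (outer y)) s t = 0" if "i < m" "s div n \<noteq> i \<or> t div n \<noteq> i" for i
  proof -
    note jz = that
    obtain w where "ip N w w = 1" "\<forall>s<N. s div n \<noteq> i \<longrightarrow> w s = 0"
      "\<forall>s<N. \<forall>t<N. f (tmat n (outer (basis_vec i)) (outer y)) s t = outer w s t"
      by (rule right_image[OF y jz(1)])
    then show ?thesis using st jz by (auto simp: outer_def)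
  qed
  have sm: "s div n < m" using div_mod_lt[OF st(1)] by simp
  have "f (tmat n delta (outer y)) s t = (\<Sum>i<m. f (tmat n (outer (basis_vec i)) (outer y)) s t)" by (rule resolve_left[OF orthonormal_basis_vec])
  also have "\<dots> = (\<Sum>i<m. if i = s div n then f (tmat n (outer (basis_vec (s div n))) (outer y)) s t else 0)"
    using z by (intro sum.cong refl) auto
  also have "\<dots> = f (tmat n (outer (basis_vec (s div n))) (outer y)) s t" using sm by simp
  finally have main: "f (tmat n delta (outer y)) s t = f (tmat n (outer (basis_vec (s div n))) (outer y)) s t" .
  show ?thesis
  proof (cases "s div n = t div n")
    case True
    have st_eq: "s div n * n + t mod n = t" using True by simp
    show ?thesis unfolding if_P[OF True] main lin_ext_right_map st_eq div_mult_mod_eq ..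
  qed (use main z[OF sm] in auto)
qed

text \<open>In the product of a matrix that preserves the second index and one that preserves the first index, a single
  intermediate index contributes. The two orders of the factors lead to different blocks.\<close>

lemma entry_unit:
  assumes x: "ip m x x = 1" and y: "ip n y y = 1" and st: "s < N" "t < N"
  shows "f (outer (tvec n x y)) s t = lin_ext m (left_map (s mod n)) (outer x) (s div n) (t div n) * lin_ext n (right_map (t div n)) (outer y) (s mod n) (t mod n)"
    and "f (outer (tvec n x y)) s t = lin_ext n (right_map (s div n)) (outer y) (s mod n) (t mod n) * lin_ext m (left_map (t mod n)) (outer x) (s div n) (t div n)"
proof -
  note d = div_mod_lt[OF st(1)] div_mod_lt[OF st(2)]
  have l: "t div n * n + s mod n < N" "s div n * n + t mod n < N" using d by (auto intro: pair_lt)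
  have n0: "0 < n" using n by simp
  have "(\<Sum>l<N. f (tmat n (outer x) delta) s l * f (tmat n delta (outer y)) l t)
    = (\<Sum>l<N. if l = t div n * n + s mod n then
        lin_ext m (left_map (s mod n)) (outer x) (s div n) (t div n) * lin_ext n (right_map (t div n)) (outer y) (s mod n) (t mod n) else 0)"
  proof (intro sum.cong refl)
    fix l assume "l \<in> {..<N}"
    then have lN: "l < N" by simp
    have "l = t div n * n + s mod n \<longleftrightarrow> s mod n = l mod n \<and> l div n = t div n"
      unfolding index_eq_iff[of l "t div n * n + s mod n" n] using n0 by auto
    then show "f (tmat n (outer x) delta) s l * f (tmat n delta (outer y)) l t = (if l = t div n * n + s mod n then
        lin_ext m (left_map (s mod n)) (outer x) (s div n) (t div n) * lin_ext n (right_map (t div n)) (outer y) (s mod n) (t mod n) else 0)"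
      unfolding left_block[OF x st(1) lN] right_block[OF y lN st(2)] by auto
  qed
  then show "f (outer (tvec n x y)) s t = lin_ext m (left_map (s mod n)) (outer x) (s div n) (t div n) * lin_ext n (right_map (t div n)) (outer y) (s mod n) (t mod n)"
    using factor(1)[OF x y st] l by simp
  have "(\<Sum>l<N. f (tmat n delta (outer y)) s l * f (tmat n (outer x) delta) l t)
    = (\<Sum>l<N. if l = s div n * n + t mod n then
        lin_ext n (right_map (s div n)) (outer y) (s mod n) (t mod n) * lin_ext m (left_map (t mod n)) (outer x) (s div n) (t div n) else 0)"
  proof (intro sum.cong refl)
    fix l assume "l \<in> {..<N}"
    then have lN: "l < N" by simp
    have "l = s div n * n + t mod n \<longleftrightarrow> s div n = l div n \<and> l mod n = t mod n"
      unfolding index_eq_iff[of l "s div n * n + t mod n" n] using n0 by auto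
    then show "f (tmat n delta (outer y)) s l * f (tmat n (outer x) delta) l t = (if l = s div n * n + t mod n then
        lin_ext n (right_map (s div n)) (outer y) (s mod n) (t mod n) * lin_ext m (left_map (t mod n)) (outer x) (s div n) (t div n) else 0)"
      unfolding right_block[OF y st(1) lN] left_block[OF x lN st(2)] by auto
  qed
  then show "f (outer (tvec n x y)) s t = lin_ext n (right_map (s div n)) (outer y) (s mod n) (t mod n) * lin_ext m (left_map (t mod n)) (outer x) (s div n) (t div n)"
    using factor(2)[OF x y st] l by simp
qed

lemma outer_scale: "outer (\<lambda>i. c * x i) = (\<lambda>i j. (c * cnj c) * outer x i j)"
  by (intro ext) (simp add: outer_def)

lemma unit_multiple_or_zero:
  obtains (unit) c where "c \<noteq> 0" "ip l (\<lambda>i. c * x i) (\<lambda>i. c * x i) = 1" | (zero) "\<forall>i<l. x i = 0"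
  using normalize[of _ l x] by blast

lemma entry:
  assumes st: "s < N" "t < N"
  shows "f (outer (tvec n x y)) s t = lin_ext m (left_map (s mod n)) (outer x) (s div n) (t div n) * lin_ext n (right_map (t div n)) (outer y) (s mod n) (t mod n)
    \<and> f (outer (tvec n x y)) s t = lin_ext n (right_map (s div n)) (outer y) (s mod n) (t mod n) * lin_ext m (left_map (t mod n)) (outer x) (s div n) (t div n)"
proof (cases rule: unit_multiple_or_zero[of m x])
  case (unit c)
  note c = unit
  show ?thesis
  proof (cases rule: unit_multiple_or_zero[of n y])
    case (unit d)
    have "tvec n (\<lambda>i. c * x i) (\<lambda>i. d * y i) = (\<lambda>s. (c * d) * tvec n x y s)" by (intro ext) (simp add: tvec_def)
    then show ?thesis
      using entry_unit[OF c(2) unit(2) st] c(1) unit(1) unfolding outer_scale lin_ext_scale by (simp add: outer_scale lin_ext_scale)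
  next
    case zero
    have "lin_ext n C (outer y) = (\<lambda>_ _. 0)" for C using zero by (intro ext) (simp add: lin_ext_def outer_def)
    moreover have "f (outer (tvec n x y)) = (\<lambda>_ _. 0)" using zero div_mod_lt by (intro ext) (simp add: lin_ext_def outer_def tvec_def)
    ultimately show ?thesis by simp
  qed
next
  case zero
  have "lin_ext m C (outer x) = (\<lambda>_ _. 0)" for C using zero by (intro ext) (simp add: lin_ext_def outer_def)
  moreover have "f (outer (tvec n x y)) = (\<lambda>_ _. 0)" using zero div_mod_lt by (intro ext) (simp add: lin_ext_def outer_def tvec_def)
  ultimately show ?thesis by simp
qed

lemma commuting_entries:
  assumes "i < m" "i' < m" "j < n" "j' < n"
  shows "lin_ext m (left_map j) (outer x) i i' * lin_ext n (right_map i') (outer y) j j' = lin_ext n (right_map i) (outer y) j j' * lin_ext m (left_map j') (outer x) i i'"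
proof -
  have dm: "(i * n + j) div n = i" "(i * n + j) mod n = j" "(i' * n + j') div n = i'" "(i' * n + j') mod n = j'"
    using assms by simp_all
  note e = entry[OF pair_lt[OF assms(1,3)] pair_lt[OF assms(2,4)], of x y, unfolded dm]
  show ?thesis by (rule trans[OF conjunct1[OF e, symmetric] conjunct2[OF e]])
qed

text \<open>The blocks are compared by evaluating the commutation relation at vectors with unimodular coordinates. The
  phase \<open>u s\<close> runs from the index \<open>(0, 0)\<close> to \<open>s\<close>, within the block 0 along the second index and then along
  the first index.\<close>

theorem product_map_form:
  "\<exists>u TA TB. (\<forall>s<N. cmod (u s) = 1) \<and> (\<forall>A B. \<forall>s<N. \<forall>t<N. f (tmat n A B) s t = u s * cnj (u t) *
    ((if TA then A (t div n) (s div n) else A (s div n) (t div n)) *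
     (if TB then B (t mod n) (s mod n) else B (s mod n) (t mod n))))"
proof -
  have "\<forall>j. \<exists>d T. j < n \<longrightarrow> (\<forall>p<m. cmod (d p) = 1) \<and>
      (\<forall>A. \<forall>p<m. \<forall>q<m. lin_ext m (left_map j) A p q = d p * cnj (d q) * (if T then A q p else A p q))"
    using rank1_map.rank1_map_form[OF rank1_map_left_map m] by blast
  then obtain d T where d: "\<And>j p. j < n \<Longrightarrow> p < m \<Longrightarrow> cmod (d j p) = 1"
    and T: "\<And>j A p q. j < n \<Longrightarrow> p < m \<Longrightarrow> q < m \<Longrightarrow> lin_ext m (left_map j) A p q = d j p * cnj (d j q) * (if T j then A q p else A p q)"
    by metis
  have "\<forall>i. \<exists>d T. i < m \<longrightarrow> (\<forall>p<n. cmod (d p) = 1) \<and>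
      (\<forall>A. \<forall>p<n. \<forall>q<n. lin_ext n (right_map i) A p q = d p * cnj (d q) * (if T then A q p else A p q))"
    using rank1_map.rank1_map_form[OF rank1_map_right_map n] by blast
  then obtain e T' where e: "\<And>i p. i < m \<Longrightarrow> p < n \<Longrightarrow> cmod (e i p) = 1"
    and T': "\<And>i A p q. i < m \<Longrightarrow> p < n \<Longrightarrow> q < n \<Longrightarrow> lin_ext n (right_map i) A p q = e i p * cnj (e i q) * (if T' i then A q p else A p q)"
    by metis
  have m01: "0 < m" "1 < m" and n01: "0 < n" "1 < n" using m n by auto
  have nz: "z \<noteq> 0" if "cmod z = 1" for z :: complex using that by auto
  have sq: "z * cnj z = 1" if "cmod z = 1" for z :: complex using that by (metis complex_norm_square of_real_1 one_power2)
  let ?one = "\<lambda>_::nat. 1::complex"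
  have one: "outer ?one i j = 1" for i j by (simp add: outer_def)
  have id1: "d j i * cnj (d j i') * (e i' j * cnj (e i' j')) = e i j * cnj (e i j') * (d j' i * cnj (d j' i'))"
    if "i < m" "i' < m" "j < n" "j' < n" for i i' j j'
    using commuting_entries[OF that, of ?one ?one] T[OF that(3,1,2)] T[OF that(4,1,2)] T'[OF that(1,3,4)] T'[OF that(2,3,4)]
    by (simp add: one cong: if_cong)
  \<comment> \<open>Testing with a vector that has a non-real relative phase shows that transposition occurs in all
    blocks or in none.\<close>
  have TA: "T j = T j'" if j: "j < n" "j' < n" for j j'
  proof -
    define K where "K = d j 0 * cnj (d j 1) * (e 1 j * cnj (e 1 j'))"
    have K: "K \<noteq> 0" using d[OF j(1)] e[OF m01(2)] nz j m01 by (simp add: K_def)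
    have "K * (if T j then \<i> else - \<i>) = e 0 j * cnj (e 0 j') * (d j' 0 * cnj (d j' 1)) * (if T j' then \<i> else - \<i>)"
      using commuting_entries[OF m01 j, of "two_point 0 1 1 \<i>" ?one] T[OF j(1) m01] T[OF j(2) m01] T'[OF m01(1) j] T'[OF m01(2) j]
      by (cases "T j"; cases "T j'") (simp_all add: one outer_def two_point_def K_def mult_ac cong: if_cong)
    then show ?thesis using id1[OF m01 j, folded K_def] K by (auto split: if_splits)
  qed
  have TB: "T' i = T' i'" if i: "i < m" "i' < m" for i i'
  proof -
    define K where "K = d 0 i * cnj (d 0 i') * (e i' 0 * cnj (e i' 1))"
    have K: "K \<noteq> 0" using d[OF n01(1)] e[OF i(2)] nz i n01 by (simp add: K_def)
    have "K * (if T' i' then \<i> else - \<i>) = e i 0 * cnj (e i 1) * (d 1 i * cnj (d 1 i')) * (if T' i then \<i> else - \<i>)"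
      using commuting_entries[OF i n01, of ?one "two_point 0 1 1 \<i>"] T[OF n01(1) i] T[OF n01(2) i] T'[OF i(1) n01] T'[OF i(2) n01]
      by (cases "T' i"; cases "T' i'") (simp_all add: one outer_def two_point_def K_def mult_ac cong: if_cong)
    then show ?thesis using id1[OF i n01, folded K_def] K by (auto split: if_splits)
  qed
  \<comment> \<open>Only ratios of the coefficients of one block are determined, hence the normalization by the index 0.\<close>
  define u where "u s = d (s mod n) (s div n) * cnj (d (s mod n) 0) * e 0 (s mod n)" for s
  have u: "cmod (u s) = 1" if "s < N" for s
    using d e div_mod_lt[OF that] m01 by (simp add: u_def norm_mult)
  let ?A = "\<lambda>A s t. if T 0 then A (t div n) (s div n) else A (s div n) (t div n)"
  let ?B = "\<lambda>B s t. if T' 0 then B (t mod n) (s mod n) else B (s mod n) (t mod n)"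
  have form_outer: "f (tmat n (outer x) (outer y)) s t = u s * cnj (u t) * (?A (outer x) s t * ?B (outer y) s t)"
    if st: "s < N" "t < N" for x y s t
  proof -
    define i j i' j' where "i = s div n" and "j = s mod n" and "i' = t div n" and "j' = t mod n"
    have lt: "i < m" "j < n" "i' < m" "j' < n" using div_mod_lt[OF st(1)] div_mod_lt[OF st(2)] by (auto simp: i_def j_def i'_def j'_def)
    have "d j i * cnj (d j i') * (e i' j * cnj (e i' j'))
      = d j i * cnj (d j 0) * (d j 0 * cnj (d j i') * (e i' j * cnj (e i' j')))"
      using sq[OF d[OF lt(2) m01(1)]] by (simp add: algebra_simps)
    also have "\<dots> = d j i * cnj (d j 0) * (e 0 j * cnj (e 0 j') * (d j' 0 * cnj (d j' i')))"
      unfolding id1[OF m01(1) lt(3,2,4)] ..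
    also have "\<dots> = u s * cnj (u t)" by (simp add: u_def i_def j_def i'_def j'_def)
    finally have "d j i * cnj (d j i') * (e i' j * cnj (e i' j')) = u s * cnj (u t)" .
    moreover have "f (outer (tvec n x y)) s t = d j i * cnj (d j i') * (e i' j * cnj (e i' j')) * (?A (outer x) s t * ?B (outer y) s t)"
      using entry[OF st, of x y] T[OF lt(2,1,3)] T'[OF lt(3,2,4)] TA[OF lt(2) n01(1)] TB[OF lt(3) m01(1)]
      by (simp add: i_def j_def i'_def j'_def)
    ultimately show ?thesis by (simp add: tmat_outer)
  qed
  have form: "f (tmat n A B) s t = u s * cnj (u t) * (?A A s t * ?B B s t)" if st: "s < N" "t < N" for A B s t
  proof -
    note lt = div_mod_lt[OF st(1)] div_mod_lt[OF st(2)]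
    obtain S :: "((nat \<times> nat) \<times> nat) set" and c x where S0: "finite S"
      "\<forall>p<m. \<forall>q<m. A p q = (\<Sum>r\<in>S. c r * outer (x r) p q)" by (rule span_outer)
    note S = S0(1) S0(2)[rule_format]
    obtain S' :: "((nat \<times> nat) \<times> nat) set" and c' y where S1: "finite S'"
      "\<forall>p<n. \<forall>q<n. B p q = (\<Sum>r\<in>S'. c' r * outer (y r) p q)" by (rule span_outer)
    note S' = S1(1) S1(2)[rule_format]
    have "f (tmat n A B) s t = (\<Sum>r\<in>S. c r * f (tmat n (outer (x r)) B) s t)"
      by (rule lin_ext_tmat_sum_left) (fact S)+
    also have "\<dots> = (\<Sum>r\<in>S. c r * (\<Sum>r'\<in>S'. c' r' * f (tmat n (outer (x r)) (outer (y r'))) s t))"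
      by (intro sum.cong refl arg_cong2[of _ _ _ _ "(*)"] lin_ext_tmat_sum_right) (use S' in auto)
    also have "\<dots> = u s * cnj (u t) * ((\<Sum>r\<in>S. c r * ?A (outer (x r)) s t) * (\<Sum>r'\<in>S'. c' r' * ?B (outer (y r')) s t))"
      unfolding form_outer[OF st] by (simp only: sum_product) (simp only: sum_distrib_left mult_ac)
    also have "(\<Sum>r\<in>S. c r * ?A (outer (x r)) s t) = ?A A s t" using S(2) lt by simp
    also have "(\<Sum>r'\<in>S'. c' r' * ?B (outer (y r')) s t) = ?B B s t" using S'(2) lt by simp
    finally show ?thesis .
  qed
  show ?thesis using u form by (intro exI[of _ u] exI[of _ "T 0"] exI[of _ "T' 0"]) simp
qed

end

definition transp_if :: "bool \<Rightarrow> (nat \<Rightarrow> nat \<Rightarrow> complex) \<Rightarrow> nat \<Rightarrow> nat \<Rightarrow> complex" where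
  "transp_if T A i j = (if T then A j i else A i j)"

text \<open>The matrix \<open>VGV*\<close>, where \<open>V\<close> has the columns \<open>v s\<close>.\<close>

definition conj_by :: "nat \<Rightarrow> (nat \<Rightarrow> nat \<Rightarrow> complex) \<Rightarrow> (nat \<Rightarrow> nat \<Rightarrow> complex) \<Rightarrow> nat \<Rightarrow> nat \<Rightarrow> complex" where
  "conj_by N v G i j = (\<Sum>s<N. \<Sum>t<N. v s i * G s t * cnj (v t j))"

lemma conj_by_inverse:
  assumes "orthonormal N N v" "i < N" "j < N"
  shows "conj_by N v (\<lambda>s t. \<Sum>i<N. \<Sum>j<N. cnj (v s i) * G i j * v t j) i j = G i j"
proof -
  have "conj_by N v (\<lambda>s t. \<Sum>i<N. \<Sum>j<N. cnj (v s i) * G i j * v t j) i j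
    = (\<Sum>s<N. \<Sum>t<N. \<Sum>p<N. \<Sum>q<N. v s i * (cnj (v s p) * G p q * v t q) * cnj (v t j))"
    unfolding conj_by_def by (simp only: sum_distrib_left sum_distrib_right)
  also have "\<dots> = (\<Sum>s<N. \<Sum>p<N. \<Sum>t<N. \<Sum>q<N. v s i * (cnj (v s p) * G p q * v t q) * cnj (v t j))"
    by (intro sum.cong refl sum.swap)
  also have "\<dots> = (\<Sum>s<N. \<Sum>p<N. \<Sum>q<N. \<Sum>t<N. v s i * (cnj (v s p) * G p q * v t q) * cnj (v t j))"
    by (intro sum.cong refl sum.swap)
  also have "\<dots> = (\<Sum>s<N. \<Sum>p<N. \<Sum>q<N. v s i * cnj (v s p) * G p q * (\<Sum>t<N. v t q * cnj (v t j)))"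
    by (simp only: sum_distrib_left mult.assoc)
  also have "\<dots> = (\<Sum>s<N. \<Sum>p<N. \<Sum>q<N. if q = j then v s i * cnj (v s p) * G p q else 0)"
    by (intro sum.cong refl) (simp add: orthonormal_complete[OF assms(1) _ assms(3)])
  also have "\<dots> = (\<Sum>s<N. \<Sum>p<N. v s i * cnj (v s p) * G p j)" using assms(3) by simp
  also have "\<dots> = (\<Sum>p<N. (\<Sum>s<N. v s i * cnj (v s p)) * G p j)"
    by (subst sum.swap) (simp only: sum_distrib_right)
  also have "\<dots> = (\<Sum>p<N. if p = i then G p j else 0)"
    by (intro sum.cong refl) (simp add: orthonormal_complete[OF assms(1,2)])
  also have "\<dots> = G i j" using assms(2) by simp
  finally show ?thesis .
qed

lemma lin_ext_conj:
  "lin_ext N (\<lambda>p q s t. \<Sum>i<N. \<Sum>j<N. cnj (v s i) * D p q i j * v t j) M s t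
    = (\<Sum>i<N. \<Sum>j<N. cnj (v s i) * lin_ext N D M i j * v t j)"
proof -
  have "lin_ext N (\<lambda>p q s t. \<Sum>i<N. \<Sum>j<N. cnj (v s i) * D p q i j * v t j) M s t
    = (\<Sum>p<N. \<Sum>q<N. \<Sum>i<N. \<Sum>j<N. cnj (v s i) * (M p q * D p q i j) * v t j)"
    unfolding lin_ext_def by (simp add: sum_distrib_left mult_ac)
  also have "\<dots> = (\<Sum>p<N. \<Sum>i<N. \<Sum>q<N. \<Sum>j<N. cnj (v s i) * (M p q * D p q i j) * v t j)"
    by (intro sum.cong refl sum.swap)
  also have "\<dots> = (\<Sum>i<N. \<Sum>p<N. \<Sum>q<N. \<Sum>j<N. cnj (v s i) * (M p q * D p q i j) * v t j)"
    by (rule sum.swap)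
  also have "\<dots> = (\<Sum>i<N. \<Sum>p<N. \<Sum>j<N. \<Sum>q<N. cnj (v s i) * (M p q * D p q i j) * v t j)"
    by (intro sum.cong refl sum.swap)
  also have "\<dots> = (\<Sum>i<N. \<Sum>j<N. \<Sum>p<N. \<Sum>q<N. cnj (v s i) * (M p q * D p q i j) * v t j)"
    by (intro sum.cong refl sum.swap)
  finally show ?thesis by (simp only: lin_ext_def sum_distrib_left sum_distrib_right)
qed

text \<open>The images of the standard basis provide the unitary that reduces the claim to the normalized case.\<close>

theorem basis_preserving_form:
  assumes m: "2 \<le> m" and n: "2 \<le> n" and bp: "basis_preserving m n D"
  shows "\<exists>v TA TB. orthonormal (m * n) (m * n) v \<and> (\<forall>A B. \<forall>i<m * n. \<forall>j<m * n.
    lin_ext (m * n) D (tmat n A B) i j = conj_by (m * n) v (tmat n (transp_if TA A) (transp_if TB B)) i j)"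
proof -
  let ?N = "m * n"
  have "product_basis m n (\<lambda>s. basis_vec (s div n)) (\<lambda>s. basis_vec (s mod n))"
    unfolding product_basis_def
  proof (intro conjI allI impI)
    show "orthonormal ?N ?N (\<lambda>s. tvec n (basis_vec (s div n)) (basis_vec (s mod n)))"
      by (rule orthonormal_tvec_left[OF orthonormal_basis_vec orthonormal_basis_vec])
  qed (use orthonormalD[OF orthonormal_basis_vec] div_mod_lt in auto)
  then obtain V where V: "orthonormal ?N ?N V"
    "\<forall>s<?N. \<forall>i<?N. \<forall>j<?N. lin_ext ?N D (outer (tvec n (basis_vec (s div n)) (basis_vec (s mod n)))) i j = outer (V s) i j"
    using bp unfolding basis_preserving_def by blast
  define D2 where "D2 = (\<lambda>p q s t. \<Sum>i<?N. \<Sum>j<?N. cnj (V s i) * D p q i j * V t j)"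
  have D2: "lin_ext ?N D2 M s t = (\<Sum>i<?N. \<Sum>j<?N. cnj (V s i) * lin_ext ?N D M i j * V t j)" for M s t
    unfolding D2_def by (rule lin_ext_conj)
  have D2_outer: "lin_ext ?N D2 M s t = outer (\<lambda>s. ip ?N (V s) w) s t"
    if "\<forall>i<?N. \<forall>j<?N. lin_ext ?N D M i j = outer w i j" for M w s t
  proof -
    have "lin_ext ?N D2 M s t = (\<Sum>i<?N. \<Sum>j<?N. (cnj (V s i) * w i) * (cnj (w j) * V t j))"
      unfolding D2 using that by (intro sum.cong refl) (simp add: outer_def)
    also have "\<dots> = ip ?N (V s) w * ip ?N w (V t)" by (simp add: ip_def sum_product)
    finally show ?thesis by (simp add: outer_def cnj_ip)
  qed
  interpret P: product_map m n D2
  proof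
    show "2 \<le> m" "2 \<le> n" by fact+
    show "basis_preserving m n D2"
      unfolding basis_preserving_def
    proof (intro allI impI)
      fix xs ys assume "product_basis m n xs ys"
      then obtain v where v: "orthonormal ?N ?N v"
        "\<forall>s<?N. \<forall>i<?N. \<forall>j<?N. lin_ext ?N D (outer (tvec n (xs s) (ys s))) i j = outer (v s) i j"
        using bp unfolding basis_preserving_def by blast
      let ?w = "\<lambda>a s. ip ?N (V s) (v a)"
      have "orthonormal ?N ?N ?w"
        unfolding orthonormal_def
      proof (intro allI impI)
        fix a b assume ab: "a < ?N" "b < ?N"
        have "ip ?N (?w a) (?w b) = ip ?N (v a) (v b)"
          unfolding parseval_ip[OF V(1), of "v a" "v b"] by (simp add: ip_def[of _ "?w a"] cnj_ip)
        then show "ip ?N (?w a) (?w b) = of_bool (a = b)" using orthonormalD[OF v(1) ab] by simp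
      qed
      moreover have "\<forall>s<?N. \<forall>i<?N. \<forall>j<?N. lin_ext ?N D2 (outer (tvec n (xs s) (ys s))) i j = outer (?w s) i j"
        using D2_outer v(2) by simp
      ultimately show "\<exists>v. orthonormal ?N ?N v \<and>
          (\<forall>s<?N. \<forall>i<?N. \<forall>j<?N. lin_ext ?N D2 (outer (tvec n (xs s) (ys s))) i j = outer (v s) i j)" by blast
    qed
    fix s i j assume s: "s < ?N" and ij: "i < ?N" "j < ?N"
    have e: "tvec n (basis_vec (s div n)) (basis_vec (s mod n)) = basis_vec s" using tvec_basis_vec[of "s mod n" n "s div n"] n by simp
    have "lin_ext ?N D2 (outer (basis_vec s)) i j = outer (\<lambda>l. ip ?N (V l) (V s)) i j"
      using D2_outer[of "outer (basis_vec s)" "V s"] V(2)[rule_format, OF s] unfolding e by blast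
    then show "lin_ext ?N D2 (outer (basis_vec s)) i j = of_bool (i = s \<and> j = s)"
      using orthonormalD[OF V(1) ij(1) s] orthonormalD[OF V(1) ij(2) s] by (simp add: outer_def)
  qed
  obtain u TA TB where u: "\<forall>s<?N. cmod (u s) = 1" and form: "\<forall>A B. \<forall>s<?N. \<forall>t<?N. lin_ext ?N D2 (tmat n A B) s t = u s * cnj (u t) *
    ((if TA then A (t div n) (s div n) else A (s div n) (t div n)) *
     (if TB then B (t mod n) (s mod n) else B (s mod n) (t mod n)))"
    using P.product_map_form by blast
  define v where "v s = (\<lambda>i. u s * V s i)" for s
  have v: "orthonormal ?N ?N v"
    unfolding orthonormal_def
  proof (intro allI impI)
    fix a b assume ab: "a < ?N" "b < ?N"
    have "cnj (u a) * u a = 1" using u ab(1) by (metis complex_norm_square mult.commute of_real_1 one_power2)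
    then show "ip ?N (v a) (v b) = of_bool (a = b)"
      unfolding v_def ip_scale_left ip_scale_right orthonormalD[OF V(1) ab] by auto
  qed
  have "lin_ext ?N D (tmat n A B) i j = conj_by ?N v (tmat n (transp_if TA A) (transp_if TB B)) i j"
    if ij: "i < ?N" "j < ?N" for A B i j
  proof -
    have "lin_ext ?N D (tmat n A B) i j = conj_by ?N V (lin_ext ?N D2 (tmat n A B)) i j"
      unfolding D2[abs_def] by (rule conj_by_inverse[OF V(1) ij, symmetric])
    also have "\<dots> = conj_by ?N v (tmat n (transp_if TA A) (transp_if TB B)) i j"
      unfolding conj_by_def using form
      by (intro sum.cong refl) (simp add: v_def tmat_def transp_if_def)
    finally show ?thesis .
  qed
  then show ?thesis using v by blast
qed

lemma sum_sandwich: "(\<Sum>i\<in>S. \<Sum>j\<in>T. a i * g * b j) = (\<Sum>i\<in>S. a i) * g * (\<Sum>j\<in>T. b j :: complex)"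
  by (simp only: sum_distrib_left[symmetric] sum_distrib_right[symmetric])

section \<open>Symmetries of higher numerical ranges\<close>

lemma quad_conj_by: "quad N (conj_by N v G) x = quad N G (\<lambda>s. ip N (v s) x)"
proof -
  have "quad N (conj_by N v G) x
    = (\<Sum>i<N. \<Sum>j<N. \<Sum>s<N. \<Sum>t<N. (cnj (x i) * v s i) * G s t * (cnj (v t j) * x j))"
    unfolding quad_def conj_by_def by (simp add: sum_distrib_left sum_distrib_right mult_ac)
  also have "\<dots> = (\<Sum>i<N. \<Sum>s<N. \<Sum>j<N. \<Sum>t<N. (cnj (x i) * v s i) * G s t * (cnj (v t j) * x j))"
    by (intro sum.cong refl sum.swap)
  also have "\<dots> = (\<Sum>s<N. \<Sum>i<N. \<Sum>j<N. \<Sum>t<N. (cnj (x i) * v s i) * G s t * (cnj (v t j) * x j))"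
    by (rule sum.swap)
  also have "\<dots> = (\<Sum>s<N. \<Sum>i<N. \<Sum>t<N. \<Sum>j<N. (cnj (x i) * v s i) * G s t * (cnj (v t j) * x j))"
    by (intro sum.cong refl sum.swap)
  also have "\<dots> = (\<Sum>s<N. \<Sum>t<N. \<Sum>i<N. \<Sum>j<N. (cnj (x i) * v s i) * G s t * (cnj (v t j) * x j))"
    by (intro sum.cong refl sum.swap)
  also have "\<dots> = (\<Sum>s<N. \<Sum>t<N. (\<Sum>i<N. cnj (x i) * v s i) * G s t * (\<Sum>j<N. cnj (v t j) * x j))"
    by (simp only: sum_sandwich)
  finally show ?thesis unfolding quad_def by (simp only: cnj_ip) (simp only: ip_def)
qed

lemma trace_range_image: "trace_range N k H = ctrace N k H ` {u. orthonormal N k u}"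
  by (auto simp: trace_range_def)

lemma trace_range_conj_by:
  assumes v: "orthonormal N N v"
  shows "trace_range N k (conj_by N v G) = trace_range N k G"
proof (intro equalityI subsetI)
  fix z assume "z \<in> trace_range N k (conj_by N v G)"
  then obtain u where u: "orthonormal N k u" "z = ctrace N k (conj_by N v G) u" by (auto simp: trace_range_def)
  let ?w = "\<lambda>a s. ip N (v s) (u a)"
  have "orthonormal N k ?w"
    unfolding orthonormal_def
  proof (intro allI impI)
    fix a b assume ab: "a < k" "b < k"
    have "ip N (?w a) (?w b) = ip N (u a) (u b)"
      unfolding parseval_ip[OF v, of "u a" "u b"] by (simp add: ip_def[of _ "?w a"] cnj_ip)
    then show "ip N (?w a) (?w b) = of_bool (a = b)" using orthonormalD[OF u(1) ab] by simp
  qed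
  moreover have "z = ctrace N k G ?w" unfolding u(2) ctrace_def quad_conj_by ..
  ultimately show "z \<in> trace_range N k G" by (auto simp: trace_range_def)
next
  fix z assume "z \<in> trace_range N k G"
  then obtain w where w: "orthonormal N k w" "z = ctrace N k G w" by (auto simp: trace_range_def)
  define u where "u a = (\<lambda>i. \<Sum>s<N. w a s * v s i)" for a
  have vu: "ip N (v s) (u a) = w a s" if s: "s < N" for s a
  proof -
    have "ip N (v s) (u a) = (\<Sum>t<N. if t = s then w a t else 0)"
      unfolding u_def ip_sum_right by (intro sum.cong refl) (use orthonormalD[OF v s] in auto)
    then show ?thesis using s by simp
  qed
  have "orthonormal N k u"
    unfolding orthonormal_def
  proof (intro allI impI)
    fix a b assume ab: "a < k" "b < k"
    have "ip N (u a) (u b) = (\<Sum>s<N. cnj (w a s) * ip N (v s) (u b))" unfolding u_def[of a] ip_sum_left ..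
    also have "\<dots> = ip N (w a) (w b)" unfolding ip_def[of N "w a"] using vu by simp
    finally show "ip N (u a) (u b) = of_bool (a = b)" using orthonormalD[OF w(1) ab] by simp
  qed
  moreover have "ctrace N k (conj_by N v G) u = z"
    unfolding w(2) ctrace_def quad_conj_by by (intro sum.cong refl) (simp add: quad_def vu)
  ultimately show "z \<in> trace_range N k (conj_by N v G)" by (auto simp: trace_range_def)
qed

lemma trace_range_cong: "(\<And>i j. i < N \<Longrightarrow> j < N \<Longrightarrow> G i j = H i j) \<Longrightarrow> trace_range N k G = trace_range N k H"
  unfolding trace_range_def by (simp add: ctrace_cong[of N G H] cong: ctrace_cong)

lemma trace_range_transpose: "trace_range N k (\<lambda>i j. G j i) = trace_range N k G"
proof -
  have sub: "trace_range N k G \<subseteq> trace_range N k (\<lambda>i j. G j i)" for G :: "nat \<Rightarrow> nat \<Rightarrow> complex"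
  proof
    fix z assume "z \<in> trace_range N k G"
    then obtain u where u: "orthonormal N k u" "z = ctrace N k G u" by (auto simp: trace_range_def)
    have q: "quad N (\<lambda>i j. G j i) (\<lambda>i. cnj (x i)) = quad N G x" for x
      unfolding quad_def by (subst sum.swap) (simp add: mult_ac)
    have "ip N (\<lambda>i. cnj (x i)) (\<lambda>i. cnj (y i)) = cnj (ip N x y)" for x y by (simp add: ip_def)
    then have "orthonormal N k (\<lambda>a i. cnj (u a i))" using u(1) by (simp add: orthonormal_def)
    moreover have "z = ctrace N k (\<lambda>i j. G j i) (\<lambda>a i. cnj (u a i))" unfolding u(2) ctrace_def q ..
    ultimately show "z \<in> trace_range N k (\<lambda>i j. G j i)" by (auto simp: trace_range_def)
  qed
  show ?thesis using sub[of G] sub[of "\<lambda>i j. G j i"] by blast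
qed

text \<open>Complements of families of length \<open>k\<close> are the families of length \<open>N - k\<close>.\<close>

lemma trace_range_complement:
  assumes "k \<le> N"
  shows "trace_range N (N - k) G = (\<lambda>z. (\<Sum>i<N. G i i) - z) ` trace_range N k G"
proof (intro equalityI subsetI)
  fix z assume "z \<in> trace_range N (N - k) G"
  then obtain u where u: "orthonormal N (N - k) u" "z = ctrace N (N - k) G u" by (auto simp: trace_range_def)
  obtain u' where u': "orthonormal N (N - (N - k)) u'"
    "\<And>H. ctrace N (N - (N - k)) H u' = (\<Sum>i<N. H i i) - ctrace N (N - k) H u"
    using orthonormal_complement[OF u(1)] by blast
  have "N - (N - k) = k" using assms by simp
  then have o: "orthonormal N k u'" and c: "ctrace N k G u' = (\<Sum>i<N. G i i) - z" using u' u(2) by simp_all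
  have "ctrace N k G u' \<in> trace_range N k G" unfolding trace_range_def using o by blast
  moreover have "z = (\<Sum>i<N. G i i) - ctrace N k G u'" using c by simp
  ultimately
  show "z \<in> (\<lambda>z. (\<Sum>i<N. G i i) - z) ` trace_range N k G" by blast
next
  fix z assume "z \<in> (\<lambda>z. (\<Sum>i<N. G i i) - z) ` trace_range N k G"
  then obtain u where u: "orthonormal N k u" "z = (\<Sum>i<N. G i i) - ctrace N k G u" by (auto simp: trace_range_def)
  obtain u' where u': "orthonormal N (N - k) u'" "\<And>H. ctrace N (N - k) H u' = (\<Sum>i<N. H i i) - ctrace N k H u"
    using orthonormal_complement[OF u(1)] by blast
  have "z = ctrace N (N - k) G u'" using u'(2)[of G] u(2) by simp
  then show "z \<in> trace_range N (N - k) G" using u'(1) unfolding trace_range_def by blast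
qed

lemma trace_range_reflect:
  assumes "N = 2 * k" "0 < k"
  shows "trace_range N k (\<lambda>i j. (\<Sum>l<N. G l l) / of_nat k * of_bool (i = j) - G i j) = trace_range N k G"
proof -
  have c: "ctrace N k (\<lambda>i j. (\<Sum>l<N. G l l) / of_nat k * of_bool (i = j) - G i j) u = (\<Sum>l<N. G l l) - ctrace N k G u"
    if "orthonormal N k u" for u
  proof -
    have "ctrace N k (\<lambda>i j. (\<Sum>l<N. G l l) / of_nat k * of_bool (i = j) + (- 1) * G i j) u = (\<Sum>l<N. G l l) - ctrace N k G u"
      unfolding ctrace_add ctrace_scale ctrace_identity[OF that] using assms by simp
    then show ?thesis by simp
  qed
  have "trace_range N k (\<lambda>i j. (\<Sum>l<N. G l l) / of_nat k * of_bool (i = j) - G i j) = (\<lambda>z. (\<Sum>l<N. G l l) - z) ` trace_range N k G"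
    unfolding trace_range_image image_image using c by (intro image_cong) auto
  also have "\<dots> = trace_range N (N - k) G" using trace_range_complement[of k N G] assms by simp
  finally show ?thesis using assms by simp
qed

section \<open>Partial transposition changes higher numerical ranges\<close>

text \<open>A weighted shift for which the tensor products with itself and with its transpose have Hermitian parts with
  different spectra: for \<open>m = n = 3\<close> their eigenvalues are, up to the factor \<open>1/2\<close>, 0 three times and
  \<open>\<plusminus>\<surd>17, \<plusminus>2, \<plusminus>2\<close>, respectively \<open>\<plusminus>4, \<plusminus>\<surd>8, \<plusminus>1\<close>.\<close>

definition shift :: "nat \<Rightarrow> nat \<Rightarrow> complex" where
  "shift i j = (if i = 0 \<and> j = 1 then 2 else if i = 1 \<and> j = 2 then 1 else 0)"

lemma sum_shift:
  assumes "3 \<le> m"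
  shows "(\<Sum>i<m. \<Sum>j<m. shift i j * g i j) = 2 * g 0 1 + g 1 2"
proof -
  have "(\<Sum>i<m. \<Sum>j<m. shift i j * g i j) = (\<Sum>i<m. \<Sum>j<m. (if j = 1 then (if i = 0 then 2 * g 0 1 else 0) else 0)
      + (if j = 2 then (if i = 1 then g 1 2 else 0) else 0))"
    by (intro sum.cong refl) (auto simp: shift_def)
  then show ?thesis using assms by (simp add: sum.distrib)
qed

lemma quad_tmat:
  "quad (m * n) (tmat n A B) x
    = (\<Sum>i<m. \<Sum>i'<m. A i i' * (\<Sum>j<n. \<Sum>j'<n. B j j' * (cnj (x (i * n + j)) * x (i' * n + j'))))"
proof -
  have "quad (m * n) (tmat n A B) x = (\<Sum>s<m * n. (\<lambda>i j. \<Sum>t<m * n.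
      (\<lambda>i' j'. A i i' * (B j j' * (cnj (x (i * n + j)) * x (i' * n + j')))) (t div n) (t mod n)) (s div n) (s mod n))"
    unfolding quad_def tmat_def by (intro sum.cong refl) (simp add: mult_ac)
  also have "\<dots> = (\<Sum>i<m. \<Sum>j<n. \<Sum>i'<m. \<Sum>j'<n. A i i' * (B j j' * (cnj (x (i * n + j)) * x (i' * n + j'))))"
    by (subst sum_div_mod, intro sum.cong refl sum_div_mod[where f = "\<lambda>i' j'. A _ i' * (B _ j' * (cnj (x (_ * n + _)) * x (i' * n + j')))"])
  also have "\<dots> = (\<Sum>i<m. \<Sum>i'<m. \<Sum>j<n. \<Sum>j'<n. A i i' * (B j j' * (cnj (x (i * n + j)) * x (i' * n + j'))))"
    by (intro sum.cong refl sum.swap)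
  finally show ?thesis by (simp only: sum_distrib_left)
qed

locale large_factors =
  fixes m n :: nat
  assumes m: "3 \<le> m" and n: "3 \<le> n"
begin

abbreviation "N \<equiv> m * n"

definition "shift_tensor = tmat n shift shift"
definition "shift_tensor_pt = tmat n shift (\<lambda>i j. shift j i)"

lemma index_lt: "p \<le> 2 * n + 2 \<Longrightarrow> p < N"
proof -
  assume "p \<le> 2 * n + 2"
  then have "p < 3 * n" using n by simp
  also have "\<dots> \<le> N" using m by (intro mult_le_mono1)
  finally show ?thesis .
qed

lemma index_subset: "F \<subseteq> {..2 * n + 2} \<Longrightarrow> F \<subseteq> {..<N}"
  using index_lt by (meson atMost_iff lessThan_iff subsetD subsetI)

lemma quad_shift_tensor: "quad N shift_tensor x = 4 * (cnj (x 0) * x (n + 1)) + 2 * (cnj (x 1) * x (n + 2))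
    + 2 * (cnj (x n) * x (2 * n + 1)) + cnj (x (n + 1)) * x (2 * n + 2)"
  unfolding shift_tensor_def quad_tmat sum_shift[OF m] sum_shift[OF n] by (simp add: algebra_simps numeral_2_eq_2)

lemma quad_shift_tensor_pt: "quad N shift_tensor_pt x = 4 * (cnj (x 1) * x n) + 2 * (cnj (x 2) * x (n + 1))
    + 2 * (cnj (x (n + 1)) * x (2 * n)) + cnj (x (n + 2)) * x (2 * n + 1)"
proof -
  have T: "(\<Sum>j<n. \<Sum>j'<n. shift j' j * g j j') = 2 * g 1 0 + g 2 1" for g
    using sum_shift[OF n, of "\<lambda>j' j. g j j'"] by (subst sum.swap) simp
  show ?thesis unfolding shift_tensor_pt_def quad_tmat sum_shift[OF m] T by (simp add: algebra_simps numeral_2_eq_2)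
qed

lemma re_cs: "2 * Re (cnj a * b) \<le> (cmod a)\<^sup>2 + (cmod b)\<^sup>2"
proof -
  have "0 \<le> (Re a - Re b)\<^sup>2 + (Im a - Im b)\<^sup>2" by simp
  then show ?thesis unfolding cmod_power2 by (simp add: power2_eq_square algebra_simps)
qed

lemma partial_norm_le:
  assumes "finite F" "F \<subseteq> {..<N}"
  shows "(\<Sum>p\<in>F. (cmod (x p))\<^sup>2) \<le> Re (ip N x x)"
proof -
  have "(\<Sum>p\<in>F. (cmod (x p))\<^sup>2) \<le> (\<Sum>p<N. (cmod (x p))\<^sup>2)" using assms by (intro sum_mono2) auto
  then show ?thesis by (simp add: ip_self)
qed

lemma shift_tensor_pt_le_2:
  shows "Re (quad N shift_tensor_pt x) \<le> 2 * Re (ip N x x)"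
proof -
  let ?F = "{1, n, 2, n + 1, 2 * n, n + 2, 2 * n + 1}"
  have "(\<Sum>p\<in>?F. (cmod (x p))\<^sup>2) \<le> Re (ip N x x)"
    by (rule partial_norm_le) (simp, rule index_subset, auto)
  moreover have "(\<Sum>p\<in>?F. (cmod (x p))\<^sup>2) = (cmod (x 1))\<^sup>2 + (cmod (x n))\<^sup>2 + (cmod (x 2))\<^sup>2 + (cmod (x (n + 1)))\<^sup>2
      + (cmod (x (2 * n)))\<^sup>2 + (cmod (x (n + 2)))\<^sup>2 + (cmod (x (2 * n + 1)))\<^sup>2"
    using n by simp
  moreover have "0 \<le> (cmod (x p))\<^sup>2" for p by simp
  note this[of 2] this[of "2 * n"] this[of "n + 2"] this[of "2 * n + 1"]
  moreover note re_cs[of "x 1" "x n"] re_cs[of "x 2" "x (n + 1)"] re_cs[of "x (n + 1)" "x (2 * n)"] re_cs[of "x (n + 2)" "x (2 * n + 1)"]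
  moreover have "Re (quad N shift_tensor_pt x) = 4 * Re (cnj (x 1) * x n) + 2 * Re (cnj (x 2) * x (n + 1))
      + 2 * Re (cnj (x (n + 1)) * x (2 * n)) + Re (cnj (x (n + 2)) * x (2 * n + 1))"
    unfolding quad_shift_tensor_pt by simp
  ultimately show ?thesis by linarith
qed

definition three_point :: "real \<Rightarrow> nat \<Rightarrow> real \<Rightarrow> nat \<Rightarrow> real \<Rightarrow> nat \<Rightarrow> nat \<Rightarrow> complex" where
  "three_point a p b q c r i = of_real a * basis_vec p i + of_real b * basis_vec q i + of_real c * basis_vec r i"

lemma ip_three_point:
  assumes "p \<le> 2 * n + 2" "q \<le> 2 * n + 2" "r \<le> 2 * n + 2"
  shows "ip N (three_point a p b q c r) x = of_real a * x p + of_real b * x q + of_real c * x r"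
proof -
  have "ip N (three_point a p b q c r) x = (\<Sum>i<N. (if i = p then of_real a * x i else 0)
      + (if i = q then of_real b * x i else 0) + (if i = r then of_real c * x i else 0))"
    unfolding ip_def three_point_def basis_vec_def by (intro sum.cong refl) (auto simp: algebra_simps)
  then show ?thesis using assms[THEN index_lt] by (simp add: sum.distrib)
qed

text \<open>The left hand side is the form of a \<open>3 \<times> 3\<close> matrix whose only eigenvalue above 1 is \<open>\<surd>17/2\<close>. The vector
  \<open>(3/4, 3/4, 1/4)\<close> is a rational substitute for a multiple of its eigenvector.\<close>

lemma chain_certificate:
  "4 * Re (cnj a * b) + Re (cnj b * c) \<le> (cmod a)\<^sup>2 + (cmod b)\<^sup>2 + (cmod c)\<^sup>2
    + (cmod (of_real (3/4) * a + of_real (3/4) * b + of_real (1/4) * c))\<^sup>2"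
proof -
  have "0 \<le> 23 * (cmod (a - b))\<^sup>2 + 2 * (cmod (a + of_real (3/2) * c))\<^sup>2 + 2 * (cmod (b - of_real (5/2) * c))\<^sup>2" by simp
  also have "\<dots> = 16 * ((cmod a)\<^sup>2 + (cmod b)\<^sup>2 + (cmod c)\<^sup>2
    + (cmod (of_real (3/4) * a + of_real (3/4) * b + of_real (1/4) * c))\<^sup>2 - (4 * Re (cnj a * b) + Re (cnj b * c)))"
    unfolding cmod_power2 by (simp add: power2_eq_square field_simps)
  finally show ?thesis by simp
qed

lemma shift_tensor_le:
  "Re (quad N shift_tensor x) \<le> Re (ip N x x) + (cmod (ip N (three_point (3/4) 0 (3/4) (n + 1) (1/4) (2 * n + 2)) x))\<^sup>2"
proof -
  let ?F = "{0, n + 1, 2 * n + 2, 1, n + 2, n, 2 * n + 1}"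
  have "(\<Sum>p\<in>?F. (cmod (x p))\<^sup>2) \<le> Re (ip N x x)"
    by (rule partial_norm_le) (simp, rule index_subset, auto)
  moreover have "(\<Sum>p\<in>?F. (cmod (x p))\<^sup>2) = (cmod (x 0))\<^sup>2 + (cmod (x (n + 1)))\<^sup>2 + (cmod (x (2 * n + 2)))\<^sup>2
      + (cmod (x 1))\<^sup>2 + (cmod (x (n + 2)))\<^sup>2 + (cmod (x n))\<^sup>2 + (cmod (x (2 * n + 1)))\<^sup>2"
    using n by simp
  moreover note re_cs[of "x 1" "x (n + 2)"] re_cs[of "x n" "x (2 * n + 1)"]
    chain_certificate[of "x 0" "x (n + 1)" "x (2 * n + 2)"]
  moreover have "Re (quad N shift_tensor x) = 4 * Re (cnj (x 0) * x (n + 1)) + 2 * Re (cnj (x 1) * x (n + 2))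
    + 2 * Re (cnj (x n) * x (2 * n + 1)) + Re (cnj (x (n + 1)) * x (2 * n + 2))"
    unfolding quad_shift_tensor by simp
  moreover have e: "ip N (three_point (3/4) 0 (3/4) (n + 1) (1/4) (2 * n + 2)) x
    = of_real (3/4) * x 0 + of_real (3/4) * x (n + 1) + of_real (1/4) * x (2 * n + 2)"
    by (rule ip_three_point) auto
  ultimately show ?thesis unfolding e by linarith
qed

lemma pair_certificate: "4 * Re (cnj a * b) \<le> (cmod (a + b))\<^sup>2"
proof -
  have "0 \<le> (cmod (a - b))\<^sup>2" by simp
  then show ?thesis unfolding cmod_power2 by (simp add: power2_eq_square algebra_simps)
qed

text \<open>The form on the left has the eigenvalues \<open>\<plusminus>\<surd>2\<close> and 0. For weights \<open>\<alpha>, \<beta>, \<alpha>\<close> with \<open>\<alpha>\<beta> = 1/2\<close> the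
  difference of the two sides is a square; \<open>(2/3, 3/4, 2/3)\<close> is rational with small norm.\<close>

lemma path_certificate:
  "2 * Re (cnj a * b) + 2 * Re (cnj b * c) \<le> (cmod (of_real (2/3) * a + of_real (3/4) * b + of_real (2/3) * c))\<^sup>2"
proof -
  have "0 \<le> (cmod (of_real (2/3) * a - of_real (3/4) * b + of_real (2/3) * c))\<^sup>2" by simp
  also have "\<dots> = (cmod (of_real (2/3) * a + of_real (3/4) * b + of_real (2/3) * c))\<^sup>2
    - (2 * Re (cnj a * b) + 2 * Re (cnj b * c))"
    unfolding cmod_power2 by (simp add: power2_eq_square field_simps)
  finally show ?thesis by simp
qed

lemma shift_tensor_pt_le:
  "Re (quad N shift_tensor_pt x) \<le> (cmod (ip N (three_point 1 1 1 n 0 0) x))\<^sup>2 + (cmod (ip N (three_point (2/3) 2 (3/4) (n + 1) (2/3) (2 * n)) x))\<^sup>2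
    + (cmod (ip N (three_point (1/2) (n + 2) (1/2) (2 * n + 1) 0 0) x))\<^sup>2"
proof -
  have e: "ip N (three_point 1 1 1 n 0 0) x = x 1 + x n"
    "ip N (three_point (2/3) 2 (3/4) (n + 1) (2/3) (2 * n)) x = of_real (2/3) * x 2 + of_real (3/4) * x (n + 1) + of_real (2/3) * x (2 * n)"
    "ip N (three_point (1/2) (n + 2) (1/2) (2 * n + 1) 0 0) x = of_real (1/2) * (x (n + 2) + x (2 * n + 1))"
    by (simp_all add: ip_three_point algebra_simps)
  have "(cmod (of_real (1/2) * (x (n + 2) + x (2 * n + 1))))\<^sup>2 = (cmod (x (n + 2) + x (2 * n + 1)))\<^sup>2 / 4"
    by (simp add: norm_mult power_divide)
  moreover note pair_certificate[of "x 1" "x n"] path_certificate[of "x 2" "x (n + 1)" "x (2 * n)"]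
    pair_certificate[of "x (n + 2)" "x (2 * n + 1)"]
  moreover have "Re (quad N shift_tensor_pt x) = 4 * Re (cnj (x 1) * x n) + 2 * Re (cnj (x 2) * x (n + 1))
      + 2 * Re (cnj (x (n + 1)) * x (2 * n)) + Re (cnj (x (n + 2)) * x (2 * n + 1))"
    unfolding quad_shift_tensor_pt by simp
  ultimately show ?thesis unfolding e by linarith
qed

lemma norm_three_point:
  assumes "p \<le> 2 * n + 2" "q \<le> 2 * n + 2" "r \<le> 2 * n + 2" "p \<noteq> q" "p \<noteq> r \<or> c = 0" "q \<noteq> r \<or> c = 0"
  shows "ip N (three_point a p b q c r) (three_point a p b q c r) = of_real (a\<^sup>2 + b\<^sup>2 + c\<^sup>2)"
  using assms(4-) unfolding ip_three_point[OF assms(1-3)]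
  by (auto simp: three_point_def basis_vec_def power2_eq_square)

lemma bessel_ctrace:
  assumes "orthonormal N k u"
  shows "(\<Sum>c<k. (cmod (ip N w (u c)))\<^sup>2) \<le> Re (ip N w w)"
  using bessel[OF assms, of w] by (simp add: cmod_ip_commute[of N w])

text \<open>For the three ranges \<open>k = 1\<close>, \<open>k = 2\<close> and \<open>3 \<le> k \<le> N - 3\<close> an explicit family exceeds an upper bound for the other
  tensor product. The exact maxima would be \<open>\<surd>17/2 > 2\<close>, \<open>2 + \<surd>2 > (\<surd>17 + 2)/2\<close> and
  \<open>(\<surd>17 + 4)/2 > (5 + \<surd>8)/2\<close>; the families and bounds approximate them by rational numbers.\<close>

theorem partial_transpose_distinguished_small:
  assumes k: "0 < k" "k \<le> N - 3" and eq: "trace_range N k shift_tensor_pt = trace_range N k shift_tensor"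
  shows False
proof -
  have Re_ctrace: "Re (ctrace N k G u) = (\<Sum>c<k. Re (quad N G (u c)))" for G u k by (simp add: ctrace_def)
  consider "k = 1" | "k = 2" | "3 \<le> k" using k by linarith
  then show False
  proof cases
    case 1
    let ?x = "three_point (12/17) 0 (12/17) (n + 1) (1/17) (2 * n + 2)"
    have "ip N ?x ?x = 1" using n by (subst norm_three_point) (auto simp: power2_eq_square)
    then have o: "orthonormal N k (\<lambda>_. ?x)" using 1 orthonormal_single by simp
    obtain u' where u': "orthonormal N k u'" "ctrace N k shift_tensor_pt u' = ctrace N k shift_tensor (\<lambda>_. ?x)" by (rule trace_range_transfer[OF eq[symmetric] o])
    have "Re (ctrace N k shift_tensor (\<lambda>_. ?x)) = 588 / 289"
      using n unfolding 1 by (simp add: ctrace_def quad_shift_tensor three_point_def basis_vec_def)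
    moreover have "Re (ctrace N k shift_tensor_pt u') \<le> 2"
      using shift_tensor_pt_le_2[of "u' 0"] orthonormalD[OF u'(1), of 0 0] 1 by (simp add: ctrace_def)
    ultimately show False using u'(2) by simp
  next
    case 2
    let ?x = "three_point (20/29) 1 (21/29) n 0 0" and ?y = "three_point (2/3) 2 (2/3) (n + 1) (1/3) (2 * n)"
    let ?u = "\<lambda>c::nat. if c = 0 then ?x else ?y"
    have x: "ip N ?x ?x = 1" using n by (subst norm_three_point) (auto simp: power2_eq_square)
    have y: "ip N ?y ?y = 1" using n by (subst norm_three_point) (auto simp: power2_eq_square)
    have xy: "ip N ?x ?y = 0" using n by (simp add: ip_three_point) (simp add: three_point_def basis_vec_def)
    then have yx: "ip N ?y ?x = 0" using cnj_ip[of N ?x ?y] by simp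
    have o: "orthonormal N k ?u" unfolding orthonormal_def 2 using x y xy yx by auto
    obtain u' where u': "orthonormal N k u'" "ctrace N k shift_tensor u' = ctrace N k shift_tensor_pt ?u" by (rule trace_range_transfer[OF eq o])
    have "Re (ctrace N k shift_tensor_pt ?u) = 1680 / 841 + 4 / 3"
      using n unfolding 2 by (simp add: ctrace_def numeral_2_eq_2 quad_shift_tensor_pt three_point_def basis_vec_def)
    moreover have "Re (ctrace N k shift_tensor u') \<le> (\<Sum>c<k. Re (ip N (u' c) (u' c)) + (cmod (ip N (three_point (3/4) 0 (3/4) (n + 1) (1/4) (2 * n + 2)) (u' c)))\<^sup>2)"
      unfolding Re_ctrace by (intro sum_mono shift_tensor_le)
    moreover have "(\<Sum>c<k. Re (ip N (u' c) (u' c))) = 2" using orthonormalD[OF u'(1)] 2 by simp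
    moreover have "(\<Sum>c<k. (cmod (ip N (three_point (3/4) 0 (3/4) (n + 1) (1/4) (2 * n + 2)) (u' c)))\<^sup>2) \<le> 19 / 16"
      using bessel_ctrace[OF u'(1), of "three_point (3/4) 0 (3/4) (n + 1) (1/4) (2 * n + 2)"] n
      by (subst (asm) norm_three_point) (auto simp: power2_eq_square)
    ultimately show False using u'(2) by (simp add: sum.distrib)
  next
    case 3
    \<comment> \<open>Three disjoint pairs of coordinates are rotated; the remaining members are standard basis vectors at which
      the form vanishes, chosen away from the second indices of the pairs.\<close>
    define Z where "Z p = (if p = 0 then three_point (20/29) 0 (21/29) (n + 1) 0 0 else if p = 1 then three_point (20/29) 1 (21/29) (n + 2) 0 0
      else if p = n then three_point (20/29) n (21/29) (2 * n + 1) 0 0 else basis_vec p)" for p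
    define F where "F = {..<N} - {n + 1, n + 2, 2 * n + 1, 0, 1, n}"
    have card_F: "card F = N - 6"
    proof -
      have "{n + 1, n + 2, 2 * n + 1, 0, 1, n} \<subseteq> {..<N}" by (rule index_subset) auto
      moreover have "card {n + 1, n + 2, 2 * n + 1, 0, 1, n} = 6" using n by simp
      ultimately show ?thesis unfolding F_def by (subst card_Diff_subset) auto
    qed
    obtain S where S: "S \<subseteq> F" "card S = k - 3" "finite S"
      using obtain_subset_with_card_n[of "k - 3" F] card_F k by (metis (no_types) diff_diff_left diff_le_mono numeral_Bit0 add_numeral_left)
    define S' where "S' = {0, 1, n} \<union> S"
    have dis: "{0, 1, n} \<inter> S = {}" using S(1) by (auto simp: F_def)
    have card_S': "card S' = k" unfolding S'_def using 3 S n dis by (subst card_Un_disjoint) auto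
    have fin: "finite S'" using S by (simp add: S'_def)
    obtain \<pi> where \<pi>: "bij_betw \<pi> {..<k} S'"
      using ex_bij_betw_nat_finite[OF fin] card_S' by (auto simp: lessThan_atLeast0)
    have Z: "ip N (Z p) (Z q) = of_bool (p = q)" if pq: "p \<in> S'" "q \<in> S'" for p q
    proof -
      have special: "ip N (Z a) (Z b) = of_bool (a = b)" if a: "a \<in> {0, 1, n}" and b: "b \<in> S'" for a b
      proof -
        have b': "b \<in> {0, 1, n} \<or> b \<notin> {n + 1, n + 2, 2 * n + 1, 0, 1, n}" using b S(1) by (auto simp: S'_def F_def)
        from a consider "a = 0" | "a = 1" | "a = n" by auto
        then show ?thesis
        proof cases
          case 1
          then have "ip N (Z a) (Z b) = of_real (20/29) * Z b 0 + of_real (21/29) * Z b (n + 1)" by (simp add: Z_def ip_three_point)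
          then show ?thesis using b' n 1 by (auto simp: Z_def three_point_def basis_vec_def)
        next
          case 2
          then have "ip N (Z a) (Z b) = of_real (20/29) * Z b 1 + of_real (21/29) * Z b (n + 2)" by (simp add: Z_def ip_three_point)
          then show ?thesis using b' n 2 by (auto simp: Z_def three_point_def basis_vec_def)
        next
          case 3
          then have "ip N (Z a) (Z b) = of_real (20/29) * Z b n + of_real (21/29) * Z b (2 * n + 1)" using n by (simp add: Z_def ip_three_point)
          then show ?thesis using b' n 3 by (auto simp: Z_def three_point_def basis_vec_def)
        qed
      qed
      consider "p \<in> {0, 1, n}" | "q \<in> {0, 1, n}" | "p \<in> S" "q \<in> S" "p \<notin> {0, 1, n}" "q \<notin> {0, 1, n}"
        using pq unfolding S'_def by blast
      then show ?thesis
      proof cases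
        case 1
        then show ?thesis using special pq by blast
      next
        case 2
        then have "ip N (Z q) (Z p) = of_bool (q = p)" using special pq by blast
        then show ?thesis using cnj_ip[of N "Z q" "Z p"] by (cases "p = q") auto
      next
        case 3
        then have "p < N" "q < N" using S(1) by (auto simp: F_def)
        then show ?thesis using 3 orthonormalD[OF orthonormal_basis_vec, of p N q] by (simp add: Z_def)
      qed
    qed
    have o: "orthonormal N k (\<lambda>c. Z (\<pi> c))"
      unfolding orthonormal_def
    proof (intro allI impI)
      fix a b assume "a < k" "b < k"
      then have "\<pi> a \<in> S'" "\<pi> b \<in> S'" "\<pi> a = \<pi> b \<longleftrightarrow> a = b" using \<pi> by (auto simp: bij_betw_def inj_on_def)
      then show "ip N (Z (\<pi> a)) (Z (\<pi> b)) = of_bool (a = b)" using Z by simp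
    qed
    obtain u' where u': "orthonormal N k u'" "ctrace N k shift_tensor_pt u' = ctrace N k shift_tensor (\<lambda>c. Z (\<pi> c))" by (rule trace_range_transfer[OF eq[symmetric] o])
    have zero: "quad N shift_tensor (Z p) = 0" if "p \<in> S" for p
      using that S(1) n by (auto simp: Z_def F_def quad_shift_tensor basis_vec_def)
    have "ctrace N k shift_tensor (\<lambda>c. Z (\<pi> c)) = (\<Sum>p\<in>S'. quad N shift_tensor (Z p))"
      unfolding ctrace_def by (rule sum.reindex_bij_betw[OF \<pi>])
    also have "\<dots> = (\<Sum>p\<in>{0, 1, n}. quad N shift_tensor (Z p)) + (\<Sum>p\<in>S. quad N shift_tensor (Z p))"
      unfolding S'_def using S dis by (intro sum.union_disjoint) auto
    also have "\<dots> = complex_of_real (3360 / 841)"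
      using n zero by (simp add: quad_shift_tensor Z_def three_point_def basis_vec_def)
    finally have "Re (ctrace N k shift_tensor (\<lambda>c. Z (\<pi> c))) = 3360 / 841" by (simp only: Re_complex_of_real)
    moreover have "Re (ctrace N k shift_tensor_pt u') \<le> (\<Sum>c<k. (cmod (ip N (three_point 1 1 1 n 0 0) (u' c)))\<^sup>2
      + (cmod (ip N (three_point (2/3) 2 (3/4) (n + 1) (2/3) (2 * n)) (u' c)))\<^sup>2
      + (cmod (ip N (three_point (1/2) (n + 2) (1/2) (2 * n + 1) 0 0) (u' c)))\<^sup>2)"
      unfolding Re_ctrace by (intro sum_mono shift_tensor_pt_le)
    moreover have "(\<Sum>c<k. (cmod (ip N (three_point 1 1 1 n 0 0) (u' c)))\<^sup>2) \<le> 2"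
      using bessel_ctrace[OF u'(1), of "three_point 1 1 1 n 0 0"] n by (subst (asm) norm_three_point) auto
    moreover have "(\<Sum>c<k. (cmod (ip N (three_point (2/3) 2 (3/4) (n + 1) (2/3) (2 * n)) (u' c)))\<^sup>2) \<le> 8 / 9 + 9 / 16"
      using bessel_ctrace[OF u'(1), of "three_point (2/3) 2 (3/4) (n + 1) (2/3) (2 * n)"] n
      by (subst (asm) norm_three_point) (auto simp: power2_eq_square)
    moreover have "(\<Sum>c<k. (cmod (ip N (three_point (1/2) (n + 2) (1/2) (2 * n + 1) 0 0) (u' c)))\<^sup>2) \<le> 1 / 2"
      using bessel_ctrace[OF u'(1), of "three_point (1/2) (n + 2) (1/2) (2 * n + 1) 0 0"] n
      by (subst (asm) norm_three_point) (auto simp: power2_eq_square)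
    ultimately show False using u'(2) by (simp add: sum.distrib)
  qed
qed

text \<open>Both tensor products have trace 0, so passing from \<open>k\<close> to \<open>N - k\<close> covers \<open>k = N - 1\<close> and \<open>k = N - 2\<close>.\<close>

theorem partial_transpose_distinguished:
  assumes k: "0 < k" "k < N" and eq: "trace_range N k shift_tensor_pt = trace_range N k shift_tensor"
  shows False
proof (cases "k \<le> N - 3")
  case True
  then show ?thesis using partial_transpose_distinguished_small[OF k(1) _ eq] by simp
next
  case False
  have "shift i i = 0" for i by (auto simp: shift_def)
  then have "(\<Sum>i<N. shift_tensor i i) = 0" "(\<Sum>i<N. shift_tensor_pt i i) = 0" by (simp_all add: shift_tensor_def shift_tensor_pt_def tmat_def)
  then have "trace_range N (N - k) shift_tensor_pt = trace_range N (N - k) shift_tensor" using trace_range_complement[of k N] k eq by simp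
  moreover have "9 \<le> N" using mult_le_mono[OF m n] by simp
  then have "0 < N - k" "N - k \<le> N - 3" using k False by linarith+
  ultimately show ?thesis using partial_transpose_distinguished_small by blast
qed

end

section \<open>Preservers of higher numerical ranges of tensor products\<close>

lemma trace_conj_by:
  assumes "orthonormal N N v"
  shows "(\<Sum>i<N. conj_by N v G i i) = (\<Sum>i<N. G i i)"
proof -
  have "orthonormal N N (\<lambda>a s. ip N (v s) (v a))"
    unfolding orthonormal_def
  proof (intro allI impI)
    fix a b assume ab: "a < N" "b < N"
    have "ip N (\<lambda>s. ip N (v s) (v a)) (\<lambda>s. ip N (v s) (v b)) = ip N (v a) (v b)"
      unfolding parseval_ip[OF assms, of "v a" "v b"] by (simp add: ip_def[of _ "\<lambda>s. ip N (v s) (v a)"] cnj_ip)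
    then show "ip N (\<lambda>s. ip N (v s) (v a)) (\<lambda>s. ip N (v s) (v b)) = of_bool (a = b)"
      using orthonormalD[OF assms ab] by simp
  qed
  then have "(\<Sum>i<N. G i i) = ctrace N N (conj_by N v G) v" by (simp add: ctrace_full[symmetric] ctrace_def quad_conj_by)
  then show ?thesis by (simp add: ctrace_full[OF assms])
qed

lemma trace_tmat_transp_if: "(\<Sum>s<N. tmat n (transp_if TA A) (transp_if TB B) s s) = (\<Sum>s<N. tmat n A B s s)"
  by (simp add: tmat_def transp_if_def)

text \<open>Since the range is invariant under the unitary similarity and under the reflection, a map of mixed type would
  make a partial transposition a preserver.\<close>

theorem (in preserver) preserver_form:
  "\<exists>v TA TB. orthonormal N N v \<and> (TA = TB \<or> min m n \<le> 2) \<and>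
    ((\<forall>A B. \<forall>i<N. \<forall>j<N. L (tmat n A B) i j = conj_by N v (tmat n (transp_if TA A) (transp_if TB B)) i j) \<or>
     N = 2 * k \<and> (\<forall>A B. \<forall>i<N. \<forall>j<N. L (tmat n A B) i j = (\<Sum>l<N. tmat n A B l l) / of_nat k * of_bool (i = j)
        - conj_by N v (tmat n (transp_if TA A) (transp_if TB B)) i j))"
  (is "\<exists>v TA TB. _ \<and> _ \<and> ?form v TA TB")
proof -
  have "\<exists>v TA TB. orthonormal N N v \<and> ?form v TA TB"
    using basis_preserving_or_reflected
  proof
    assume "basis_preserving m n D"
    from basis_preserving_form[OF m n this] show ?thesis by blast
  next
    assume r: "N = 2 * k \<and> basis_preserving m n (reflected k D)"
    then obtain v TA TB where v: "orthonormal N N v"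
      "\<forall>A B. \<forall>i<N. \<forall>j<N. lin_ext N (reflected k D) (tmat n A B) i j = conj_by N v (tmat n (transp_if TA A) (transp_if TB B)) i j"
      using basis_preserving_form[OF m n, of "reflected k D"] by blast
    have "L (tmat n A B) i j = (\<Sum>l<N. tmat n A B l l) / of_nat k * of_bool (i = j)
        - conj_by N v (tmat n (transp_if TA A) (transp_if TB B)) i j" if "i < N" "j < N" for A B i j
    proof -
      have "(\<Sum>l<N. tmat n A B l l) / of_nat k * of_bool (i = j) - L (tmat n A B) i j
        = conj_by N v (tmat n (transp_if TA A) (transp_if TB B)) i j"
        using v(2) that unfolding lin_ext_reflected by blast
      then show ?thesis by (simp only: diff_eq_eq) simp
    qed
    then show ?thesis using v(1) r by blast
  qed
  then obtain v TA TB where v: "orthonormal N N v" and alt: "?form v TA TB"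
    by blast
  have same: "trace_range N k (tmat n (transp_if TA A) (transp_if TB B)) = trace_range N k (tmat n A B)" for A B
    using alt
  proof
    assume f: "\<forall>A B. \<forall>i<N. \<forall>j<N. L (tmat n A B) i j = conj_by N v (tmat n (transp_if TA A) (transp_if TB B)) i j"
    have "trace_range N k (tmat n A B) = trace_range N k (conj_by N v (tmat n (transp_if TA A) (transp_if TB B)))"
      unfolding pres[symmetric] by (rule trace_range_cong) (simp add: f)
    then show ?thesis unfolding trace_range_conj_by[OF v] by simp
  next
    let ?G = "conj_by N v (tmat n (transp_if TA A) (transp_if TB B))"
    assume f: "N = 2 * k \<and> (\<forall>A B. \<forall>i<N. \<forall>j<N. L (tmat n A B) i j = (\<Sum>l<N. tmat n A B l l) / of_nat k * of_bool (i = j)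
        - conj_by N v (tmat n (transp_if TA A) (transp_if TB B)) i j)"
    have t: "(\<Sum>l<N. tmat n A B l l) = (\<Sum>l<N. ?G l l)" unfolding trace_conj_by[OF v] trace_tmat_transp_if ..
    have "trace_range N k (tmat n A B) = trace_range N k (\<lambda>i j. (\<Sum>l<N. ?G l l) / of_nat k * of_bool (i = j) - ?G i j)"
      unfolding pres[symmetric] t[symmetric] by (rule trace_range_cong) (use f in blast)
    also have "\<dots> = trace_range N k ?G" using f k(1) by (intro trace_range_reflect) auto
    finally show ?thesis unfolding trace_range_conj_by[OF v] by simp
  qed
  have "TA = TB \<or> min m n \<le> 2"
  proof (rule ccontr)
    assume c: "\<not> ?thesis"
    then interpret F: large_factors m n by unfold_locales auto
    have tF: "transp_if False A = A" and tT: "transp_if True A = (\<lambda>i j. A j i)" for A by (auto simp: transp_if_def fun_eq_iff)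
    have "trace_range N k F.shift_tensor_pt = trace_range N k F.shift_tensor"
    proof (cases TA)
      case True
      have "trace_range N k F.shift_tensor_pt = trace_range N k (\<lambda>i j. F.shift_tensor_pt j i)" by (rule trace_range_transpose[symmetric])
      moreover have 2: "(\<lambda>i j. F.shift_tensor_pt j i) = tmat n (\<lambda>i j. shift j i) shift" by (simp add: F.shift_tensor_pt_def tmat_def fun_eq_iff)
      moreover have "trace_range N k (tmat n (\<lambda>i j. shift j i) shift) = trace_range N k F.shift_tensor" using same[of shift shift] c True by (simp add: tF tT F.shift_tensor_def)
      ultimately show ?thesis unfolding 2 by simp
    next
      case False
      then show ?thesis using same[of shift shift] c by (simp add: tF tT F.shift_tensor_def F.shift_tensor_pt_def)
    qed
    then show False by (rule F.partial_transpose_distinguished[OF k])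
  qed
  then show ?thesis using v alt by blast
qed

section \<open>Partial transposition with a factor of size two\<close>

lemma lessThan_2: "{..<2::nat} = {0, 1}"
  by auto

lemma sum_2: "(\<Sum>i<2. g i) = g 0 + (g 1 :: complex)" for g :: "nat \<Rightarrow> complex"
  by (simp add: lessThan_2)

lemma real_system_2x3:
  fixes p0 p1 p2 q0 q1 q2 :: real
  shows "\<exists>x y z. p0 * x + p1 * y + p2 * z = 0 \<and> q0 * x + q1 * y + q2 * z = 0 \<and> (x \<noteq> 0 \<or> y \<noteq> 0 \<or> z \<noteq> 0)"
proof -
  define M where "M = mat\<^sub>r 3 3 (\<lambda>a. if a = 2 then 0\<^sub>v 3 else vec 3 (\<lambda>i. if a = 0 then [p0, p1, p2] ! i else [q0, q1, q2] ! i))"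
  have M: "M \<in> carrier_mat 3 3" by (simp add: M_def)
  have "det M = 0" unfolding M_def by (intro det_row_0) auto
  then obtain v where v: "v \<in> carrier_vec 3" "v \<noteq> 0\<^sub>v 3" "M *\<^sub>v v = 0\<^sub>v 3"
    using det_0_iff_vec_prod_zero[OF M] by auto
  have i3: "{0..<3::nat} = {0, 1, 2}" by auto
  have "(M *\<^sub>v v) $ 0 = 0" "(M *\<^sub>v v) $ 1 = 0" using v(3) by simp_all
  then have "p0 * v $ 0 + p1 * v $ 1 + p2 * v $ 2 = 0" "q0 * v $ 0 + q1 * v $ 1 + q2 * v $ 2 = 0"
    using v(1) by (simp_all add: M_def scalar_prod_def i3)
  moreover have "v $ 0 \<noteq> 0 \<or> v $ 1 \<noteq> 0 \<or> v $ 2 \<noteq> 0"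
  proof (rule ccontr)
    assume "\<not> ?thesis"
    then have "v $ i = 0" if "i < 3" for i
      using that by (auto simp: numeral_3_eq_3 numeral_2_eq_2 less_Suc_eq)
    then show False using v(1,2) by (auto simp: vec_eq_iff)
  qed
  ultimately show ?thesis by blast
qed

text \<open>A symmetric unitary matrix with rows \<open>(x, \<i>s)\<close> and \<open>(\<i>s, cnj x)\<close>, \<open>s\<close> real, intertwines \<open>B\<close> and its transpose if
  and only if one complex linear equation holds, which means two real equations for three real unknowns.\<close>

lemma transpose_similar_2:
  obtains c where "orthonormal 2 2 c" "\<And>i j. i < 2 \<Longrightarrow> j < 2 \<Longrightarrow> B j i = conj_by 2 c B i j"
proof -
  define b d e where "b = B 0 1" and "d = B 1 0" and "e = B 0 0 - B 1 1"
  obtain x1 x2 s where eqs: "Re (b - d) * x1 + - Im (b + d) * x2 + Im e * s = 0"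
    "Im (b - d) * x1 + Re (b + d) * x2 + - Re e * s = 0" and nz: "x1 \<noteq> 0 \<or> x2 \<noteq> 0 \<or> s \<noteq> 0"
    using real_system_2x3[of "Re (b - d)" "- Im (b + d)" "Im e" "Im (b - d)" "Re (b + d)" "- Re e"] by blast
  define r where "r = sqrt (x1\<^sup>2 + x2\<^sup>2 + s\<^sup>2)"
  have r2: "r\<^sup>2 = x1\<^sup>2 + x2\<^sup>2 + s\<^sup>2" unfolding r_def by simp
  have "0 < x1\<^sup>2 + x2\<^sup>2 + s\<^sup>2"
    using nz by (auto simp: add_pos_nonneg add_nonneg_pos)
  then have r: "r \<noteq> 0" unfolding r_def by simp
  define x where "x = Complex (x1 / r) (x2 / r)"
  define y where "y = \<i> * complex_of_real (s / r)"
  have cy: "cnj y = - y" by (simp add: y_def)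
  have "(x1 / r)\<^sup>2 + (x2 / r)\<^sup>2 + (s / r)\<^sup>2 = (x1\<^sup>2 + x2\<^sup>2 + s\<^sup>2) / r\<^sup>2"
    by (simp add: power_divide add_divide_distrib)
  then have "(x1 / r)\<^sup>2 + (x2 / r)\<^sup>2 + (s / r)\<^sup>2 = 1" using r unfolding r2[symmetric] by simp
  then have nrm: "x * cnj x - y * y = 1"
    by (simp add: x_def y_def complex_eq_iff power2_eq_square)
  have rel: "x * b - cnj x * d = y * e"
  proof -
    have "complex_of_real r * (x * b - cnj x * d) = Complex x1 x2 * b - Complex x1 (- x2) * d"
      using r by (simp add: x_def complex_eq_iff field_simps)
    also have "\<dots> = \<i> * complex_of_real s * e" using eqs by (simp add: complex_eq_iff algebra_simps)
    also have "\<dots> = complex_of_real r * (y * e)" using r by (simp add: y_def)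
    finally show ?thesis using r by simp
  qed
  define c where "c a i = (if a = i then (if a = 0 then x else cnj x) else y)" for a i :: nat
  have nrm': "cnj x * x - y * y = 1" using nrm by (simp add: mult.commute)
  show ?thesis
  proof (rule that[of c])
    show "orthonormal 2 2 c"
      unfolding orthonormal_def
    proof (intro allI impI)
      fix p q :: nat assume "p < 2" "q < 2"
      then have "p \<in> {0, 1}" "q \<in> {0, 1}" by auto
      then show "ip 2 (c p) (c q) = of_bool (p = q)"
        using nrm nrm' by (auto simp: ip_def sum_2 c_def cy algebra_simps)
    qed
    fix i j :: nat assume "i < 2" "j < 2"
    then have ij: "i = 0 \<and> j = 0 \<or> i = 0 \<and> j = 1 \<or> i = 1 \<and> j = 0 \<or> i = 1 \<and> j = 1" by auto
    have f: "conj_by 2 c B i j = c 0 i * B 0 0 * cnj (c 0 j) + c 0 i * b * cnj (c 1 j)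
      + (c 1 i * d * cnj (c 0 j) + c 1 i * B 1 1 * cnj (c 1 j))"
      by (simp add: conj_by_def sum_2 b_def d_def)
    have B11: "B 1 1 = B 0 0 - e" by (simp add: e_def)
    define a where "a = B 0 0"
    from ij show "B j i = conj_by 2 c B i j"
    proof (elim disjE conjE)
      assume "i = 0" "j = 0"
      then have "conj_by 2 c B i j = a * (x * cnj x - y * y) - y * (x * b - cnj x * d - y * e)"
        unfolding f B11 by (simp add: c_def cy a_def algebra_simps)
      then show ?thesis unfolding nrm rel using \<open>i = 0\<close> \<open>j = 0\<close> by (simp add: a_def)
    next
      assume "i = 0" "j = 1"
      then have "conj_by 2 c B i j = x * (x * b - cnj x * d - y * e) + d * (x * cnj x - y * y)"
        unfolding f B11 by (simp add: c_def cy a_def algebra_simps)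
      then show ?thesis unfolding nrm rel using \<open>i = 0\<close> \<open>j = 1\<close> by (simp add: d_def cy algebra_simps)
    next
      assume "i = 1" "j = 0"
      then have "conj_by 2 c B i j = b * (x * cnj x - y * y) - cnj x * (x * b - cnj x * d - y * e)"
        unfolding f B11 by (simp add: c_def cy a_def algebra_simps)
      then show ?thesis unfolding nrm rel using \<open>i = 1\<close> \<open>j = 0\<close> by (simp add: b_def)
    next
      assume "i = 1" "j = 1"
      then have "conj_by 2 c B i j = (a - e) * (x * cnj x - y * y) + y * (x * b - cnj x * d - y * e)"
        unfolding f B11 by (simp add: c_def cy a_def algebra_simps)
      then show ?thesis unfolding nrm rel using \<open>i = 1\<close> \<open>j = 1\<close> B11 by (simp add: a_def)
    qed
  qed
qed

lemma conj_by_tmat: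
  assumes "i < m * n" "j < m * n"
  shows "conj_by (m * n) (\<lambda>s. tvec n (b (s div n)) (c (s mod n))) (tmat n A B) i j = tmat n (conj_by m b A) (conj_by n c B) i j"
proof -
  let ?a = "\<lambda>p p'. b p (i div n) * A p p' * cnj (b p' (j div n))"
  let ?b = "\<lambda>q q'. c q (i mod n) * B q q' * cnj (c q' (j mod n))"
  have "conj_by (m * n) (\<lambda>s. tvec n (b (s div n)) (c (s mod n))) (tmat n A B) i j
    = (\<Sum>s<m * n. \<Sum>t<m * n. ?a (s div n) (t div n) * ?b (s mod n) (t mod n))"
    by (simp add: conj_by_def tvec_def tmat_def mult_ac)
  also have "\<dots> = (\<Sum>s<m * n. \<Sum>p'<m. \<Sum>q'<n. ?a (s div n) p' * ?b (s mod n) q')"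
  proof (rule sum.cong[OF refl])
    fix s
    show "(\<Sum>t<m * n. ?a (s div n) (t div n) * ?b (s mod n) (t mod n)) = (\<Sum>p'<m. \<Sum>q'<n. ?a (s div n) p' * ?b (s mod n) q')"
      by (rule sum_div_mod[where f = "\<lambda>p' q'. ?a (s div n) p' * ?b (s mod n) q'"])
  qed
  also have "\<dots> = (\<Sum>p<m. \<Sum>q<n. \<Sum>p'<m. \<Sum>q'<n. ?a p p' * ?b q q')"
    by (rule sum_div_mod[where f = "\<lambda>p q. \<Sum>p'<m. \<Sum>q'<n. ?a p p' * ?b q q'"])
  also have "\<dots> = (\<Sum>p<m. \<Sum>p'<m. \<Sum>q<n. \<Sum>q'<n. ?a p p' * ?b q q')"
    by (intro sum.cong refl sum.swap)
  also have "\<dots> = (\<Sum>p<m. \<Sum>p'<m. ?a p p') * (\<Sum>q<n. \<Sum>q'<n. ?b q q')"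
    by (simp only: sum_distrib_left[symmetric] sum_distrib_right[symmetric])
  finally show ?thesis by (simp add: conj_by_def tmat_def)
qed

lemma conj_by_basis_vec: "i < m \<Longrightarrow> j < m \<Longrightarrow> conj_by m basis_vec A i j = A i j"
proof -
  assume ij: "i < m" "j < m"
  have "conj_by m basis_vec A i j = (\<Sum>s<m. \<Sum>t<m. if t = j then (if s = i then A i j else 0) else 0)"
    unfolding conj_by_def basis_vec_def by (intro sum.cong refl) auto
  then show ?thesis using ij by simp
qed

lemma trace_range_partial_transpose_right:
  assumes "n = 2"
  shows "trace_range (m * n) k (tmat n A (\<lambda>i j. B j i)) = trace_range (m * n) k (tmat n A B)"
proof -
  obtain c where c: "orthonormal 2 2 c" "\<And>i j. i < 2 \<Longrightarrow> j < 2 \<Longrightarrow> B j i = conj_by 2 c B i j"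
    using transpose_similar_2[of B] by metis
  have o: "orthonormal (m * n) (m * n) (\<lambda>s. tvec n (basis_vec (s div n)) (c (s mod n)))"
    using c(1) assms by (intro orthonormal_tvec_left orthonormal_basis_vec) simp
  have "trace_range (m * n) k (tmat n A (\<lambda>i j. B j i)) = trace_range (m * n) k (conj_by (m * n) (\<lambda>s. tvec n (basis_vec (s div n)) (c (s mod n))) (tmat n A B))"
  proof (rule trace_range_cong)
    fix i j assume ij: "i < m * n" "j < m * n"
    note d = div_mod_lt[OF ij(1)] div_mod_lt[OF ij(2)]
    show "tmat n A (\<lambda>i j. B j i) i j = conj_by (m * n) (\<lambda>s. tvec n (basis_vec (s div n)) (c (s mod n))) (tmat n A B) i j"
      unfolding conj_by_tmat[OF ij] using d c(2)[of "i mod n" "j mod n"] assms by (simp add: tmat_def conj_by_basis_vec)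
  qed
  then show ?thesis unfolding trace_range_conj_by[OF o] .
qed

lemma trace_range_partial_transpose_left:
  assumes "m = 2"
  shows "trace_range (m * n) k (tmat n (\<lambda>i j. A j i) B) = trace_range (m * n) k (tmat n A B)"
proof -
  obtain c where c: "orthonormal 2 2 c" "\<And>i j. i < 2 \<Longrightarrow> j < 2 \<Longrightarrow> A j i = conj_by 2 c A i j"
    using transpose_similar_2[of A] by metis
  have o: "orthonormal (m * n) (m * n) (\<lambda>s. tvec n (c (s div n)) (basis_vec (s mod n)))"
    using c(1) assms by (intro orthonormal_tvec_left orthonormal_basis_vec) simp
  have "trace_range (m * n) k (tmat n (\<lambda>i j. A j i) B) = trace_range (m * n) k (conj_by (m * n) (\<lambda>s. tvec n (c (s div n)) (basis_vec (s mod n))) (tmat n A B))"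
  proof (rule trace_range_cong)
    fix i j assume ij: "i < m * n" "j < m * n"
    note d = div_mod_lt[OF ij(1)] div_mod_lt[OF ij(2)]
    show "tmat n (\<lambda>i j. A j i) B i j = conj_by (m * n) (\<lambda>s. tvec n (c (s div n)) (basis_vec (s mod n))) (tmat n A B) i j"
      unfolding conj_by_tmat[OF ij] using d c(2)[of "i div n" "j div n"] assms by (simp add: tmat_def conj_by_basis_vec)
  qed
  then show ?thesis unfolding trace_range_conj_by[OF o] .
qed

text \<open>With a left factor of size 2, transposing the right factor is the same, up to a full transposition, as
  transposing the left factor.\<close>

lemma trace_range_transp_if:
  assumes "2 \<le> m" "2 \<le> n" "TA = TB \<or> min m n \<le> 2"
  shows "trace_range (m * n) k (tmat n (transp_if TA A) (transp_if TB B)) = trace_range (m * n) k (tmat n A B)"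
proof -
  have tF: "transp_if False A = A" and tT: "transp_if True A = (\<lambda>i j. A j i)" for A by (auto simp: transp_if_def fun_eq_iff)
  have full: "trace_range (m * n) k (tmat n (\<lambda>i j. A j i) (\<lambda>i j. B j i)) = trace_range (m * n) k (tmat n A B)" for A B
  proof -
    have "tmat n (\<lambda>i j. A j i) (\<lambda>i j. B j i) = (\<lambda>i j. tmat n A B j i)" by (simp add: tmat_def fun_eq_iff)
    then show ?thesis using trace_range_transpose[of "m * n" k "tmat n A B"] by simp
  qed
  show ?thesis
  proof (cases "TA = TB")
    case True
    then show ?thesis using full by (cases TB) (simp_all add: tF tT)
  next
    case False
    then have "m = 2 \<or> n = 2" using assms by auto
    then show ?thesis
    proof
      assume m: "m = 2"
      show ?thesis
      proof (cases TA)
        case True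
        then show ?thesis using False trace_range_partial_transpose_left[OF m] by (simp add: tF tT)
      next
        case fa: False
        have "trace_range (m * n) k (tmat n A (\<lambda>i j. B j i)) = trace_range (m * n) k (tmat n (\<lambda>i j. A j i) B)"
          using full[of "\<lambda>i j. A j i" B] by simp
        then show ?thesis using False fa trace_range_partial_transpose_left[OF m] by (simp add: tF tT)
      qed
    next
      assume n: "n = 2"
      show ?thesis
      proof (cases TA)
        case False': False
        then show ?thesis using False trace_range_partial_transpose_right[OF n] by (simp add: tF tT)
      next
        case tr: True
        have "trace_range (m * n) k (tmat n (\<lambda>i j. A j i) B) = trace_range (m * n) k (tmat n A (\<lambda>i j. B j i))"
          using full[of A "\<lambda>i j. B j i"] by simp
        then show ?thesis using False tr trace_range_partial_transpose_right[OF n] by (simp add: tF tT)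
      qed
    qed
  qed
qed

section \<open>Matrices\<close>

abbreviation entries :: "complex mat \<Rightarrow> nat \<Rightarrow> nat \<Rightarrow> complex" where
  "entries A \<equiv> \<lambda>i j. A $$ (i, j)"

lemma adjoint_carrier: "A \<in> carrier_mat r c \<Longrightarrow> mat_adjoint A \<in> carrier_mat c r"
  unfolding mat_adjoint_def by (auto simp: mat_of_rows_def)

lemma adjoint_entry: "A \<in> carrier_mat r c \<Longrightarrow> i < c \<Longrightarrow> j < r \<Longrightarrow> mat_adjoint A $$ (i, j) = cnj (A $$ (j, i))"
  unfolding mat_adjoint_def by (auto simp: mat_of_rows_def)

lemma mult_entry:
  assumes "A \<in> carrier_mat r l" "B \<in> carrier_mat l c" "i < r" "j < c"
  shows "(A * B) $$ (i, j) = (\<Sum>p<l. A $$ (i, p) * B $$ (p, j))"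
  using assms by (simp add: scalar_prod_def lessThan_atLeast0)

text \<open>Families of vectors are the columns of rectangular matrices.\<close>

lemma isometry_iff:
  assumes "X \<in> carrier_mat N k"
  shows "mat_adjoint X * X = 1\<^sub>m k \<longleftrightarrow> orthonormal N k (\<lambda>c i. X $$ (i, c))"
proof -
  have a: "mat_adjoint X \<in> carrier_mat k N" by (rule adjoint_carrier[OF assms])
  have e: "(mat_adjoint X * X) $$ (i, j) = ip N (\<lambda>p. X $$ (p, i)) (\<lambda>p. X $$ (p, j))" if "i < k" "j < k" for i j
    unfolding mult_entry[OF a assms that] ip_def
    by (intro sum.cong refl) (simp add: adjoint_entry[OF assms] that)
  show ?thesis
  proof
    assume "mat_adjoint X * X = 1\<^sub>m k"
    then have "ip N (\<lambda>p. X $$ (p, i)) (\<lambda>p. X $$ (p, j)) = 1\<^sub>m k $$ (i, j)" if "i < k" "j < k" for i j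
      using e[OF that] by simp
    then show "orthonormal N k (\<lambda>c i. X $$ (i, c))" unfolding orthonormal_def by simp
  next
    assume o: "orthonormal N k (\<lambda>c i. X $$ (i, c))"
    show "mat_adjoint X * X = 1\<^sub>m k"
    proof (rule eq_matI)
      fix i j assume "i < dim_row (1\<^sub>m k)" "j < dim_col (1\<^sub>m k)"
      then show "(mat_adjoint X * X) $$ (i, j) = 1\<^sub>m k $$ (i, j)" using e orthonormalD[OF o] by simp
    qed (use assms a in auto)
  qed
qed

lemma compression_trace:
  assumes X: "X \<in> carrier_mat N k" and A: "A \<in> carrier_mat N N"
  shows "mat_trace (mat_adjoint X * A * X) = ctrace N k (entries A) (\<lambda>c i. X $$ (i, c))"
proof -
  have a: "mat_adjoint X \<in> carrier_mat k N" by (rule adjoint_carrier[OF X])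
  have aA: "mat_adjoint X * A \<in> carrier_mat k N" using a A by simp
  have "(mat_adjoint X * A * X) $$ (c, c) = quad N (entries A) (\<lambda>i. X $$ (i, c))" if c: "c < k" for c
  proof -
    have "(mat_adjoint X * A * X) $$ (c, c) = (\<Sum>j<N. (\<Sum>i<N. cnj (X $$ (i, c)) * A $$ (i, j)) * X $$ (j, c))"
      unfolding mult_entry[OF aA X c c]
    proof (intro sum.cong refl arg_cong2[of _ _ _ _ "(*)"])
      fix j assume j: "j \<in> {..<N}"
      show "(mat_adjoint X * A) $$ (c, j) = (\<Sum>i<N. cnj (X $$ (i, c)) * A $$ (i, j))"
        using mult_entry[OF a A c, of j] j adjoint_entry[OF X c] by simp
    qed
    also have "\<dots> = quad N (entries A) (\<lambda>i. X $$ (i, c))"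
      unfolding quad_def by (subst sum.swap) (simp add: sum_distrib_right)
    finally show ?thesis .
  qed
  moreover have "dim_row (mat_adjoint X * A * X) = k" using mult_carrier_mat[OF aA X] by (rule carrier_matD)
  ultimately show ?thesis by (simp add: mat_trace_def ctrace_def)
qed

lemma k_numerical_range_eq_image:
  assumes A: "A \<in> carrier_mat N N"
  shows "k_numerical_range k A = (\<lambda>z. z / of_nat k) ` trace_range N k (entries A)"
proof (intro equalityI subsetI)
  fix z assume "z \<in> k_numerical_range k A"
  then obtain X where X: "X \<in> carrier_mat N k" "mat_adjoint X * X = 1\<^sub>m k" "z = mat_trace (mat_adjoint X * A * X) / of_nat k"
    using A by (auto simp: k_numerical_range_def)
  have "ctrace N k (entries A) (\<lambda>c i. X $$ (i, c)) \<in> trace_range N k (entries A)"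
    unfolding trace_range_def using isometry_iff[OF X(1)] X(2) by blast
  then show "z \<in> (\<lambda>z. z / of_nat k) ` trace_range N k (entries A)" unfolding X(3) compression_trace[OF X(1) A] by blast
next
  fix z assume "z \<in> (\<lambda>z. z / of_nat k) ` trace_range N k (entries A)"
  then obtain u where u: "orthonormal N k u" "z = ctrace N k (entries A) u / of_nat k" by (auto simp: trace_range_def)
  define X where "X = mat N k (\<lambda>(i, c). u c i)"
  have X: "X \<in> carrier_mat N k" by (simp add: X_def)
  have ipX: "ip N (\<lambda>i. X $$ (i, a)) (\<lambda>i. X $$ (i, b)) = ip N (u a) (u b)" if "a < k" "b < k" for a b
    using that by (intro ip_cong) (auto simp: X_def)
  have "orthonormal N k (\<lambda>c i. X $$ (i, c))" using u(1) ipX by (simp add: orthonormal_def)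
  moreover have "ctrace N k (entries A) (\<lambda>c i. X $$ (i, c)) = ctrace N k (entries A) u"
    unfolding ctrace_def quad_def by (intro sum.cong refl) (auto simp: X_def)
  ultimately have "mat_adjoint X * X = 1\<^sub>m k" "z = mat_trace (mat_adjoint X * A * X) / of_nat k"
    unfolding isometry_iff[OF X] compression_trace[OF X A] by (simp_all add: u(2))
  then show "z \<in> k_numerical_range k A"
    unfolding k_numerical_range_def using X carrier_matD(1)[OF A] by blast
qed

lemma k_numerical_range_eq_iff:
  assumes "A \<in> carrier_mat N N" "B \<in> carrier_mat N N" "0 < k"
  shows "k_numerical_range k A = k_numerical_range k B \<longleftrightarrow> trace_range N k (entries A) = trace_range N k (entries B)"
proof -
  have "inj (\<lambda>z::complex. z / of_nat k)" using assms(3) by (auto simp: inj_def)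
  then show ?thesis
    unfolding k_numerical_range_eq_image[OF assms(1)] k_numerical_range_eq_image[OF assms(2)] by (rule inj_image_eq_iff)
qed

lemma kron_carrier: "A \<in> carrier_mat m m \<Longrightarrow> B \<in> carrier_mat n n \<Longrightarrow> kron A B \<in> carrier_mat (m * n) (m * n)"
  by (auto simp: kron_def)

lemma kron_entry:
  "A \<in> carrier_mat m m \<Longrightarrow> B \<in> carrier_mat n n \<Longrightarrow> i < m * n \<Longrightarrow> j < m * n \<Longrightarrow> entries (kron A B) i j = tmat n (entries A) (entries B) i j"
  by (auto simp: kron_def tmat_def)

lemma trace_range_kron:
  "A \<in> carrier_mat m m \<Longrightarrow> B \<in> carrier_mat n n \<Longrightarrow> trace_range (m * n) k (entries (kron A B)) = trace_range (m * n) k (tmat n (entries A) (entries B))"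
  by (rule trace_range_cong) (rule kron_entry)

lemma trace_kron:
  "A \<in> carrier_mat m m \<Longrightarrow> B \<in> carrier_mat n n \<Longrightarrow> mat_trace (kron A B) = (\<Sum>l<m * n. tmat n (entries A) (entries B) l l)"
  unfolding mat_trace_def using kron_carrier[of A m B n] by (auto simp: kron_entry)

lemma unitary_iff_orthonormal:
  assumes U: "U \<in> carrier_mat N N"
  shows "unitary_mat N U \<longleftrightarrow> orthonormal N N (\<lambda>s i. U $$ (i, s))"
proof -
  have a: "mat_adjoint U \<in> carrier_mat N N" by (rule adjoint_carrier[OF U])
  have "mat_adjoint U * U = 1\<^sub>m N \<Longrightarrow> U * mat_adjoint U = 1\<^sub>m N"
    by (rule mat_mult_left_right_inverse[OF a U])
  then show ?thesis using U isometry_iff[OF U] by (auto simp: unitary_mat_def)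
qed

lemma conj_entry:
  assumes U: "U \<in> carrier_mat N N" and M: "M \<in> carrier_mat N N" and ij: "i < N" "j < N"
  shows "entries (U * M * mat_adjoint U) i j = conj_by N (\<lambda>s i. U $$ (i, s)) (entries M) i j"
proof -
  have a: "mat_adjoint U \<in> carrier_mat N N" by (rule adjoint_carrier[OF U])
  have UM: "U * M \<in> carrier_mat N N" using U M by simp
  have "entries (U * M * mat_adjoint U) i j = (\<Sum>t<N. (\<Sum>s<N. U $$ (i, s) * M $$ (s, t)) * cnj (U $$ (j, t)))"
    unfolding mult_entry[OF UM a ij]
  proof (intro sum.cong refl arg_cong2[of _ _ _ _ "(*)"])
    fix t assume "t \<in> {..<N}"
    then have t: "t < N" by simp
    show "(U * M) $$ (i, t) = (\<Sum>s<N. U $$ (i, s) * M $$ (s, t))" by (rule mult_entry[OF U M ij(1) t])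
    show "mat_adjoint U $$ (t, j) = cnj (U $$ (j, t))" by (rule adjoint_entry[OF U t ij(2)])
  qed
  also have "\<dots> = conj_by N (\<lambda>s i. U $$ (i, s)) (entries M) i j"
    unfolding conj_by_def by (subst sum.swap) (simp add: sum_distrib_right)
  finally show ?thesis .
qed

lemma mat_linear_mapD:
  assumes "mat_linear_map N f"
  shows "\<And>M. M \<in> carrier_mat N N \<Longrightarrow> f M \<in> carrier_mat N N"
    and "\<And>M K. M \<in> carrier_mat N N \<Longrightarrow> K \<in> carrier_mat N N \<Longrightarrow> f (M + K) = f M + f K"
    and "\<And>c M. M \<in> carrier_mat N N \<Longrightarrow> f (c \<cdot>\<^sub>m M) = c \<cdot>\<^sub>m f M"
proof -
  interpret linear_map class_ring "module_mat TYPE(complex) N N" "module_mat TYPE(complex) N N" f by fact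
  show "\<And>M. M \<in> carrier_mat N N \<Longrightarrow> f M \<in> carrier_mat N N" using T_im by (simp add: module_mat_simps)
  show "\<And>M K. M \<in> carrier_mat N N \<Longrightarrow> K \<in> carrier_mat N N \<Longrightarrow> f (M + K) = f M + f K"
    using T_add by (simp add: module_mat_simps)
  show "\<And>c M. M \<in> carrier_mat N N \<Longrightarrow> f (c \<cdot>\<^sub>m M) = c \<cdot>\<^sub>m f M"
    using T_smult by (simp add: module_mat_simps class_ring_simps)
qed

lemma mat_linear_mapI:
  assumes "\<And>M. M \<in> carrier_mat N N \<Longrightarrow> f M \<in> carrier_mat N N"
    and "\<And>M K. M \<in> carrier_mat N N \<Longrightarrow> K \<in> carrier_mat N N \<Longrightarrow> f (M + K) = f M + f K"
    and "\<And>c M. M \<in> carrier_mat N N \<Longrightarrow> f (c \<cdot>\<^sub>m M) = c \<cdot>\<^sub>m f M"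
  shows "mat_linear_map N f"
proof -
  interpret vectorspace class_ring "module_mat TYPE(complex) N N" by (rule matrix_vs)
  have "f \<in> LinearCombinations.module_hom class_ring (module_mat TYPE(complex) N N) (module_mat TYPE(complex) N N)"
    unfolding LinearCombinations.module_hom_def module_mat_simps class_ring_simps
    by (intro CollectI conjI ballI allI impI funcsetI) (simp_all add: assms)
  then show ?thesis by unfold_locales
qed

lemma mat_linear_sum:
  assumes f: "mat_linear_map N f" and S: "finite S" and M: "\<And>x. x \<in> S \<Longrightarrow> M x \<in> carrier_mat N N"
  shows "f (mat N N (\<lambda>(i, j). \<Sum>x\<in>S. c x * M x $$ (i, j))) = mat N N (\<lambda>(i, j). \<Sum>x\<in>S. c x * f (M x) $$ (i, j))"
  using S M
proof (induction S rule: finite_induct)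
  case empty
  have z: "mat N N (\<lambda>(i, j). \<Sum>x\<in>{}. c x * M x $$ (i, j)) = 0 \<cdot>\<^sub>m (0\<^sub>m N N :: complex mat)" by (intro eq_matI) auto
  have "f (0\<^sub>m N N) \<in> carrier_mat N N" by (rule mat_linear_mapD(1)[OF f]) simp
  then show ?case unfolding z mat_linear_mapD(3)[OF f zero_carrier_mat] by (intro eq_matI) auto
next
  case (insert x F)
  let ?R = "mat N N (\<lambda>(i, j). \<Sum>x\<in>F. c x * M x $$ (i, j))"
  have Mx: "M x \<in> carrier_mat N N" using insert.prems by simp
  have fMx: "f (M x) \<in> carrier_mat N N" by (rule mat_linear_mapD(1)[OF f Mx])
  have "mat N N (\<lambda>(i, j). \<Sum>x\<in>insert x F. c x * M x $$ (i, j)) = c x \<cdot>\<^sub>m M x + ?R"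
    using insert.hyps Mx by (intro eq_matI) auto
  also have "f \<dots> = c x \<cdot>\<^sub>m f (M x) + f ?R"
    using Mx by (simp add: mat_linear_mapD(2,3)[OF f])
  also have "f ?R = mat N N (\<lambda>(i, j). \<Sum>x\<in>F. c x * f (M x) $$ (i, j))"
    by (rule insert.IH) (use insert.prems in auto)
  also have "c x \<cdot>\<^sub>m f (M x) + \<dots> = mat N N (\<lambda>(i, j). \<Sum>x\<in>insert x F. c x * f (M x) $$ (i, j))"
    using insert.hyps fMx by (intro eq_matI) auto
  finally show ?case .
qed

definition matrix_unit :: "nat \<Rightarrow> nat \<Rightarrow> nat \<Rightarrow> complex mat" where
  "matrix_unit N p q = mat N N (\<lambda>(i, j). mat_unit p q i j)"

lemma mat_linear_lin_ext:
  assumes f: "mat_linear_map N f" and M: "M \<in> carrier_mat N N" and ij: "i < N" "j < N"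
  shows "entries (f M) i j = lin_ext N (\<lambda>p q i j. f (matrix_unit N p q) $$ (i, j)) (entries M) i j"
proof -
  let ?S = "{..<N} \<times> {..<N}"
  have "M = mat N N (\<lambda>(i, j). \<Sum>r\<in>?S. M $$ r * matrix_unit N (fst r) (snd r) $$ (i, j))"
  proof (rule eq_matI)
    fix i j assume "i < dim_row (mat N N (\<lambda>(i, j). \<Sum>r\<in>?S. M $$ r * matrix_unit N (fst r) (snd r) $$ (i, j)))"
      "j < dim_col (mat N N (\<lambda>(i, j). \<Sum>r\<in>?S. M $$ r * matrix_unit N (fst r) (snd r) $$ (i, j)))"
    then have ij: "i < N" "j < N" by simp_all
    then show "M $$ (i, j) = mat N N (\<lambda>(i, j). \<Sum>r\<in>?S. M $$ r * matrix_unit N (fst r) (snd r) $$ (i, j)) $$ (i, j)"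
      using expand_mat_unit[OF ij, of "entries M"] by (simp add: matrix_unit_def)
  qed (use M in auto)
  then have "f M = f (mat N N (\<lambda>(i, j). \<Sum>r\<in>?S. M $$ r * matrix_unit N (fst r) (snd r) $$ (i, j)))" by simp
  also have "\<dots> = mat N N (\<lambda>(i, j). \<Sum>r\<in>?S. M $$ r * f (matrix_unit N (fst r) (snd r)) $$ (i, j))"
    by (rule mat_linear_sum[OF f]) (auto simp: matrix_unit_def)
  finally have "f M $$ (i, j) = (\<Sum>r\<in>?S. M $$ (fst r, snd r) * f (matrix_unit N (fst r) (snd r)) $$ (i, j))" using ij by simp
  also have "\<dots> = (\<Sum>p<N. \<Sum>q<N. M $$ (p, q) * f (matrix_unit N p q) $$ (i, j))"
    by (rule sum_pair[where f = "\<lambda>p q. M $$ (p, q) * f (matrix_unit N p q) $$ (i, j)"])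
  finally show ?thesis by (simp add: lin_ext_def)
qed

text \<open>The row of the argument from which a partial transposition takes its entry at \<open>(s, t)\<close>: each transposed factor
  contributes its part of the column index \<open>t\<close>. The column is obtained by exchanging \<open>s\<close> and \<open>t\<close>.\<close>

definition swap_index :: "nat \<Rightarrow> bool \<Rightarrow> bool \<Rightarrow> nat \<Rightarrow> nat \<Rightarrow> nat" where
  "swap_index n TA TB s t = (if TA then t div n else s div n) * n + (if TB then t mod n else s mod n)"

definition partial_tr :: "nat \<Rightarrow> nat \<Rightarrow> bool \<Rightarrow> bool \<Rightarrow> complex mat \<Rightarrow> complex mat" where
  "partial_tr m n TA TB M = mat (m * n) (m * n) (\<lambda>(s, t). M $$ (swap_index n TA TB s t, swap_index n TA TB t s))"

lemma swap_index_lt: "s < m * n \<Longrightarrow> t < m * n \<Longrightarrow> swap_index n TA TB s t < m * n"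
  unfolding swap_index_def using div_mod_lt by (auto intro!: pair_lt)

lemma partial_tr_linear: "mat_linear_map (m * n) (partial_tr m n TA TB)"
  by (rule mat_linear_mapI) (auto simp: partial_tr_def swap_index_lt intro!: eq_matI)

definition transp_mat :: "bool \<Rightarrow> complex mat \<Rightarrow> complex mat" where
  "transp_mat T A = (if T then transpose_mat A else A)"

lemma transp_mat_carrier: "A \<in> carrier_mat m m \<Longrightarrow> transp_mat T A \<in> carrier_mat m m"
  by (auto simp: transp_mat_def)

lemma transp_mat_entry: "A \<in> carrier_mat m m \<Longrightarrow> i < m \<Longrightarrow> j < m \<Longrightarrow> entries (transp_mat T A) i j = transp_if T (entries A) i j"
  by (auto simp: transp_mat_def transp_if_def)

lemma kron_transp_entry:
  assumes "A \<in> carrier_mat m m" "B \<in> carrier_mat n n" "i < m * n" "j < m * n"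
  shows "entries (kron (transp_mat TA A) (transp_mat TB B)) i j = tmat n (transp_if TA (entries A)) (transp_if TB (entries B)) i j"
  using div_mod_lt[OF assms(3)] div_mod_lt[OF assms(4)] assms
  by (subst kron_entry[of _ m _ n]) (auto simp: transp_mat_carrier tmat_def transp_mat_entry)

lemma partial_tr_kron:
  assumes AB: "A \<in> carrier_mat m m" "B \<in> carrier_mat n n"
  shows "partial_tr m n TA TB (kron A B) = kron (transp_mat TA A) (transp_mat TB B)"
proof (rule eq_matI)
  have c: "kron (transp_mat TA A) (transp_mat TB B) \<in> carrier_mat (m * n) (m * n)" by (intro kron_carrier transp_mat_carrier AB)
  then show "dim_row (partial_tr m n TA TB (kron A B)) = dim_row (kron (transp_mat TA A) (transp_mat TB B))"
    "dim_col (partial_tr m n TA TB (kron A B)) = dim_col (kron (transp_mat TA A) (transp_mat TB B))"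
    by (auto simp: partial_tr_def)
  fix i j assume "i < dim_row (kron (transp_mat TA A) (transp_mat TB B))" "j < dim_col (kron (transp_mat TA A) (transp_mat TB B))"
  then have ij: "i < m * n" "j < m * n" using c by auto
  have n: "0 < n" using ij by (cases n) auto
  have d: "swap_index n TA TB s t div n = (if TA then t div n else s div n)"
    "swap_index n TA TB s t mod n = (if TB then t mod n else s mod n)" for s t
    using n by (auto simp: swap_index_def)
  have "partial_tr m n TA TB (kron A B) $$ (i, j) = tmat n (entries A) (entries B) (swap_index n TA TB i j) (swap_index n TA TB j i)"
    using ij kron_entry[OF AB swap_index_lt[OF ij] swap_index_lt[OF ij(2,1)]] by (simp add: partial_tr_def)
  also have "\<dots> = tmat n (transp_if TA (entries A)) (transp_if TB (entries B)) i j" by (simp add: tmat_def d transp_if_def)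
  finally show "partial_tr m n TA TB (kron A B) $$ (i, j) = kron (transp_mat TA A) (transp_mat TB B) $$ (i, j)"
    using kron_transp_entry[OF AB ij] by simp
qed

lemma kron_transpose:
  assumes AB: "A \<in> carrier_mat m m" "B \<in> carrier_mat n n"
  shows "transpose_mat (kron A B) = kron (transpose_mat A) (transpose_mat B)"
  using AB div_mod_lt[of _ m n] by (intro eq_matI) (auto simp: kron_def)

section \<open>The theorem\<close>

lemma conj_by_cong:
  assumes "\<And>s i. s < N \<Longrightarrow> i < N \<Longrightarrow> u s i = v s i" "\<And>s t. s < N \<Longrightarrow> t < N \<Longrightarrow> G s t = H s t" "i < N" "j < N"
  shows "conj_by N u G i j = conj_by N v H i j"
  unfolding conj_by_def using assms by (intro sum.cong refl) auto

lemma conj_carrier: "U \<in> carrier_mat N N \<Longrightarrow> M \<in> carrier_mat N N \<Longrightarrow> U * M * mat_adjoint U \<in> carrier_mat N N"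
  using adjoint_carrier[of U N N] by (metis mult_carrier_mat)

definition standard_form ::
  "nat \<Rightarrow> nat \<Rightarrow> nat \<Rightarrow> (complex mat \<Rightarrow> complex mat) \<Rightarrow> complex mat \<Rightarrow> (complex mat \<Rightarrow> complex mat \<Rightarrow> complex mat) \<Rightarrow> bool" where
  "standard_form m n k \<phi> U P \<longleftrightarrow>
    (\<forall>A \<in> carrier_mat m m. \<forall>B \<in> carrier_mat n n. \<phi> (kron A B) = U * P A B * mat_adjoint U) \<or>
    m * n = 2 * k \<and> (\<forall>A \<in> carrier_mat m m. \<forall>B \<in> carrier_mat n n.
      \<phi> (kron A B) = (mat_trace (kron A B) / of_nat k) \<cdot>\<^sub>m 1\<^sub>m (m * n) - U * P A B * mat_adjoint U)"

abbreviation factor_transp :: "bool \<Rightarrow> bool \<Rightarrow> complex mat \<Rightarrow> complex mat \<Rightarrow> complex mat" where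
  "factor_transp TA TB \<equiv> \<lambda>A B. kron (transp_mat TA A) (transp_mat TB B)"

lemma pattern_imp_preserves:
  assumes mn: "2 \<le> m" "2 \<le> n" and k: "0 < k" and T: "TA = TB \<or> min m n \<le> 2"
    and phi: "mat_linear_map (m * n) \<phi>" and U: "unitary_mat (m * n) U"
    and AB: "A \<in> carrier_mat m m" "B \<in> carrier_mat n n"
    and form: "standard_form m n k \<phi> U (factor_transp TA TB)"
  shows "k_numerical_range k (\<phi> (kron A B)) = k_numerical_range k (kron A B)"
proof -
  let ?N = "m * n" and ?K = "kron (transp_mat TA A) (transp_mat TB B)"
  let ?v = "\<lambda>s i. U $$ (i, s)"
  have UC: "U \<in> carrier_mat ?N ?N" using U by (simp add: unitary_mat_def)
  have v: "orthonormal ?N ?N ?v" using unitary_iff_orthonormal[OF UC] U by simp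
  have K: "?K \<in> carrier_mat ?N ?N" by (intro kron_carrier transp_mat_carrier AB)
  have c: "kron A B \<in> carrier_mat ?N ?N" by (rule kron_carrier[OF AB])
  have WK: "trace_range ?N k (entries ?K) = trace_range ?N k (entries (kron A B))"
  proof -
    have "trace_range ?N k (entries ?K) = trace_range ?N k (tmat n (transp_if TA (entries A)) (transp_if TB (entries B)))"
      by (rule trace_range_cong) (rule kron_transp_entry[OF AB])
    then show ?thesis unfolding trace_range_transp_if[OF mn T] trace_range_kron[OF AB] .
  qed
  have "\<phi> (kron A B) = U * ?K * mat_adjoint U \<or>
      ?N = 2 * k \<and> \<phi> (kron A B) = (mat_trace (kron A B) / of_nat k) \<cdot>\<^sub>m 1\<^sub>m ?N - U * ?K * mat_adjoint U"
    using form AB unfolding standard_form_def by blast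
  then have "trace_range ?N k (entries (\<phi> (kron A B))) = trace_range ?N k (entries (kron A B))"
  proof
    assume f: "\<phi> (kron A B) = U * ?K * mat_adjoint U"
    have "trace_range ?N k (entries (\<phi> (kron A B))) = trace_range ?N k (conj_by ?N ?v (entries ?K))"
      unfolding f by (rule trace_range_cong) (rule conj_entry[OF UC K])
    then show ?thesis unfolding trace_range_conj_by[OF v] WK .
  next
    assume f: "?N = 2 * k \<and> \<phi> (kron A B) = (mat_trace (kron A B) / of_nat k) \<cdot>\<^sub>m 1\<^sub>m ?N - U * ?K * mat_adjoint U"
    let ?G = "conj_by ?N ?v (entries ?K)"
    have "(\<Sum>l<?N. entries ?K l l) = (\<Sum>l<?N. tmat n (transp_if TA (entries A)) (transp_if TB (entries B)) l l)"
      by (intro sum.cong refl) (simp add: kron_transp_entry[OF AB])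
    then have t: "mat_trace (kron A B) = (\<Sum>l<?N. ?G l l)"
      unfolding trace_conj_by[OF v] trace_kron[OF AB] trace_tmat_transp_if[of n TA "entries A" TB "entries B"] by simp
    have "trace_range ?N k (entries (\<phi> (kron A B))) = trace_range ?N k (\<lambda>i j. (\<Sum>l<?N. ?G l l) / of_nat k * of_bool (i = j) - ?G i j)"
    proof (rule trace_range_cong)
      fix i j assume ij: "i < ?N" "j < ?N"
      have "entries (\<phi> (kron A B)) i j = (mat_trace (kron A B) / of_nat k) * of_bool (i = j) - entries (U * ?K * mat_adjoint U) i j"
        using ij carrier_matD[OF conj_carrier[OF UC K]] f by simp
      then show "entries (\<phi> (kron A B)) i j = (\<Sum>l<?N. ?G l l) / of_nat k * of_bool (i = j) - ?G i j"
        unfolding conj_entry[OF UC K ij] t .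
    qed
    also have "\<dots> = trace_range ?N k ?G" using f k by (intro trace_range_reflect) auto
    finally show ?thesis unfolding trace_range_conj_by[OF v] WK .
  qed
  then show ?thesis using k_numerical_range_eq_iff[OF mat_linear_mapD(1)[OF phi c] c k] by simp
qed

lemma preserves_imp_pattern:
  assumes mn: "2 \<le> m" "2 \<le> n" and k: "0 < k" "k < m * n" and phi: "mat_linear_map (m * n) \<phi>"
    and pres: "\<And>A B. A \<in> carrier_mat m m \<Longrightarrow> B \<in> carrier_mat n n \<Longrightarrow>
      k_numerical_range k (\<phi> (kron A B)) = k_numerical_range k (kron A B)"
  obtains U TA TB where "unitary_mat (m * n) U" "TA = TB \<or> min m n \<le> 2"
    "standard_form m n k \<phi> U (factor_transp TA TB)"
proof -
  let ?N = "m * n"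
  define D where "D = (\<lambda>p q i j. \<phi> (matrix_unit ?N p q) $$ (i, j))"
  have phi_entry: "entries (\<phi> (kron A B)) i j = lin_ext ?N D (tmat n (entries A) (entries B)) i j"
    if AB: "A \<in> carrier_mat m m" "B \<in> carrier_mat n n" and ij: "i < ?N" "j < ?N" for A B i j
  proof -
    have "lin_ext ?N D (entries (kron A B)) = lin_ext ?N D (tmat n (entries A) (entries B))"
      by (rule lin_ext_cong) (rule kron_entry[OF AB])
    then show ?thesis unfolding mat_linear_lin_ext[OF phi kron_carrier[OF AB] ij] D_def[symmetric] by simp
  qed
  interpret P: preserver m n k D
  proof
    show "2 \<le> m" "2 \<le> n" "0 < k" "k < m * n" by fact+
    fix A B :: "nat \<Rightarrow> nat \<Rightarrow> complex"
    define A' where "A' = mat m m (\<lambda>(i, j). A i j)"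
    define B' where "B' = mat n n (\<lambda>(i, j). B i j)"
    have AB: "A' \<in> carrier_mat m m" "B' \<in> carrier_mat n n" by (auto simp: A'_def B'_def)
    have e: "tmat n A B i j = tmat n (entries A') (entries B') i j" if "i < ?N" "j < ?N" for i j
      using div_mod_lt[OF that(1)] div_mod_lt[OF that(2)] by (simp add: tmat_def A'_def B'_def)
    have "trace_range ?N k (lin_ext ?N D (tmat n A B)) = trace_range ?N k (lin_ext ?N D (tmat n (entries A') (entries B')))"
      using lin_ext_cong[of ?N "tmat n A B" "tmat n (entries A') (entries B')" D] e by simp
    also have "\<dots> = trace_range ?N k (entries (\<phi> (kron A' B')))" by (rule trace_range_cong) (simp add: phi_entry[OF AB])
    also have "\<dots> = trace_range ?N k (entries (kron A' B'))"
      using pres[OF AB] k_numerical_range_eq_iff[OF mat_linear_mapD(1)[OF phi kron_carrier[OF AB]] kron_carrier[OF AB] k(1)] by simp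
    also have "\<dots> = trace_range ?N k (tmat n A B)" unfolding trace_range_kron[OF AB] by (rule trace_range_cong) (simp add: e)
    finally show "trace_range ?N k (lin_ext ?N D (tmat n A B)) = trace_range ?N k (tmat n A B)" .
  qed
  obtain v TA TB where v: "orthonormal ?N ?N v" and T: "TA = TB \<or> min m n \<le> 2" and alt:
    "(\<forall>A B. \<forall>i<?N. \<forall>j<?N. lin_ext ?N D (tmat n A B) i j = conj_by ?N v (tmat n (transp_if TA A) (transp_if TB B)) i j) \<or>
     ?N = 2 * k \<and> (\<forall>A B. \<forall>i<?N. \<forall>j<?N. lin_ext ?N D (tmat n A B) i j = (\<Sum>l<?N. tmat n A B l l) / of_nat k * of_bool (i = j)
        - conj_by ?N v (tmat n (transp_if TA A) (transp_if TB B)) i j)"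
    using P.preserver_form by blast
  define U where "U = mat ?N ?N (\<lambda>(i, s). v s i)"
  have UC: "U \<in> carrier_mat ?N ?N" by (simp add: U_def)
  have "ip ?N (\<lambda>i. U $$ (i, a)) (\<lambda>i. U $$ (i, b)) = ip ?N (v a) (v b)" if "a < ?N" "b < ?N" for a b
    using that by (intro ip_cong) (auto simp: U_def)
  then have U: "unitary_mat ?N U" using v unfolding unitary_iff_orthonormal[OF UC] by (simp add: orthonormal_def)
  have conj: "entries (U * kron (transp_mat TA A) (transp_mat TB B) * mat_adjoint U) i j
      = conj_by ?N v (tmat n (transp_if TA (entries A)) (transp_if TB (entries B))) i j"
    and KC: "U * kron (transp_mat TA A) (transp_mat TB B) * mat_adjoint U \<in> carrier_mat ?N ?N"
    if AB: "A \<in> carrier_mat m m" "B \<in> carrier_mat n n" and ij: "i < ?N" "j < ?N" for A B i j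
  proof -
    have K: "kron (transp_mat TA A) (transp_mat TB B) \<in> carrier_mat ?N ?N" by (intro kron_carrier transp_mat_carrier AB)
    show "entries (U * kron (transp_mat TA A) (transp_mat TB B) * mat_adjoint U) i j
      = conj_by ?N v (tmat n (transp_if TA (entries A)) (transp_if TB (entries B))) i j"
      unfolding conj_entry[OF UC K ij] using ij
      by (intro conj_by_cong) (auto simp: U_def kron_transp_entry[OF AB])
    show "U * kron (transp_mat TA A) (transp_mat TB B) * mat_adjoint U \<in> carrier_mat ?N ?N" by (rule conj_carrier[OF UC K])
  qed
  have N0: "0 < ?N" by (rule P.N_gt)
  have KC': "U * kron (transp_mat TA A) (transp_mat TB B) * mat_adjoint U \<in> carrier_mat ?N ?N"
    if "A \<in> carrier_mat m m" "B \<in> carrier_mat n n" for A B by (rule KC[OF that N0 N0])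
  have phiC: "\<phi> (kron A B) \<in> carrier_mat ?N ?N" if "A \<in> carrier_mat m m" "B \<in> carrier_mat n n" for A B
    by (rule mat_linear_mapD(1)[OF phi kron_carrier[OF that]])
  show ?thesis
  proof (rule that[OF U T], use alt in \<open>elim disjE conjE\<close>)
    assume f: "\<forall>A B. \<forall>i<?N. \<forall>j<?N. lin_ext ?N D (tmat n A B) i j = conj_by ?N v (tmat n (transp_if TA A) (transp_if TB B)) i j"
    show "standard_form m n k \<phi> U (factor_transp TA TB)"
      unfolding standard_form_def
    proof (intro disjI1 ballI)
      fix A B :: "complex mat" assume AB: "A \<in> carrier_mat m m" "B \<in> carrier_mat n n"
      show "\<phi> (kron A B) = U * kron (transp_mat TA A) (transp_mat TB B) * mat_adjoint U"
      proof (rule eq_matI)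
        fix i j assume "i < dim_row (U * kron (transp_mat TA A) (transp_mat TB B) * mat_adjoint U)"
          "j < dim_col (U * kron (transp_mat TA A) (transp_mat TB B) * mat_adjoint U)"
        then have ij: "i < ?N" "j < ?N" using carrier_matD[OF KC'[OF AB]] by simp_all
        show "\<phi> (kron A B) $$ (i, j) = (U * kron (transp_mat TA A) (transp_mat TB B) * mat_adjoint U) $$ (i, j)"
          unfolding phi_entry[OF AB ij] conj[OF AB ij] using f ij by blast
      qed (use carrier_matD[OF KC'[OF AB]] carrier_matD[OF phiC[OF AB]] in simp_all)
    qed
  next
    assume half: "?N = 2 * k" and
      f: "\<forall>A B. \<forall>i<?N. \<forall>j<?N. lin_ext ?N D (tmat n A B) i j = (\<Sum>l<?N. tmat n A B l l) / of_nat k * of_bool (i = j)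
        - conj_by ?N v (tmat n (transp_if TA A) (transp_if TB B)) i j"
    show "standard_form m n k \<phi> U (factor_transp TA TB)"
      unfolding standard_form_def
    proof (intro disjI2 conjI ballI half)
      fix A B :: "complex mat" assume AB: "A \<in> carrier_mat m m" "B \<in> carrier_mat n n"
      let ?R = "(mat_trace (kron A B) / of_nat k) \<cdot>\<^sub>m 1\<^sub>m ?N - U * kron (transp_mat TA A) (transp_mat TB B) * mat_adjoint U"
      have R: "?R \<in> carrier_mat ?N ?N" by (rule minus_carrier_mat[OF KC'[OF AB]])
      show "\<phi> (kron A B) = ?R"
      proof (rule eq_matI)
        fix i j assume "i < dim_row ?R" "j < dim_col ?R"
        then have ij: "i < ?N" "j < ?N" using carrier_matD[OF R] by simp_all
        have "?R $$ (i, j) = mat_trace (kron A B) / of_nat k * of_bool (i = j)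
            - (U * kron (transp_mat TA A) (transp_mat TB B) * mat_adjoint U) $$ (i, j)"
          using ij carrier_matD[OF KC'[OF AB]] by simp
        then show "\<phi> (kron A B) $$ (i, j) = ?R $$ (i, j)"
          unfolding phi_entry[OF AB ij] conj[OF AB ij] trace_kron[OF AB] using f ij by simp
      qed (use carrier_matD[OF R] carrier_matD[OF phiC[OF AB]] in simp_all)
    qed
  qed
qed

theorem theorem1p1:
  fixes m n k :: nat and \<phi> :: "complex mat \<Rightarrow> complex mat"
  assumes "m \<ge> 2" and "n \<ge> 2" and "k \<in> {1..m * n - 1}"
    and "mat_linear_map (m * n) \<phi>"
  shows
    "(\<forall>A \<in> carrier_mat m m. \<forall>B \<in> carrier_mat n n.
        k_numerical_range k (\<phi> (kron A B)) = k_numerical_range k (kron A B))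
     \<longleftrightarrow>
     (\<exists>U \<psi>. unitary_mat (m * n) U \<and> mat_linear_map (m * n) \<psi> \<and>
        ((\<forall>A \<in> carrier_mat m m. \<forall>B \<in> carrier_mat n n. \<psi> (kron A B) = kron A B) \<or>
         (\<forall>A \<in> carrier_mat m m. \<forall>B \<in> carrier_mat n n. \<psi> (kron A B) = transpose_mat (kron A B)) \<or>
         min m n \<le> 2 \<and>
         ((\<forall>A \<in> carrier_mat m m. \<forall>B \<in> carrier_mat n n. \<psi> (kron A B) = kron A (transpose_mat B)) \<or>
          (\<forall>A \<in> carrier_mat m m. \<forall>B \<in> carrier_mat n n. \<psi> (kron A B) = kron (transpose_mat A) B))) \<and>
        ((\<forall>A \<in> carrier_mat m m. \<forall>B \<in> carrier_mat n n.
            \<phi> (kron A B) = U * \<psi> (kron A B) * mat_adjoint U) \<or>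
         m * n = 2 * k \<and>
         (\<forall>A \<in> carrier_mat m m. \<forall>B \<in> carrier_mat n n.
            \<phi> (kron A B) = (mat_trace (kron A B) / of_nat k) \<cdot>\<^sub>m 1\<^sub>m (m * n)
                              - U * \<psi> (kron A B) * mat_adjoint U)))"
proof -
  have k: "0 < k" "k < m * n" using assms(3) mult_le_mono[OF assms(1,2)] by auto
  \<comment> \<open>The four listed forms of the inner map are the four choices of factors to transpose.\<close>
  have four: "(\<exists>TA TB. (TA = TB \<or> min m n \<le> 2) \<and>
      (\<forall>A \<in> carrier_mat m m. \<forall>B \<in> carrier_mat n n. \<psi> (kron A B) = factor_transp TA TB A B)) \<longleftrightarrow>
    ((\<forall>A \<in> carrier_mat m m. \<forall>B \<in> carrier_mat n n. \<psi> (kron A B) = kron A B) \<or>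
     (\<forall>A \<in> carrier_mat m m. \<forall>B \<in> carrier_mat n n. \<psi> (kron A B) = transpose_mat (kron A B)) \<or>
     min m n \<le> 2 \<and>
     ((\<forall>A \<in> carrier_mat m m. \<forall>B \<in> carrier_mat n n. \<psi> (kron A B) = kron A (transpose_mat B)) \<or>
      (\<forall>A \<in> carrier_mat m m. \<forall>B \<in> carrier_mat n n. \<psi> (kron A B) = kron (transpose_mat A) B)))" for \<psi>
    by (simp add: ex_bool_eq transp_mat_def kron_transpose[of _ m _ n] cong: ball_cong) blast
  have form_cong: "standard_form m n k \<phi> U P = standard_form m n k \<phi> U Q"
    if "\<And>A B. A \<in> carrier_mat m m \<Longrightarrow> B \<in> carrier_mat n n \<Longrightarrow> P A B = Q A B" for U P Q
    unfolding standard_form_def using that by (simp cong: ball_cong)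
  show ?thesis
    unfolding four[symmetric] standard_form_def[symmetric, where P = "\<lambda>A B. _ (kron A B)"]
  proof (intro iffI)
    assume "\<forall>A \<in> carrier_mat m m. \<forall>B \<in> carrier_mat n n.
      k_numerical_range k (\<phi> (kron A B)) = k_numerical_range k (kron A B)"
    then obtain U TA TB where U: "unitary_mat (m * n) U" and T: "TA = TB \<or> min m n \<le> 2"
      and f: "standard_form m n k \<phi> U (factor_transp TA TB)"
      using preserves_imp_pattern[OF assms(1,2) k assms(4)] by metis
    show "\<exists>U \<psi>. unitary_mat (m * n) U \<and> mat_linear_map (m * n) \<psi> \<and>
      (\<exists>TA TB. (TA = TB \<or> min m n \<le> 2) \<and>
        (\<forall>A \<in> carrier_mat m m. \<forall>B \<in> carrier_mat n n. \<psi> (kron A B) = factor_transp TA TB A B)) \<and>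
      standard_form m n k \<phi> U (\<lambda>A B. \<psi> (kron A B))"
    proof (intro exI[of _ U] exI[of _ "partial_tr m n TA TB"] conjI U partial_tr_linear)
      show "\<exists>TA' TB'. (TA' = TB' \<or> min m n \<le> 2) \<and> (\<forall>A \<in> carrier_mat m m. \<forall>B \<in> carrier_mat n n.
          partial_tr m n TA TB (kron A B) = factor_transp TA' TB' A B)"
        by (intro exI[of _ TA] exI[of _ TB] conjI ballI T partial_tr_kron)
      show "standard_form m n k \<phi> U (\<lambda>A B. partial_tr m n TA TB (kron A B))"
        using f by (subst form_cong[OF partial_tr_kron])
    qed
  next
    assume "\<exists>U \<psi>. unitary_mat (m * n) U \<and> mat_linear_map (m * n) \<psi> \<and>
      (\<exists>TA TB. (TA = TB \<or> min m n \<le> 2) \<and>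
        (\<forall>A \<in> carrier_mat m m. \<forall>B \<in> carrier_mat n n. \<psi> (kron A B) = factor_transp TA TB A B)) \<and>
      standard_form m n k \<phi> U (\<lambda>A B. \<psi> (kron A B))"
    then obtain U \<psi> TA TB where U: "unitary_mat (m * n) U" and T: "TA = TB \<or> min m n \<le> 2"
      and psi: "\<forall>A \<in> carrier_mat m m. \<forall>B \<in> carrier_mat n n. \<psi> (kron A B) = factor_transp TA TB A B"
      and f: "standard_form m n k \<phi> U (\<lambda>A B. \<psi> (kron A B))"
      by (elim exE conjE) (rule that)
    have "standard_form m n k \<phi> U (factor_transp TA TB)"
      using f form_cong[of "\<lambda>A B. \<psi> (kron A B)" "factor_transp TA TB" U] psi by blast
    then show "\<forall>A \<in> carrier_mat m m. \<forall>B \<in> carrier_mat n n.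
      k_numerical_range k (\<phi> (kron A B)) = k_numerical_range k (kron A B)"
      by (intro ballI pattern_imp_preserves[OF assms(1,2) k(1) T assms(4) U])
  qed
qed

end
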